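(* Let $A$ be a unital $C^*$-algebra. Let $V_1$ and $V_2$ be two smooth Hilbert $A$-module bundles on a paracompact manifold $M$ which are topologically isomorphic (the isomorphism is not necessarily smooth). Then there is also a smooth isomorphism between the two bundles. In other words, up to isomorphism there is at most one smooth structure on a given Hilbert $A$-module bundle.
   Context: A Hilbert $A$-module is a right $A$-module with an $A$-valued inner product, complete in the induced norm; $\operatorname{Hom}_A(V,W)$ is the Banach space of continuous $A$-linear adjointable maps with operator norm. A Hilbert $A$-module bundle over $M$ is a locally trivial bundle whose fibers are Hilbert $A$-modules, with local trivializations that are fiberwise Hilbert $A$-module isomorphisms. A smooth structure is an atlas of local trivializations whose transition functions $x\mapsto\phi_2\circ\phi_1^{-1}(x)$ are smooth maps into the Banach spaces $\operatorname{Hom}_A(V_1,V_2)$. Given two smooth bundles, the bundle $\operatorname{Hom}_A(V_1,V_2)$ of fiberwise adjointable maps inherits a smooth structure; a bundle isomorphism is a continuous section of it with invertible values, and it is smooth if this section is smooth. *)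

theory Defs
  imports "HOL-Analysis.Analysis"
begin

section \<open>Smooth maps and smooth manifolds\<close>

text \<open>
  Manifolds are modelled on a finite-dimensional inner product space. The class
  \<open>euclidean_space\<close> is not used for this because it excludes dimension 0.
\<close>

definition finite_dimensional :: "'n::real_vector itself \<Rightarrow> bool" where
  "finite_dimensional _ \<longleftrightarrow> (\<exists>B :: 'n set. finite B \<and> span B = UNIV)"

text \<open>
  For finite-dimensional domains, and on open sets \<open>S\<close>, continuity of all directional
  derivatives up to order \<open>k\<close> is the same as continuity of the Frechet derivatives up to
  order \<open>k\<close> in operator norm.
\<close>

primrec Ck_on :: "nat \<Rightarrow> ('n::real_normed_vector \<Rightarrow> 'b::real_normed_vector) \<Rightarrow> 'n set \<Rightarrow> bool" where
  "Ck_on 0 f S \<longleftrightarrow> continuous_on S f"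
| "Ck_on (Suc k) f S \<longleftrightarrow>
     (\<forall>x\<in>S. f differentiable (at x)) \<and>
     (\<forall>v. Ck_on k (\<lambda>x. frechet_derivative f (at x) v) S)"

definition smooth_on :: "'n set \<Rightarrow> ('n::real_normed_vector \<Rightarrow> 'b::real_normed_vector) \<Rightarrow> bool" where
  "smooth_on S f \<longleftrightarrow> (\<forall>k. Ck_on k f S)"

type_synonym ('m, 'n) chart = "'m set \<times> ('m \<Rightarrow> 'n)"

definition smooth_atlas :: "'m topology \<Rightarrow> ('m, 'n::real_inner) chart set \<Rightarrow> bool" where
  "smooth_atlas M \<A> \<longleftrightarrow>
     finite_dimensional TYPE('n) \<and>
     (\<forall>(U, \<kappa>)\<in>\<A>. openin M U \<and> open (\<kappa> ` U) \<and>
        homeomorphic_map (subtopology M U) (top_of_set (\<kappa> ` U)) \<kappa>) \<and>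
     (\<Union>(U, \<kappa>)\<in>\<A>. U) = topspace M \<and>
     (\<forall>(U, \<kappa>)\<in>\<A>. \<forall>(U', \<kappa>')\<in>\<A>. smooth_on (\<kappa> ` (U \<inter> U')) (\<kappa>' \<circ> inv_into U \<kappa>))"

definition smooth_manifold :: "'m topology \<Rightarrow> ('m, 'n::real_inner) chart set \<Rightarrow> bool" where
  "smooth_manifold M \<A> \<longleftrightarrow> Hausdorff_space M \<and> smooth_atlas M \<A>"

definition paracompact_space :: "'m topology \<Rightarrow> bool" where
  "paracompact_space M \<longleftrightarrow>
     (\<forall>\<U>. (\<forall>U\<in>\<U>. openin M U) \<and> \<Union>\<U> = topspace M \<longrightarrow>
        (\<exists>\<V>. (\<forall>V\<in>\<V>. openin M V \<and> (\<exists>U\<in>\<U>. V \<subseteq> U)) \<and> \<Union>\<V> = topspace M \<and>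
             locally_finite_in M \<V>))"

definition smooth_map_on ::
    "('m, 'n::real_inner) chart set \<Rightarrow> 'm set \<Rightarrow> ('m \<Rightarrow> 'b::real_normed_vector) \<Rightarrow> bool" where
  "smooth_map_on \<A> W f \<longleftrightarrow> (\<forall>(U, \<kappa>)\<in>\<A>. smooth_on (\<kappa> ` (U \<inter> W)) (f \<circ> inv_into U \<kappa>))"


section \<open>Unital \<open>C\<^sup>*\<close>-algebras\<close>

text \<open>
  The class \<open>real_normed_algebra_1\<close> would exclude the zero algebra; for nonzero algebras
  \<open>norm 1 = 1\<close> follows from the \<open>C\<^sup>*\<close>-identity.
\<close>

class unital_cstar_algebra = real_normed_algebra + monoid_mult + banach +
  fixes scaleC :: "complex \<Rightarrow> 'a \<Rightarrow> 'a" (infixr "*\<^sub>C" 75)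
    and star :: "'a \<Rightarrow> 'a"
  assumes scaleC_add_right: "c *\<^sub>C (x + y) = c *\<^sub>C x + c *\<^sub>C y"
    and scaleC_add_left: "(c + d) *\<^sub>C x = c *\<^sub>C x + d *\<^sub>C x"
    and scaleC_scaleC: "c *\<^sub>C (d *\<^sub>C x) = (c * d) *\<^sub>C x"
    and scaleC_of_real: "complex_of_real r *\<^sub>C x = r *\<^sub>R x"
    and mult_scaleC_left: "(c *\<^sub>C x) * y = c *\<^sub>C (x * y)"
    and mult_scaleC_right: "x * (c *\<^sub>C y) = c *\<^sub>C (x * y)"
    and norm_scaleC: "norm (c *\<^sub>C x) = cmod c * norm x"
    and star_star: "star (star x) = x"
    and star_add: "star (x + y) = star x + star y"
    and star_scaleC: "star (c *\<^sub>C x) = cnj c *\<^sub>C star x"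
    and star_mult: "star (x * y) = star y * star x"
    and cstar_identity: "norm (star x * x) = (norm x)\<^sup>2"

definition positive_element :: "'a::unital_cstar_algebra \<Rightarrow> bool" where
  "positive_element a \<longleftrightarrow> (\<exists>b. a = star b * b)"


section \<open>Hilbert modules\<close>

text \<open>
  Hilbert modules are realised as linear subspaces of an ambient normed space \<open>'v\<close> which
  carries their norm. The ambient space allows modules that are not isomorphic to each other,
  such as the fibres of a bundle over different components of the base, to live in one type.
  It is no restriction: any family of Hilbert modules, indexed by a set, embeds isometrically
  into its algebraic direct sum with the \<open>\<ell>\<^sup>1\<close>-norm.
\<close>

record ('a, 'v) hmodule =
  carrier :: "'v set"
  act :: "'v \<Rightarrow> 'a \<Rightarrow> 'v"
  ip :: "'v \<Rightarrow> 'v \<Rightarrow> 'a"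

text \<open>
  The complex scalar multiplication is \<open>act v (c *\<^sub>C 1)\<close>; \<open>act_scaleR\<close> says that it
  extends the real one of \<open>'v\<close>. Definiteness of the inner product is part of \<open>norm_ip\<close>.
\<close>

locale hilbert_module =
  fixes V :: "('a::unital_cstar_algebra, 'v::real_normed_vector) hmodule"
  assumes subspace_carrier: "subspace (carrier V)"
    and act_closed: "v \<in> carrier V \<Longrightarrow> act V v a \<in> carrier V"
    and act_add_left: "v \<in> carrier V \<Longrightarrow> w \<in> carrier V \<Longrightarrow> act V (v + w) a = act V v a + act V w a"
    and act_add_right: "v \<in> carrier V \<Longrightarrow> act V v (a + b) = act V v a + act V v b"
    and act_mult: "v \<in> carrier V \<Longrightarrow> act V v (a * b) = act V (act V v a) b"
    and act_one: "v \<in> carrier V \<Longrightarrow> act V v 1 = v"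
    and act_scaleR: "v \<in> carrier V \<Longrightarrow> act V v (r *\<^sub>R 1) = r *\<^sub>R v"
    and ip_add_right: "u \<in> carrier V \<Longrightarrow> v \<in> carrier V \<Longrightarrow> w \<in> carrier V \<Longrightarrow>
           ip V u (v + w) = ip V u v + ip V u w"
    and ip_act_right: "v \<in> carrier V \<Longrightarrow> w \<in> carrier V \<Longrightarrow> ip V v (act V w a) = ip V v w * a"
    and ip_star: "v \<in> carrier V \<Longrightarrow> w \<in> carrier V \<Longrightarrow> ip V w v = star (ip V v w)"
    and ip_positive: "v \<in> carrier V \<Longrightarrow> positive_element (ip V v v)"
    and norm_ip: "v \<in> carrier V \<Longrightarrow> norm v = sqrt (norm (ip V v v))"
    and complete_carrier: "complete (carrier V)"

text \<open>Isomorphisms of Hilbert modules preserve the whole structure, including the inner product.\<close>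

definition hmodule_iso ::
    "('a::unital_cstar_algebra, 'v::real_normed_vector) hmodule \<Rightarrow>
     ('a, 'w::real_normed_vector) hmodule \<Rightarrow> ('v \<Rightarrow> 'w) \<Rightarrow> bool" where
  "hmodule_iso V W f \<longleftrightarrow>
     bij_betw f (carrier V) (carrier W) \<and>
     (\<forall>u\<in>carrier V. \<forall>v\<in>carrier V. f (u + v) = f u + f v) \<and>
     (\<forall>v\<in>carrier V. \<forall>a. f (act V v a) = act W (f v) a) \<and>
     (\<forall>u\<in>carrier V. \<forall>v\<in>carrier V. ip W (f u) (f v) = ip V u v)"


section \<open>The Banach space of adjointable maps\<close>

text \<open>
  Adjointable maps between modules \<open>V\<close> and \<open>W\<close>, which are subspaces only, are extended by zero
  to the ambient types. They are then elements of the following normed space of maps, which are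
  bounded but need not be linear; for an extension by zero of a bounded linear map on \<open>carrier V\<close>,
  the norm below is its operator norm.
\<close>

typedef (overloaded) ('v, 'w) bounded_map =
  "{f :: 'v::real_normed_vector \<Rightarrow> 'w::real_normed_vector. \<exists>K. \<forall>v. norm (f v) \<le> K * norm v}"
  morphisms apply_map Bounded_map
  by (rule exI[of _ "\<lambda>_. 0"]) (auto intro: exI[of _ 0])

setup_lifting type_definition_bounded_map

lemma bounded_map_eqI: "(\<And>v. apply_map f v = apply_map g v) \<Longrightarrow> f = g"
  by transfer auto

lemma bounded_map_bdd_above:
  assumes "\<exists>K. \<forall>v. norm (f v) \<le> K * norm v"
  shows "bdd_above (range (\<lambda>v. norm (f v) / norm v))"
proof -
  obtain K where K: "\<And>v. norm (f v) \<le> K * norm v" using assms by blast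
  have "norm (f v) / norm v \<le> max K 0" for v
    using K[of v] by (cases "norm v = 0") (auto simp: divide_simps intro: order_trans mult_right_mono)
  then show ?thesis by (auto intro!: bdd_aboveI)
qed

lemma bounded_map_le_onorm:
  assumes "\<exists>K. \<forall>v. norm (f v) \<le> K * norm v"
  shows "norm (f v) \<le> onorm f * norm v"
proof (cases "norm v = 0")
  case True
  with assms show ?thesis by (metis mult_zero_right)
next
  case False
  have "norm (f v) / norm v \<le> onorm f"
    unfolding onorm_def by (rule cSUP_upper[OF UNIV_I bounded_map_bdd_above[OF assms]])
  with False show ?thesis by (simp add: divide_simps split: if_splits)
qed

lemma bounded_map_onorm_le:
  assumes "\<And>v. norm (f v) \<le> K * norm v" "0 \<le> K"
  shows "onorm f \<le> K"
  unfolding onorm_def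
proof (rule cSUP_least)
  fix v show "norm (f v) / norm v \<le> K"
    using assms(1)[of v] assms(2) by (cases "norm v = 0") (auto simp: divide_simps)
qed simp

lemma bounded_map_onorm_nonneg:
  assumes "\<exists>K. \<forall>v. norm (f v) \<le> K * norm v"
  shows "0 \<le> onorm f"
  unfolding onorm_def
  by (rule cSUP_upper2[of _ _ 0, OF bounded_map_bdd_above[OF assms]]) auto

instantiation bounded_map :: (real_normed_vector, real_normed_vector) real_normed_vector
begin

lift_definition zero_bounded_map :: "('a, 'b) bounded_map" is "\<lambda>_. 0"
  by (auto intro: exI[of _ 0])

lift_definition plus_bounded_map :: "('a, 'b) bounded_map \<Rightarrow> ('a, 'b) bounded_map \<Rightarrow> ('a, 'b) bounded_map"
  is "\<lambda>f g v. f v + g v"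
proof -
  fix f g :: "'a \<Rightarrow> 'b"
  assume "\<exists>K. \<forall>v. norm (f v) \<le> K * norm v" "\<exists>K. \<forall>v. norm (g v) \<le> K * norm v"
  then obtain K L where "\<And>v. norm (f v) \<le> K * norm v" "\<And>v. norm (g v) \<le> L * norm v" by blast
  then have "\<forall>v. norm (f v + g v) \<le> (K + L) * norm v"
    by (metis add_mono distrib_right norm_triangle_le)
  then show "\<exists>K. \<forall>v. norm (f v + g v) \<le> K * norm v" ..
qed

lift_definition uminus_bounded_map :: "('a, 'b) bounded_map \<Rightarrow> ('a, 'b) bounded_map"
  is "\<lambda>f v. - f v" by simp

lift_definition scaleR_bounded_map :: "real \<Rightarrow> ('a, 'b) bounded_map \<Rightarrow> ('a, 'b) bounded_map"
  is "\<lambda>r f v. r *\<^sub>R f v"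
proof -
  fix r :: real and f :: "'a \<Rightarrow> 'b"
  assume "\<exists>K. \<forall>v. norm (f v) \<le> K * norm v"
  then obtain K where "\<And>v. norm (f v) \<le> K * norm v" by blast
  then have "\<forall>v. norm (r *\<^sub>R f v) \<le> (\<bar>r\<bar> * K) * norm v"
    by (simp add: mult.assoc mult_left_mono)
  then show "\<exists>K. \<forall>v. norm (r *\<^sub>R f v) \<le> K * norm v" ..
qed

lift_definition norm_bounded_map :: "('a, 'b) bounded_map \<Rightarrow> real" is onorm .

definition minus_bounded_map :: "('a, 'b) bounded_map \<Rightarrow> ('a, 'b) bounded_map \<Rightarrow> ('a, 'b) bounded_map"
  where "minus_bounded_map f g = f + - g"

definition dist_bounded_map :: "('a, 'b) bounded_map \<Rightarrow> ('a, 'b) bounded_map \<Rightarrow> real"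
  where "dist_bounded_map f g = norm (f - g)"

definition sgn_bounded_map :: "('a, 'b) bounded_map \<Rightarrow> ('a, 'b) bounded_map"
  where "sgn_bounded_map f = scaleR (inverse (norm f)) f"

definition [code del]:
  "(uniformity :: (('a, 'b) bounded_map \<times> ('a, 'b) bounded_map) filter) =
     (INF e\<in>{0<..}. principal {(f, g). dist f g < e})"

definition open_bounded_map :: "('a, 'b) bounded_map set \<Rightarrow> bool" where [code del]:
  "open_bounded_map S = (\<forall>f\<in>S. \<forall>\<^sub>F (f', g) in uniformity. f' = f \<longrightarrow> g \<in> S)"

instance
proof
  fix f g h :: "('a, 'b) bounded_map" and r s :: real
  show "dist f g = norm (f - g)" by (rule dist_bounded_map_def)
  show "sgn f = inverse (norm f) *\<^sub>R f" by (rule sgn_bounded_map_def)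
  show "f - g = f + - g" by (rule minus_bounded_map_def)
  show "(uniformity :: (('a, 'b) bounded_map \<times> ('a, 'b) bounded_map) filter) =
     (INF e\<in>{0<..}. principal {(f, g). dist f g < e})"
    by (rule uniformity_bounded_map_def)
  show "f + g + h = f + (g + h)" by transfer (simp add: add.assoc)
  show "f + g = g + f" by transfer (simp add: add.commute)
  show "0 + f = f" by transfer simp
  show "- f + f = 0" by transfer simp
  show "r *\<^sub>R (f + g) = r *\<^sub>R f + r *\<^sub>R g" by transfer (simp add: scaleR_add_right)
  show "(r + s) *\<^sub>R f = r *\<^sub>R f + s *\<^sub>R f" by transfer (simp add: scaleR_add_left)
  show "r *\<^sub>R s *\<^sub>R f = (r * s) *\<^sub>R f" by transfer simp
  show "1 *\<^sub>R f = f" by transfer simp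
  show "(norm f = 0) = (f = 0)"
  proof
    assume "norm f = 0"
    then show "f = 0"
    proof transfer
      fix f :: "'a \<Rightarrow> 'b"
      assume "\<exists>K. \<forall>v. norm (f v) \<le> K * norm v" and "onorm f = 0"
      then have "norm (f v) \<le> 0" for v using bounded_map_le_onorm[of f v] by simp
      then show "f = (\<lambda>_. 0)" by auto
    qed
  next
    assume "f = 0"
    then show "norm f = 0" by transfer (simp add: onorm_def)
  qed
  show "norm (f + g) \<le> norm f + norm g"
  proof transfer
    fix f g :: "'a \<Rightarrow> 'b"
    assume fg: "\<exists>K. \<forall>v. norm (f v) \<le> K * norm v" "\<exists>K. \<forall>v. norm (g v) \<le> K * norm v"
    have "norm (f v + g v) \<le> (onorm f + onorm g) * norm v" for v
      using norm_triangle_ineq[of "f v" "g v"] bounded_map_le_onorm[OF fg(1), of v]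
        bounded_map_le_onorm[OF fg(2), of v] by (simp add: distrib_right)
    then show "onorm (\<lambda>v. f v + g v) \<le> onorm f + onorm g"
      by (rule bounded_map_onorm_le) (simp add: bounded_map_onorm_nonneg fg)
  qed
  show "norm (r *\<^sub>R f) = \<bar>r\<bar> * norm f"
  proof transfer
    fix r :: real and f :: "'a \<Rightarrow> 'b"
    assume f: "\<exists>K. \<forall>v. norm (f v) \<le> K * norm v"
    have le: "onorm (\<lambda>v. c *\<^sub>R h v) \<le> \<bar>c\<bar> * onorm h"
      if h: "\<exists>K. \<forall>v. norm (h v) \<le> K * norm v" for c :: real and h :: "'a \<Rightarrow> 'b"
    proof (rule bounded_map_onorm_le)
      fix v show "norm (c *\<^sub>R h v) \<le> \<bar>c\<bar> * onorm h * norm v"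
        using bounded_map_le_onorm[OF h, of v] by (simp add: mult.assoc mult_left_mono)
    qed (simp add: bounded_map_onorm_nonneg h)
    show "onorm (\<lambda>v. r *\<^sub>R f v) = \<bar>r\<bar> * onorm f"
    proof (cases "r = 0")
      case True
      then show ?thesis by (simp add: onorm_def)
    next
      case False
      have "norm (r *\<^sub>R f v) \<le> (\<bar>r\<bar> * onorm f) * norm v" for v
        using bounded_map_le_onorm[OF f, of v] by (simp add: mult.assoc mult_left_mono)
      then have "\<exists>K. \<forall>v. norm (r *\<^sub>R f v) \<le> K * norm v" by blast
      from le[OF this, of "inverse r"] False
      have "onorm f \<le> inverse \<bar>r\<bar> * onorm (\<lambda>v. r *\<^sub>R f v)" by simp
      with False have "\<bar>r\<bar> * onorm f \<le> onorm (\<lambda>v. r *\<^sub>R f v)"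
        by (simp add: field_simps)
      with le[OF f, of r] show ?thesis by simp
    qed
  qed
qed (rule open_bounded_map_def)

end

definition Hom ::
    "('a::unital_cstar_algebra, 'v::real_normed_vector) hmodule \<Rightarrow>
     ('a, 'w::real_normed_vector) hmodule \<Rightarrow> ('v, 'w) bounded_map set" where
  "Hom V W = {T.
     (\<forall>v. v \<notin> carrier V \<longrightarrow> apply_map T v = 0) \<and>
     (\<forall>v\<in>carrier V. apply_map T v \<in> carrier W) \<and>
     (\<forall>u\<in>carrier V. \<forall>v\<in>carrier V. apply_map T (u + v) = apply_map T u + apply_map T v) \<and>
     (\<forall>v\<in>carrier V. \<forall>a. apply_map T (act V v a) = act W (apply_map T v) a) \<and>
     (\<exists>S. (\<forall>w\<in>carrier W. S w \<in> carrier V) \<and>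
          (\<forall>v\<in>carrier V. \<forall>w\<in>carrier W. ip W (apply_map T v) w = ip V v (S w)))}"

definition invertible_hom ::
    "('a::unital_cstar_algebra, 'v::real_normed_vector) hmodule \<Rightarrow>
     ('a, 'w::real_normed_vector) hmodule \<Rightarrow> ('v, 'w) bounded_map \<Rightarrow> bool" where
  "invertible_hom V W T \<longleftrightarrow>
     T \<in> Hom V W \<and>
     (\<exists>S\<in>Hom W V. (\<forall>v\<in>carrier V. apply_map S (apply_map T v) = v) \<and>
                   (\<forall>w\<in>carrier W. apply_map T (apply_map S w) = w))"

definition as_hom ::
    "('a, 'v::real_normed_vector) hmodule \<Rightarrow> ('v \<Rightarrow> 'w::real_normed_vector) \<Rightarrow>
     ('v, 'w) bounded_map" where
  "as_hom V f = Bounded_map (\<lambda>v. if v \<in> carrier V then f v else 0)"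


section \<open>Hilbert module bundles\<close>

text \<open>
  The total space is the set of pairs of a base point and a vector in the fibre over it. Its
  topology is a datum of its own, unrelated to the topology of the ambient type \<open>'v\<close>; only the
  subspace topologies of the individual fibres are determined by the latter.
\<close>

record ('m, 'a, 'v) hbundle =
  fibre :: "'m \<Rightarrow> ('a, 'v) hmodule"
  total_space :: "('m \<times> 'v) topology"

record ('m, 'a, 'v, 'f) triv =
  triv_dom :: "'m set"
  model_fibre :: "('a, 'f) hmodule"
  triv_map :: "'m \<Rightarrow> 'v \<Rightarrow> 'f"

definition local_trivialization ::
    "'m topology \<Rightarrow> ('m, 'a::unital_cstar_algebra, 'v::real_normed_vector) hbundle \<Rightarrow>
     ('m, 'a, 'v, 'f::real_normed_vector) triv \<Rightarrow> bool" where
  "local_trivialization M E \<phi> \<longleftrightarrow>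
     openin M (triv_dom \<phi>) \<and>
     hilbert_module (model_fibre \<phi>) \<and>
     (\<forall>x\<in>triv_dom \<phi>. hmodule_iso (fibre E x) (model_fibre \<phi>) (triv_map \<phi> x)) \<and>
     homeomorphic_map
       (subtopology (total_space E) (SIGMA x:triv_dom \<phi>. carrier (fibre E x)))
       (prod_topology (subtopology M (triv_dom \<phi>)) (top_of_set (carrier (model_fibre \<phi>))))
       (\<lambda>(x, v). (x, triv_map \<phi> x v))"

text \<open>
  In the local triviality condition the model module may always be taken to be one of the fibres,
  hence to live in the same type \<open>'v\<close>.
\<close>

locale hilbert_module_bundle =
  fixes M :: "'m topology"
    and E :: "('m, 'a::unital_cstar_algebra, 'v::real_normed_vector) hbundle"
  assumes fibre_hilbert_module: "x \<in> topspace M \<Longrightarrow> hilbert_module (fibre E x)"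
    and topspace_total: "topspace (total_space E) = (SIGMA x:topspace M. carrier (fibre E x))"
    and locally_trivial: "x \<in> topspace M \<Longrightarrow>
          \<exists>\<phi> :: ('m, 'a, 'v, 'v) triv. local_trivialization M E \<phi> \<and> x \<in> triv_dom \<phi>"

text \<open>
  For adjointable \<open>s x\<close> between the fibres over \<open>x\<close>, \<open>local_hom E\<^sub>1 \<phi>\<^sub>1 \<phi>\<^sub>2 s x\<close> is
  \<open>\<phi>\<^sub>2(x) \<circ> s(x) \<circ> \<phi>\<^sub>1(x)\<^sup>-\<^sup>1\<close> as an element of \<open>Hom (model_fibre \<phi>\<^sub>1) (model_fibre \<phi>\<^sub>2)\<close>. This serves
  both for the transition functions of one bundle (with \<open>s\<close> the identity) and for the local
  trivializations of the bundle of fibrewise adjointable maps.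
\<close>

definition local_hom ::
    "('m, 'a::unital_cstar_algebra, 'v::real_normed_vector) hbundle \<Rightarrow>
     ('m, 'a, 'v, 'f::real_normed_vector) triv \<Rightarrow> ('m, 'a, 'w, 'g::real_normed_vector) triv \<Rightarrow>
     ('m \<Rightarrow> 'v \<Rightarrow> 'w) \<Rightarrow> 'm \<Rightarrow> ('f, 'g) bounded_map" where
  "local_hom E\<^sub>1 \<phi>\<^sub>1 \<phi>\<^sub>2 s x =
     as_hom (model_fibre \<phi>\<^sub>1)
       (\<lambda>v. triv_map \<phi>\<^sub>2 x (s x (inv_into (carrier (fibre E\<^sub>1 x)) (triv_map \<phi>\<^sub>1 x) v)))"

text \<open>
  Smoothness into the closed subspace \<open>Hom V W\<close> of the type \<open>bounded_map\<close> is the same as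
  smoothness into the type, since difference quotients and their limits stay in the subspace.
\<close>

definition smooth_structure ::
    "'m topology \<Rightarrow> ('m, 'n::real_inner) chart set \<Rightarrow>
     ('m, 'a::unital_cstar_algebra, 'v::real_normed_vector) hbundle \<Rightarrow>
     ('m, 'a, 'v, 'f::real_normed_vector) triv set \<Rightarrow> bool" where
  "smooth_structure M \<A> E \<T> \<longleftrightarrow>
     (\<forall>\<phi>\<in>\<T>. local_trivialization M E \<phi>) \<and>
     (\<Union>\<phi>\<in>\<T>. triv_dom \<phi>) = topspace M \<and>
     (\<forall>\<phi>\<^sub>1\<in>\<T>. \<forall>\<phi>\<^sub>2\<in>\<T>.
        smooth_map_on \<A> (triv_dom \<phi>\<^sub>1 \<inter> triv_dom \<phi>\<^sub>2) (local_hom E \<phi>\<^sub>1 \<phi>\<^sub>2 (\<lambda>x v. v)))"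

definition smooth_hilbert_module_bundle ::
    "'m topology \<Rightarrow> ('m, 'n::real_inner) chart set \<Rightarrow>
     ('m, 'a::unital_cstar_algebra, 'v::real_normed_vector) hbundle \<Rightarrow>
     ('m, 'a, 'v, 'f::real_normed_vector) triv set \<Rightarrow> bool" where
  "smooth_hilbert_module_bundle M \<A> E \<T> \<longleftrightarrow> hilbert_module_bundle M E \<and> smooth_structure M \<A> E \<T>"


section \<open>Isomorphisms\<close>

text \<open>
  Continuity of a section of the bundle of fibrewise adjointable maps refers to the operator norm
  in the local trivializations of that bundle, not just to continuity of the induced map of total
  spaces.
\<close>

definition continuous_hom_section ::
    "'m topology \<Rightarrow>
     ('m, 'a::unital_cstar_algebra, 'v::real_normed_vector) hbundle \<Rightarrow>
     ('m, 'a, 'v, 'f::real_normed_vector) triv set \<Rightarrow>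
     ('m, 'a, 'w::real_normed_vector) hbundle \<Rightarrow>
     ('m, 'a, 'w, 'g::real_normed_vector) triv set \<Rightarrow> ('m \<Rightarrow> ('v, 'w) bounded_map) \<Rightarrow> bool" where
  "continuous_hom_section M E\<^sub>1 \<T>\<^sub>1 E\<^sub>2 \<T>\<^sub>2 s \<longleftrightarrow>
     (\<forall>x\<in>topspace M. s x \<in> Hom (fibre E\<^sub>1 x) (fibre E\<^sub>2 x)) \<and>
     (\<forall>\<phi>\<^sub>1\<in>\<T>\<^sub>1. \<forall>\<phi>\<^sub>2\<in>\<T>\<^sub>2.
        continuous_map (subtopology M (triv_dom \<phi>\<^sub>1 \<inter> triv_dom \<phi>\<^sub>2)) euclidean
          (local_hom E\<^sub>1 \<phi>\<^sub>1 \<phi>\<^sub>2 (\<lambda>x. apply_map (s x))))"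

definition smooth_hom_section ::
    "'m topology \<Rightarrow> ('m, 'n::real_inner) chart set \<Rightarrow>
     ('m, 'a::unital_cstar_algebra, 'v::real_normed_vector) hbundle \<Rightarrow>
     ('m, 'a, 'v, 'f::real_normed_vector) triv set \<Rightarrow>
     ('m, 'a, 'w::real_normed_vector) hbundle \<Rightarrow>
     ('m, 'a, 'w, 'g::real_normed_vector) triv set \<Rightarrow> ('m \<Rightarrow> ('v, 'w) bounded_map) \<Rightarrow> bool" where
  "smooth_hom_section M \<A> E\<^sub>1 \<T>\<^sub>1 E\<^sub>2 \<T>\<^sub>2 s \<longleftrightarrow>
     (\<forall>x\<in>topspace M. s x \<in> Hom (fibre E\<^sub>1 x) (fibre E\<^sub>2 x)) \<and>
     (\<forall>\<phi>\<^sub>1\<in>\<T>\<^sub>1. \<forall>\<phi>\<^sub>2\<in>\<T>\<^sub>2.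
        smooth_map_on \<A> (triv_dom \<phi>\<^sub>1 \<inter> triv_dom \<phi>\<^sub>2) (local_hom E\<^sub>1 \<phi>\<^sub>1 \<phi>\<^sub>2 (\<lambda>x. apply_map (s x))))"

definition bundle_isomorphism ::
    "'m topology \<Rightarrow>
     ('m, 'a::unital_cstar_algebra, 'v::real_normed_vector) hbundle \<Rightarrow>
     ('m, 'a, 'v, 'f::real_normed_vector) triv set \<Rightarrow>
     ('m, 'a, 'w::real_normed_vector) hbundle \<Rightarrow>
     ('m, 'a, 'w, 'g::real_normed_vector) triv set \<Rightarrow> ('m \<Rightarrow> ('v, 'w) bounded_map) \<Rightarrow> bool" where
  "bundle_isomorphism M E\<^sub>1 \<T>\<^sub>1 E\<^sub>2 \<T>\<^sub>2 s \<longleftrightarrow>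
     continuous_hom_section M E\<^sub>1 \<T>\<^sub>1 E\<^sub>2 \<T>\<^sub>2 s \<and>
     (\<forall>x\<in>topspace M. invertible_hom (fibre E\<^sub>1 x) (fibre E\<^sub>2 x) (s x))"

definition smooth_bundle_isomorphism ::
    "'m topology \<Rightarrow> ('m, 'n::real_inner) chart set \<Rightarrow>
     ('m, 'a::unital_cstar_algebra, 'v::real_normed_vector) hbundle \<Rightarrow>
     ('m, 'a, 'v, 'f::real_normed_vector) triv set \<Rightarrow>
     ('m, 'a, 'w::real_normed_vector) hbundle \<Rightarrow>
     ('m, 'a, 'w, 'g::real_normed_vector) triv set \<Rightarrow> ('m \<Rightarrow> ('v, 'w) bounded_map) \<Rightarrow> bool" where
  "smooth_bundle_isomorphism M \<A> E\<^sub>1 \<T>\<^sub>1 E\<^sub>2 \<T>\<^sub>2 s \<longleftrightarrow>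
     bundle_isomorphism M E\<^sub>1 \<T>\<^sub>1 E\<^sub>2 \<T>\<^sub>2 s \<and> smooth_hom_section M \<A> E\<^sub>1 \<T>\<^sub>1 E\<^sub>2 \<T>\<^sub>2 s"

end

theory Submission
  imports Defs
begin

text \<open>
  Near a point \<open>x\<^sub>0\<close>, the given continuous isomorphism \<open>s\<close> is approximated by the smooth section
  that is constant, with value \<open>s x\<^sub>0\<close>, in local trivializations around \<open>x\<^sub>0\<close>. A combination \<open>t\<close> of
  these sections with smooth, locally finite, nonnegative coefficients of positive sum \<open>\<sigma>\<close> satisfies
  \<open>norm (t x v - \<sigma> x *\<^sub>R s x v) \<le> \<sigma> x * norm (s x v) / 8\<close>. This condition is convex, and it makes \<open>t x\<close>
  invertible, so the coefficients need not be normalised. The inverse exists by the Banach fixed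
  point theorem; that it is adjointable follows by applying the same theorem to the adjoint, whose
  distance from the identity is controlled by polarization.
\<close>

section \<open>Calculus of \<open>C\<^sup>k\<close> maps\<close>

text \<open>An isomorphism needs an inverse that is itself adjointable, so solving
  \<open>apply_map (t x) v = w\<close> is not enough: the adjoint of \<open>t x\<close> has to be
  inverted too, although only \<open>t x\<close> is known to be close to a multiple of
  \<open>s x\<close>. The radius 1/8 is small enough for the lossy estimate on the adjoint to leave
  a contraction, with constant 9/10. Comparing the error with
  \<open>norm (apply_map (s x) v)\<close> instead of a fixed radius avoids any bound on the inverses
  of \<open>s x\<close> that is uniform in \<open>x\<close>; and since trivializations are isometric
  on fibres, such an estimate passes unchanged between a fibre and its model. Two obstacles shape
  the analysis. Operator-valued functions live in a type with nonlinear elements, so the product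
  rule is proved for operations that are bilinear only on closed subspaces. And paracompactness
  provides locally finite families of open sets, whereas gluing needs the closed sets that support
  the coefficients to be locally finite; this takes two successive refinements.\<close>

lemma Ck_on_subset: "Ck_on k f S \<Longrightarrow> T \<subseteq> S \<Longrightarrow> Ck_on k f T"
  by (induction k arbitrary: f) (auto intro: continuous_on_subset)

lemma frechet_derivative_transform_within_open:
  assumes "open S" "x \<in> S" "\<And>y. y \<in> S \<Longrightarrow> f y = g y" "f differentiable (at x)"
  shows "g differentiable (at x)" "frechet_derivative g (at x) = frechet_derivative f (at x)"
proof -
  have "(f has_derivative frechet_derivative f (at x)) (at x)"
    using assms(4) frechet_derivative_works by blast
  then have g: "(g has_derivative frechet_derivative f (at x)) (at x)"
    using assms(1-3) by (rule has_derivative_transform_within_open)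
  then show "g differentiable (at x)"
    by (rule differentiableI)
  show "frechet_derivative g (at x) = frechet_derivative f (at x)"
    using frechet_derivative_at[OF g] by simp
qed

lemma Ck_on_cong:
  assumes "open S" "Ck_on k f S" "\<And>x. x \<in> S \<Longrightarrow> f x = g x"
  shows "Ck_on k g S"
  using assms(2,3)
proof (induction k arbitrary: f g)
  case 0
  then show ?case by (simp cong: continuous_on_cong)
next
  case (Suc k)
  have d: "g differentiable (at x)" "frechet_derivative g (at x) = frechet_derivative f (at x)"
    if "x \<in> S" for x
    using frechet_derivative_transform_within_open[OF assms(1) that Suc.prems(2)] Suc.prems(1) that
    by auto
  have "Ck_on k (\<lambda>x. frechet_derivative g (at x) v) S" for v
    by (rule Suc.IH[of "\<lambda>x. frechet_derivative f (at x) v"]) (use Suc.prems(1) d in auto)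
  then show ?case using d by simp
qed

text \<open>Derivatives are taken \<open>at x\<close> in the whole space and so do not see the set;
  openness of the pieces matters only for continuity at level 0.\<close>

lemma Ck_on_UN:
  assumes "\<And>i. i \<in> I \<Longrightarrow> open (S i)" "\<And>i. i \<in> I \<Longrightarrow> Ck_on k f (S i)"
  shows "Ck_on k f (\<Union>i\<in>I. S i)"
  using assms(2)
proof (induction k arbitrary: f)
  case 0
  then show ?case using assms(1) by (auto intro: continuous_on_open_UN)
next
  case (Suc k)
  then show ?case by auto
qed

lemma Ck_on_local:
  assumes "\<And>x. x \<in> S \<Longrightarrow> \<exists>T. open T \<and> x \<in> T \<and> Ck_on k f T"
  shows "Ck_on k f S"
proof -
  obtain T where T: "\<And>x. x \<in> S \<Longrightarrow> open (T x) \<and> x \<in> T x \<and> Ck_on k f (T x)"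
    using assms by metis
  have "Ck_on k f (\<Union>x\<in>S. T x)"
    by (rule Ck_on_UN) (use T in auto)
  then show ?thesis
    by (rule Ck_on_subset) (use T in auto)
qed

lemma Ck_on_SucD: "Ck_on (Suc k) f S \<Longrightarrow> Ck_on k f S"
proof (induction k arbitrary: f)
  case 0
  then show ?case
    by (auto intro!: continuous_at_imp_continuous_on differentiable_imp_continuous_within)
next
  case (Suc k)
  then show ?case by simp
qed

lemma Ck_on_const: "Ck_on k (\<lambda>x. c) S"
  by (induction k arbitrary: c) auto

lemma Ck_on_add:
  assumes "open S" "Ck_on k f S" "Ck_on k g S"
  shows "Ck_on k (\<lambda>x. f x + g x) S"
  using assms(2,3)
proof (induction k arbitrary: f g)
  case 0
  then show ?case by (simp add: continuous_on_add)
next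
  case (Suc k)
  have d: "((\<lambda>x. f x + g x) has_derivative
      (\<lambda>v. frechet_derivative f (at x) v + frechet_derivative g (at x) v)) (at x)" if "x \<in> S" for x
    using Suc.prems that by (auto intro!: has_derivative_add simp: frechet_derivative_works)
  have "Ck_on k (\<lambda>x. frechet_derivative (\<lambda>x. f x + g x) (at x) v) S" for v
    by (rule Ck_on_cong[OF assms(1)
          Suc.IH[of "\<lambda>x. frechet_derivative f (at x) v" "\<lambda>x. frechet_derivative g (at x) v"]])
      (use Suc.prems in \<open>auto simp: frechet_derivative_at[OF d, symmetric]\<close>)
  then show ?case using d by (auto simp: differentiable_def)
qed

lemma Ck_on_sum:
  assumes "open S" "\<And>i. i \<in> I \<Longrightarrow> Ck_on k (f i) S"
  shows "Ck_on k (\<lambda>x. \<Sum>i\<in>I. f i x) S"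
  using assms(2) by (induction I rule: infinite_finite_induct) (auto intro: Ck_on_const Ck_on_add assms(1))

text \<open>The derivative along \<open>v\<close> is a limit of difference quotients, which stay in
  \<open>P\<close>. The product rule on subspaces depends on this: it inserts derivatives into the
  operation, and the induction on the order of differentiability does so again.\<close>

lemma frechet_derivative_in_closed_subspace:
  assumes P: "subspace P" "closed P" and S: "open S" "x \<in> S" "\<And>y. y \<in> S \<Longrightarrow> f y \<in> P"
    and f: "(f has_derivative f') (at x)"
  shows "f' v \<in> P"
proof -
  have "((\<lambda>t. x + t *\<^sub>R v) has_derivative (\<lambda>t. t *\<^sub>R v)) (at 0)"
    by (auto intro!: derivative_eq_intros)
  then have "((\<lambda>t. f (x + t *\<^sub>R v)) has_derivative (\<lambda>t. f' (t *\<^sub>R v))) (at 0)"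
    using has_derivative_compose[of "\<lambda>t. x + t *\<^sub>R v" _ 0 UNIV f f'] f by simp
  then have "((\<lambda>t. f (x + t *\<^sub>R v)) has_vector_derivative f' v) (at 0)"
    using linear_cmul[OF has_derivative_linear[OF f]] by (simp add: has_vector_derivative_def)
  then have "((\<lambda>t. norm (f (x + t *\<^sub>R v) - f x - t *\<^sub>R f' v) / norm t) \<longlongrightarrow> 0) (at 0)"
    by (simp add: has_vector_derivative_def has_derivative_at)
  then have "((\<lambda>t. norm ((f (x + t *\<^sub>R v) - f x) /\<^sub>R t - f' v)) \<longlongrightarrow> 0) (at 0)"
  proof (rule Lim_transform_eventually)
    have "norm (f (x + t *\<^sub>R v) - f x - t *\<^sub>R f' v) / norm t = norm ((f (x + t *\<^sub>R v) - f x) /\<^sub>R t - f' v)"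
      if "t \<noteq> 0" for t
    proof -
      have "(f (x + t *\<^sub>R v) - f x) /\<^sub>R t - f' v = (f (x + t *\<^sub>R v) - f x - t *\<^sub>R f' v) /\<^sub>R t"
        using that by (simp add: scaleR_diff_right)
      then show ?thesis by (simp add: divide_inverse mult.commute)
    qed
    then show "\<forall>\<^sub>F t in at 0. norm (f (x + t *\<^sub>R v) - f x - t *\<^sub>R f' v) / norm t
        = norm ((f (x + t *\<^sub>R v) - f x) /\<^sub>R t - f' v)"
      by (auto simp: eventually_at_filter)
  qed
  then have lim: "((\<lambda>t. (f (x + t *\<^sub>R v) - f x) /\<^sub>R t) \<longlongrightarrow> f' v) (at 0)"
    by (simp add: tendsto_norm_zero_iff LIM_zero_iff)
  have "((\<lambda>t. x + t *\<^sub>R v) \<longlongrightarrow> x + 0 *\<^sub>R v) (at 0)"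
    by (intro tendsto_intros)
  then have "\<forall>\<^sub>F t in at 0. x + t *\<^sub>R v \<in> S"
    by (rule topological_tendstoD) (use S in auto)
  then have "\<forall>\<^sub>F t in at 0. (f (x + t *\<^sub>R v) - f x) /\<^sub>R t \<in> P"
    by eventually_elim (use S in \<open>auto intro!: subspace_scale subspace_diff P\<close>)
  then show ?thesis
    using lim by (intro Lim_in_closed_set[OF P(2)]) auto
qed

text \<open>Elements of \<open>bounded_map\<close> need not be linear, so their composition is bilinear on subspaces
  only.\<close>

locale subspace_bilinear =
  fixes B :: "'b::real_normed_vector \<Rightarrow> 'c::real_normed_vector \<Rightarrow> 'd::real_normed_vector"
    and P Q and K :: real
  assumes P: "subspace P" "closed P" and Q: "subspace Q" "closed Q"
    and add_left: "\<And>p p' q. p \<in> P \<Longrightarrow> p' \<in> P \<Longrightarrow> q \<in> Q \<Longrightarrow> B (p + p') q = B p q + B p' q"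
    and add_right: "\<And>p q q'. p \<in> P \<Longrightarrow> q \<in> Q \<Longrightarrow> q' \<in> Q \<Longrightarrow> B p (q + q') = B p q + B p q'"
    and scaleR_left: "\<And>r p q. p \<in> P \<Longrightarrow> q \<in> Q \<Longrightarrow> B (r *\<^sub>R p) q = r *\<^sub>R B p q"
    and scaleR_right: "\<And>r p q. p \<in> P \<Longrightarrow> q \<in> Q \<Longrightarrow> B p (r *\<^sub>R q) = r *\<^sub>R B p q"
    and bound: "\<And>p q. p \<in> P \<Longrightarrow> q \<in> Q \<Longrightarrow> norm (B p q) \<le> norm p * norm q * K"
    and K: "0 \<le> K"
begin

lemma diff_left: "p \<in> P \<Longrightarrow> p' \<in> P \<Longrightarrow> q \<in> Q \<Longrightarrow> B (p - p') q = B p q - B p' q"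
  using add_left[of p "- p'" q] scaleR_left[of p' q "- 1"] P(1) by (simp add: subspace_neg)

lemma diff_right: "p \<in> P \<Longrightarrow> q \<in> Q \<Longrightarrow> q' \<in> Q \<Longrightarrow> B p (q - q') = B p q - B p q'"
  using add_right[of p q "- q'"] scaleR_right[of p q' "- 1"] Q(1) by (simp add: subspace_neg)

lemma has_derivative:
  assumes S: "open S" "x \<in> S" "\<And>y. y \<in> S \<Longrightarrow> f y \<in> P" "\<And>y. y \<in> S \<Longrightarrow> g y \<in> Q"
    and f: "(f has_derivative f') (at x)" and g: "(g has_derivative g') (at x)"
  shows "((\<lambda>y. B (f y) (g y)) has_derivative (\<lambda>v. B (f x) (g' v) + B (f' v) (g x))) (at x)"
proof -
  have f'P: "f' v \<in> P" and g'Q: "g' v \<in> Q" for v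
    using frechet_derivative_in_closed_subspace[OF P S(1,2,3) f]
      frechet_derivative_in_closed_subspace[OF Q S(1,2,4) g] by auto
  note lf = has_derivative_linear[OF f] and lg = has_derivative_linear[OF g]
  obtain L where L: "\<And>v. norm (f' v) \<le> norm v * L"
    using bounded_linear.bounded[OF has_derivative_bounded_linear[OF f]] by blast
  obtain L' where L': "\<And>v. norm (g' v) \<le> norm v * L'"
    using bounded_linear.bounded[OF has_derivative_bounded_linear[OF g]] by blast
  define rf where "rf y = f y - f x - f' (y - x)" for y
  define rg where "rg y = g y - g x - g' (y - x)" for y
  have rf0: "((\<lambda>y. norm (rf y) / norm (y - x)) \<longlongrightarrow> 0) (at x)"
    and rg0: "((\<lambda>y. norm (rg y) / norm (y - x)) \<longlongrightarrow> 0) (at x)"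
    using f g by (auto simp: has_derivative_iff_norm rf_def rg_def)
  have g0: "((\<lambda>y. norm (g y - g x)) \<longlongrightarrow> 0) (at x)" and gx: "((\<lambda>y. norm (g y)) \<longlongrightarrow> norm (g x)) (at x)"
    using has_derivative_continuous[OF g] by (auto simp: continuous_within intro!: tendsto_norm_zero LIM_zero tendsto_norm)
  let ?r = "\<lambda>y. B (f y) (g y) - B (f x) (g x) - (B (f x) (g' (y - x)) + B (f' (y - x)) (g x))"
  let ?bd = "\<lambda>y. (norm (f x) * (norm (rg y) / norm (y - x)) + (norm (rf y) / norm (y - x)) * norm (g y)
       + L * norm (g y - g x)) * K"
  have "(?bd \<longlongrightarrow> (norm (f x) * 0 + 0 * norm (g x) + L * 0) * K) (at x)"
    by (intro tendsto_intros rf0 rg0 g0 gx)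
  then have bd0: "(?bd \<longlongrightarrow> 0) (at x)" by simp
  have r_le: "norm (?r y) / norm (y - x) \<le> ?bd y" if "y \<in> S" "y \<noteq> x" for y
  proof -
    have mem: "f x \<in> P" "f y \<in> P" "g x \<in> Q" "g y \<in> Q" "rf y \<in> P" "rg y \<in> Q" "g y - g x \<in> Q"
      using S that f'P g'Q P(1) Q(1) by (auto simp: rf_def rg_def intro!: subspace_diff)
    \<comment> \<open>Each of the three terms contains a factor that is small: a first-order
      remainder \<open>rf\<close> or \<open>rg\<close>, or else \<open>g y - g x\<close> next to the
      linear term \<open>f' (y - x)\<close>. All arguments lie in \<open>P\<close> or
      \<open>Q\<close>, so bilinearity may be used.\<close>
    have "?r y = B (f x) (rg y) + B (rf y) (g y) + B (f' (y - x)) (g y - g x)"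
      unfolding rf_def rg_def using mem f'P g'Q P(1) Q(1)
      by (simp add: diff_left diff_right subspace_diff)
    also have "norm \<dots> \<le> norm (f x) * norm (rg y) * K + norm (rf y) * norm (g y) * K
        + norm (f' (y - x)) * norm (g y - g x) * K"
      by (intro norm_triangle_le add_mono bound mem f'P)
    also have "\<dots> \<le> norm (f x) * norm (rg y) * K + norm (rf y) * norm (g y) * K
        + norm (y - x) * L * norm (g y - g x) * K"
      by (intro add_mono mult_right_mono L order_refl K norm_ge_zero)
    finally have "norm (?r y) / norm (y - x) \<le> (norm (f x) * norm (rg y) * K + norm (rf y) * norm (g y) * K
        + norm (y - x) * L * norm (g y - g x) * K) / norm (y - x)"
      by (rule divide_right_mono) simp
    also have "\<dots> = ?bd y"
      using that by (simp add: field_simps)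
    finally show ?thesis .
  qed
  have "bounded_linear (\<lambda>v. B (f x) (g' v) + B (f' v) (g x))"
  proof (rule bounded_linear_intro)
    fix v w r
    have mem: "f x \<in> P" "g x \<in> Q" using S by auto
    show "B (f x) (g' (v + w)) + B (f' (v + w)) (g x) =
        B (f x) (g' v) + B (f' v) (g x) + (B (f x) (g' w) + B (f' w) (g x))"
      by (simp add: linear_add[OF lf] linear_add[OF lg] add_left add_right mem f'P g'Q)
    show "B (f x) (g' (r *\<^sub>R v)) + B (f' (r *\<^sub>R v)) (g x) = r *\<^sub>R (B (f x) (g' v) + B (f' v) (g x))"
      by (simp add: linear_cmul[OF lf] linear_cmul[OF lg] scaleR_left scaleR_right mem f'P g'Q scaleR_add_right)
    have "norm (B (f x) (g' v) + B (f' v) (g x)) \<le> norm (f x) * (norm v * L') * K + norm v * L * norm (g x) * K"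
      by (intro norm_triangle_le add_mono order_trans[OF bound] mult_right_mono mult_left_mono L L' mem f'P g'Q K) auto
    then show "norm (B (f x) (g' v) + B (f' v) (g x)) \<le> norm v * (norm (f x) * L' * K + L * norm (g x) * K)"
      by (simp add: algebra_simps)
  qed
  moreover have "((\<lambda>y. norm (?r y) / norm (y - x)) \<longlongrightarrow> 0) (at x)"
  proof (rule tendsto_sandwich[OF _ _ tendsto_const bd0])
    show "\<forall>\<^sub>F y in at x. norm (?r y) / norm (y - x) \<le> ?bd y"
      using r_le S(1,2) unfolding eventually_at_topological by blast
  qed simp
  ultimately show ?thesis
    by (simp add: has_derivative_iff_norm)
qed

lemma Ck_on:
  assumes "open S" "Ck_on k f S" "Ck_on k g S" "\<And>y. y \<in> S \<Longrightarrow> f y \<in> P" "\<And>y. y \<in> S \<Longrightarrow> g y \<in> Q"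
  shows "Ck_on k (\<lambda>x. B (f x) (g x)) S"
  using assms(2-)
proof (induction k arbitrary: f g)
  case 0
  have "((\<lambda>y. B (f y) (g y)) \<longlongrightarrow> B (f x) (g x)) (at x within S)" if x: "x \<in> S" for x
  proof -
    have fg: "(f \<longlongrightarrow> f x) (at x within S)" "(g \<longlongrightarrow> g x) (at x within S)"
      using 0 x by (auto simp: continuous_on)
    let ?bd = "\<lambda>y. (norm (f x) * norm (g y - g x) + norm (f y - f x) * norm (g y)) * K"
    have "(?bd \<longlongrightarrow> (norm (f x) * norm (g x - g x) + norm (f x - f x) * norm (g x)) * K) (at x within S)"
      by (intro tendsto_intros fg)
    then have "(?bd \<longlongrightarrow> 0) (at x within S)" by simp
    moreover have "norm (B (f y) (g y) - B (f x) (g x)) \<le> ?bd y" if y: "y \<in> S" for y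
    proof -
      have mem: "f x \<in> P" "g x \<in> Q" "f y \<in> P" "g y \<in> Q" using 0 x y by auto
      then have "B (f y) (g y) - B (f x) (g x) = B (f x) (g y - g x) + B (f y - f x) (g y)"
        by (simp add: diff_left diff_right)
      also have "norm \<dots> \<le> norm (f x) * norm (g y - g x) * K + norm (f y - f x) * norm (g y) * K"
        by (intro norm_triangle_le add_mono bound mem subspace_diff P Q)
      finally show ?thesis by (simp add: algebra_simps)
    qed
    then have "\<forall>\<^sub>F y in at x within S. norm (B (f y) (g y) - B (f x) (g x)) \<le> ?bd y"
      by (auto simp: eventually_at_filter)
    ultimately have "((\<lambda>y. B (f y) (g y) - B (f x) (g x)) \<longlongrightarrow> 0) (at x within S)"
      by (rule Lim_null_comparison[rotated])
    then show ?thesis by (simp add: LIM_zero_iff)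
  qed
  then show ?case by (simp add: continuous_on)
next
  case (Suc k)
  have df: "(f has_derivative frechet_derivative f (at x)) (at x)"
    and dg: "(g has_derivative frechet_derivative g (at x)) (at x)" if "x \<in> S" for x
    using Suc.prems that by (auto simp: frechet_derivative_works)
  have d: "((\<lambda>y. B (f y) (g y)) has_derivative (\<lambda>v. B (f x) (frechet_derivative g (at x) v)
      + B (frechet_derivative f (at x) v) (g x))) (at x)" if "x \<in> S" for x
    using has_derivative[OF assms(1) that Suc.prems(3,4) df[OF that] dg[OF that]] .
  have mem: "frechet_derivative f (at x) v \<in> P" "frechet_derivative g (at x) v \<in> Q" if "x \<in> S" for x v
    using frechet_derivative_in_closed_subspace[OF P assms(1) that Suc.prems(3) df[OF that]]
      frechet_derivative_in_closed_subspace[OF Q assms(1) that Suc.prems(4) dg[OF that]] by auto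
  \<comment> \<open>The product rule produces products of the same shape, so the induction
    hypothesis applies to each; the undifferentiated factor is lowered from order
    \<open>Suc k\<close> to \<open>k\<close>.\<close>
  have "Ck_on k (\<lambda>x. B (f x) (frechet_derivative g (at x) v) + B (frechet_derivative f (at x) v) (g x)) S" for v
    using Suc.prems mem by (intro Ck_on_add Suc.IH assms(1)) (auto intro: Ck_on_SucD)
  then have "Ck_on k (\<lambda>x. frechet_derivative (\<lambda>y. B (f y) (g y)) (at x) v) S" for v
    by (rule Ck_on_cong[OF assms(1)]) (simp add: frechet_derivative_at[OF d, symmetric])
  moreover have "(\<lambda>y. B (f y) (g y)) differentiable (at x)" if "x \<in> S" for x
    using d[OF that] by (auto simp: differentiable_def)
  ultimately show ?case by simp
qed

lemma smooth_on:
  assumes "open S" "smooth_on S f" "smooth_on S g" "\<And>y. y \<in> S \<Longrightarrow> f y \<in> P" "\<And>y. y \<in> S \<Longrightarrow> g y \<in> Q"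
  shows "smooth_on S (\<lambda>x. B (f x) (g x))"
  using Ck_on assms unfolding smooth_on_def by blast

end

lemma (in bounded_bilinear) smooth_on:
  assumes "open S" "smooth_on S f" "smooth_on S g"
  shows "smooth_on S (\<lambda>x. prod (f x) (g x))"
proof -
  obtain K where "0 \<le> K" "\<And>a b. norm (prod a b) \<le> norm a * norm b * K"
    using nonneg_bounded by blast
  then interpret subspace_bilinear prod UNIV UNIV K
    by unfold_locales (auto simp: add_left add_right scaleR_left scaleR_right)
  show ?thesis using assms by (intro smooth_on) auto
qed

lemma smooth_on_subset: "smooth_on S f \<Longrightarrow> T \<subseteq> S \<Longrightarrow> smooth_on T f"
  unfolding smooth_on_def using Ck_on_subset by blast

lemma smooth_on_cong: "open S \<Longrightarrow> smooth_on S f \<Longrightarrow> (\<And>x. x \<in> S \<Longrightarrow> f x = g x) \<Longrightarrow> smooth_on S g"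
  unfolding smooth_on_def using Ck_on_cong by blast

lemma smooth_on_local: "(\<And>x. x \<in> S \<Longrightarrow> \<exists>T. open T \<and> x \<in> T \<and> smooth_on T f) \<Longrightarrow> smooth_on S f"
  unfolding smooth_on_def using Ck_on_local by metis

lemma smooth_on_const: "smooth_on S (\<lambda>x. c)"
  unfolding smooth_on_def using Ck_on_const by blast

lemma smooth_on_add: "open S \<Longrightarrow> smooth_on S f \<Longrightarrow> smooth_on S g \<Longrightarrow> smooth_on S (\<lambda>x. f x + g x)"
  unfolding smooth_on_def using Ck_on_add by blast

lemma smooth_on_sum:
  "open S \<Longrightarrow> (\<And>i. i \<in> I \<Longrightarrow> smooth_on S (f i)) \<Longrightarrow> smooth_on S (\<lambda>x. \<Sum>i\<in>I. f i x)"
  by (simp add: smooth_on_def Ck_on_sum)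

lemma smooth_on_imp_continuous_on: "smooth_on S f \<Longrightarrow> continuous_on S f"
  by (metis smooth_on_def Ck_on.simps(1))

section \<open>Smooth bump functions\<close>

text \<open>Put u = 1/t. The derivative of p(u) exp(-u) with respect to t is u^2 (p - p')(u)
  exp(-u), and \<open>[:0, 0, 1:]\<close> is u^2.\<close>

primrec flat_poly :: "nat \<Rightarrow> real poly" where
  "flat_poly 0 = 1"
| "flat_poly (Suc n) = [:0, 0, 1:] * (flat_poly n - pderiv (flat_poly n))"

text \<open>\<open>flat 0\<close> is Cauchy's function exp(-1/t), extended by zero, and
  \<open>flat n\<close> is its n-th derivative. Having all derivatives in one family lets inductions
  over the order of differentiability close.\<close>

definition flat :: "nat \<Rightarrow> real \<Rightarrow> real" where
  "flat n t = (if t \<le> 0 then 0 else poly (flat_poly n) (1 / t) * exp (- 1 / t))"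

lemma flat_pos: "0 < t \<Longrightarrow> 0 < flat 0 t"
  by (simp add: flat_def)

lemma flat_nonneg: "0 \<le> flat 0 t"
  by (simp add: flat_def)

lemma flat_eq_0: "t \<le> 0 \<Longrightarrow> flat n t = 0"
  by (simp add: flat_def)

lemma tendsto_poly_times_exp_neg: "((\<lambda>u. poly p u * exp (- u)) \<longlongrightarrow> (0::real)) at_top"
proof -
  have "((\<lambda>u. \<Sum>i\<le>degree p. coeff p i * (u ^ i / exp u)) \<longlongrightarrow> (\<Sum>i\<le>degree p. coeff p i * 0)) at_top"
    by (intro tendsto_intros tendsto_power_div_exp_0)
  then show ?thesis
    by (simp add: poly_altdef exp_minus divide_inverse sum_distrib_right mult.assoc)
qed

lemma DERIV_flat: "(flat n has_real_derivative flat (Suc n) t) (at t)"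
proof -
  consider "t < 0" | "t = 0" | "t > 0" by linarith
  then show ?thesis
  proof cases
    case 1
    have "((\<lambda>_. 0) has_real_derivative 0) (at t)" by simp
    then have "(flat n has_real_derivative 0) (at t)"
      by (rule has_field_derivative_transform_within_open[of _ _ _ "{..<0}"]) (use 1 in \<open>auto simp: flat_def\<close>)
    then show ?thesis using 1 by (simp add: flat_def)
  next
    case 2
    \<comment> \<open>The right-hand difference quotient at 0 is p(u) exp(-u) / h with u = 1/h;
      \<open>pCons 0\<close> accounts for the extra factor u.\<close>
    have "((\<lambda>h. poly (pCons 0 (flat_poly n)) (inverse h) * exp (- inverse h)) \<longlongrightarrow> 0) (at_right 0)"
      by (rule filterlim_compose[OF tendsto_poly_times_exp_neg filterlim_inverse_at_top_right])
    then have "((\<lambda>h. flat n h / h) \<longlongrightarrow> 0) (at_right 0)"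
      by (rule Lim_transform_eventually)
        (auto simp: eventually_at_filter flat_def divide_inverse intro!: always_eventually)
    moreover have "((\<lambda>h. flat n h / h) \<longlongrightarrow> 0) (at_left 0)"
      by (rule Lim_transform_eventually[OF tendsto_const])
        (auto simp: eventually_at_filter flat_def intro!: always_eventually)
    ultimately have "((\<lambda>h. flat n h / h) \<longlongrightarrow> 0) (at 0)"
      by (simp add: filterlim_split_at)
    then show ?thesis using 2 by (simp add: DERIV_def flat_def)
  next
    case 3
    have "((\<lambda>t. poly (flat_poly n) (1 / t) * exp (- 1 / t)) has_real_derivative
        poly (pderiv (flat_poly n)) (1 / t) * (- 1 / t\<^sup>2) * exp (- 1 / t)
        + poly (flat_poly n) (1 / t) * (exp (- 1 / t) * (1 / t\<^sup>2))) (at t)"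
      using 3 by (auto intro!: derivative_eq_intros DERIV_chain2[OF poly_DERIV]
          simp: power2_eq_square field_simps)
    also have "poly (pderiv (flat_poly n)) (1 / t) * (- 1 / t\<^sup>2) * exp (- 1 / t)
        + poly (flat_poly n) (1 / t) * (exp (- 1 / t) * (1 / t\<^sup>2)) = flat (Suc n) t"
      using 3 by (simp add: flat_def power2_eq_square field_simps)
    finally show ?thesis
      by (rule has_field_derivative_transform_within_open[of _ _ _ "{0<..}"]) (use 3 in \<open>auto simp: flat_def\<close>)
  qed
qed

text \<open>The chain rule replaces \<open>flat n\<close> by \<open>flat (Suc n)\<close> and
  multiplies by a derivative of \<open>q\<close>, so the induction on \<open>k\<close> has to vary
  both \<open>n\<close> and \<open>q\<close>.\<close>

lemma Ck_on_flat:
  assumes "open S" "Ck_on k q S"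
  shows "Ck_on k (\<lambda>x. flat n (q x)) S"
  using assms(2)
proof (induction k arbitrary: n q)
  case 0
  have "continuous_on UNIV (flat n)"
    using DERIV_flat DERIV_isCont continuous_at_imp_continuous_on by blast
  then show ?case
    using 0 continuous_on_compose2[of UNIV "flat n" S q] by auto
next
  case (Suc k)
  interpret mult: subspace_bilinear "(*) :: real \<Rightarrow> real \<Rightarrow> real" UNIV UNIV 1
    by unfold_locales (auto simp: algebra_simps abs_mult)
  have d: "((\<lambda>x. flat n (q x)) has_derivative
      (\<lambda>v. flat (Suc n) (q x) * frechet_derivative q (at x) v)) (at x)" if "x \<in> S" for x
  proof -
    have "(q has_derivative frechet_derivative q (at x)) (at x)"
      using Suc.prems that by (simp add: frechet_derivative_works)
    then show ?thesis
      using has_derivative_compose[OF _ has_field_derivative_imp_has_derivative[OF DERIV_flat]] by blast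
  qed
  have "Ck_on k (\<lambda>x. frechet_derivative (\<lambda>x. flat n (q x)) (at x) v) S" for v
    by (rule Ck_on_cong[OF assms(1) mult.Ck_on[OF assms(1) Suc.IH[of q "Suc n"],
            of "\<lambda>x. frechet_derivative q (at x) v"]])
      (use Suc.prems Ck_on_SucD in \<open>auto simp: frechet_derivative_at[OF d, symmetric]\<close>)
  then show ?case using d by (auto simp: differentiable_def)
qed

text \<open>The squared distance to \<open>a\<close>, unlike the distance, is smooth everywhere,
  being an inner product of smooth maps. For \<open>0 < r\<close> the resulting function is positive
  exactly where \<open>g x\<close> lies in the open ball of radius \<open>r\<close> around
  \<open>a\<close>.\<close>

lemma smooth_on_bump:
  fixes g :: "'n::real_normed_vector \<Rightarrow> 'b::real_inner"
  assumes "open S" "smooth_on S g"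
  shows "smooth_on S (\<lambda>x. flat 0 (r\<^sup>2 - (g x - a) \<bullet> (g x - a)))"
proof -
  have "smooth_on S (\<lambda>x. g x + - a)"
    by (intro smooth_on_add smooth_on_const assms)
  then have "smooth_on S (\<lambda>x. (g x - a) \<bullet> (g x - a))"
    using bounded_bilinear.smooth_on[OF bounded_bilinear_inner assms(1)] by auto
  then have "smooth_on S (\<lambda>x. (- 1) * ((g x - a) \<bullet> (g x - a)))"
    by (intro bounded_bilinear.smooth_on[OF bounded_bilinear_mult assms(1)] smooth_on_const)
  then have "smooth_on S (\<lambda>x. r\<^sup>2 + (- 1) * ((g x - a) \<bullet> (g x - a)))"
    by (intro smooth_on_add smooth_on_const assms)
  then show ?thesis
    by (simp add: smooth_on_def Ck_on_flat assms(1))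
qed

section \<open>Compactness of closed balls in the model space\<close>

lemma compact_coefficient_box:
  fixes C :: "'n::real_normed_vector set"
  assumes "finite C"
  shows "compact {\<Sum>c\<in>C. f c *\<^sub>R c | f. \<forall>c\<in>C. \<bar>f c\<bar> \<le> R c}"
  using assms
proof (induction C)
  case empty
  then show ?case by simp
next
  case (insert c C)
  let ?B = "\<lambda>C. {\<Sum>c\<in>C. f c *\<^sub>R c | f. \<forall>c\<in>C. \<bar>f c\<bar> \<le> R c}"
  \<comment> \<open>The box over \<open>insert c C\<close> is the Minkowski sum of a segment in
    direction \<open>c\<close> and the box over \<open>C\<close>; sums of compact sets are
    compact.\<close>
  have "?B (insert c C) = {x + y | x y. x \<in> (\<lambda>t. t *\<^sub>R c) ` {- R c..R c} \<and> y \<in> ?B C}" (is "?L = ?R")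
  proof
    show "?L \<subseteq> ?R"
    proof
      fix z assume "z \<in> ?L"
      then obtain f where f: "z = (\<Sum>c\<in>insert c C. f c *\<^sub>R c)" "\<forall>c\<in>insert c C. \<bar>f c\<bar> \<le> R c" by blast
      then have "z = f c *\<^sub>R c + (\<Sum>c\<in>C. f c *\<^sub>R c)" "f c \<in> {- R c..R c}"
        using insert by (auto simp: abs_le_iff)
      then show "z \<in> ?R" using f(2) by blast
    qed
    show "?R \<subseteq> ?L"
    proof
      fix z assume "z \<in> ?R"
      then obtain t f where tf: "t \<in> {- R c..R c}" "\<forall>c\<in>C. \<bar>f c\<bar> \<le> R c"
        and z: "z = t *\<^sub>R c + (\<Sum>c\<in>C. f c *\<^sub>R c)" by auto
      have "(\<Sum>d\<in>insert c C. (f(c := t)) d *\<^sub>R d) = t *\<^sub>R c + (\<Sum>d\<in>C. (f(c := t)) d *\<^sub>R d)"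
        using insert by simp
      also have "(\<Sum>d\<in>C. (f(c := t)) d *\<^sub>R d) = (\<Sum>d\<in>C. f d *\<^sub>R d)"
        using insert by (intro sum.cong) auto
      finally have "z = (\<Sum>d\<in>insert c C. (f(c := t)) d *\<^sub>R d)" using z by simp
      moreover have "\<forall>d\<in>insert c C. \<bar>(f(c := t)) d\<bar> \<le> R d" using tf by auto
      ultimately show "z \<in> ?L" by blast
    qed
  qed
  moreover have "compact ((\<lambda>t. t *\<^sub>R c) ` {- R c..R c})"
    by (intro compact_continuous_image continuous_intros compact_Icc)
  ultimately show ?case
    using compact_sums[OF _ insert.IH] by simp
qed

text \<open>In an orthogonal spanning set the coefficients of \<open>x\<close> are
  \<open>(x \<bullet> c) / (c \<bullet> c)\<close>, and Cauchy-Schwarz bounds them by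
  \<open>r / norm c\<close>. The ball around 0 is thus a closed subset of a compact box of
  coefficients.\<close>

lemma compact_cball_finite_dimensional:
  fixes a :: "'n::real_inner"
  assumes "finite_dimensional TYPE('n)"
  shows "compact (cball a r)"
proof -
  obtain B :: "'n set" where "finite B" "span B = UNIV"
    using assms unfolding finite_dimensional_def by blast
  then obtain C where C: "finite C" "span C = (UNIV :: 'n set)" "pairwise orthogonal C"
    using basis_orthogonal[of B] by metis
  let ?f = "\<lambda>x c :: 'n. (x \<bullet> c) / (c \<bullet> c)"
  have expand: "x = (\<Sum>c\<in>C. ?f x c *\<^sub>R c)" for x
  proof -
    obtain f where f: "x = (\<Sum>c\<in>C. f c *\<^sub>R c)"
      using C span_finite[of C] by auto
    \<comment> \<open>The zero vector may belong to \<open>C\<close>. Its coefficient is arbitrary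
      in \<open>f\<close> and 0 in \<open>?f\<close>, but both multiples of it vanish.\<close>
    have "?f x c *\<^sub>R c = f c *\<^sub>R c" if "c \<in> C" for c
    proof (cases "c = 0")
      case False
      have "x \<bullet> c = (\<Sum>d\<in>C. if d = c then f c * (c \<bullet> c) else 0)"
        unfolding f inner_sum_left using C(3) that
        by (intro sum.cong) (auto simp: pairwise_def orthogonal_def)
      then show ?thesis using C(1) that False by simp
    qed simp
    then have "(\<Sum>c\<in>C. ?f x c *\<^sub>R c) = (\<Sum>c\<in>C. f c *\<^sub>R c)" by (intro sum.cong) auto
    then show ?thesis using f by simp
  qed
  have "\<bar>?f x c\<bar> \<le> r / norm c" if "norm x \<le> r" for x c
  proof (cases "c = 0")
    case False
    have "\<bar>?f x c\<bar> \<le> (norm x * norm c) / (norm c * norm c)"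
      using divide_right_mono[OF Cauchy_Schwarz_ineq2[of x c], of "norm c * norm c"]
      by (simp add: abs_divide dot_square_norm power2_eq_square)
    also have "\<dots> \<le> r / norm c" using that False by (simp add: divide_right_mono)
    finally show ?thesis .
  qed simp
  then have sub: "cball 0 r \<subseteq> {\<Sum>c\<in>C. f c *\<^sub>R c | f. \<forall>c\<in>C. \<bar>f c\<bar> \<le> r / norm c}" (is "_ \<subseteq> ?K")
    using expand by (fastforce simp: dist_norm)
  have "compact (?K \<inter> cball 0 r)"
    by (intro compact_Int_closed compact_coefficient_box C) auto
  moreover have "?K \<inter> cball 0 r = cball 0 r" using sub by auto
  ultimately have "compact ((+) a ` cball 0 r)"
    by (intro compact_translation) simp
  then show ?thesis by (simp add: image_add_cball)
qed

section \<open>Smooth functions on manifolds\<close>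

lemma smooth_map_on_iff:
  "smooth_map_on \<A> W f \<longleftrightarrow> (\<forall>U \<kappa>. (U, \<kappa>) \<in> \<A> \<longrightarrow> smooth_on (\<kappa> ` (U \<inter> W)) (f \<circ> inv_into U \<kappa>))"
  by (auto simp: smooth_map_on_def)

lemma smooth_map_on_subset: "smooth_map_on \<A> W f \<Longrightarrow> W' \<subseteq> W \<Longrightarrow> smooth_map_on \<A> W' f"
  unfolding smooth_map_on_iff by (metis Int_mono image_mono order_refl smooth_on_subset)

lemma smooth_map_on_const: "smooth_map_on \<A> W (\<lambda>x. c)"
  by (auto simp: smooth_map_on_iff o_def smooth_on_const)

context
  fixes M :: "'m topology" and \<A> :: "('m, 'n::real_inner) chart set"
  assumes atlas: "smooth_atlas M \<A>"
begin

lemma chart_openin: "(U, \<kappa>) \<in> \<A> \<Longrightarrow> openin M U"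
  and chart_homeomorphic: "(U, \<kappa>) \<in> \<A> \<Longrightarrow> homeomorphic_map (subtopology M U) (top_of_set (\<kappa> ` U)) \<kappa>"
  and chart_image_open: "(U, \<kappa>) \<in> \<A> \<Longrightarrow> open (\<kappa> ` U)"
  using atlas by (auto simp: smooth_atlas_def)

lemma chart_inj: "(U, \<kappa>) \<in> \<A> \<Longrightarrow> inj_on \<kappa> U"
  using homeomorphic_imp_injective_map[OF chart_homeomorphic] chart_openin openin_subset
  by (fastforce simp: topspace_subtopology inf.absorb2)

lemma open_chart_image:
  assumes "(U, \<kappa>) \<in> \<A>" "openin M W"
  shows "open (\<kappa> ` (U \<inter> W))"
proof -
  have "openin (subtopology M U) (U \<inter> W)"
    using assms by (simp add: openin_subtopology_Int2 chart_openin)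
  then have "openin (top_of_set (\<kappa> ` U)) (\<kappa> ` (U \<inter> W))"
    using homeomorphic_map_openness_eq[OF chart_homeomorphic[OF assms(1)]] by blast
  then show ?thesis
    using chart_image_open[OF assms(1)] openin_open_eq by blast
qed

lemma chart_cover: "x \<in> topspace M \<Longrightarrow> \<exists>U \<kappa>. (U, \<kappa>) \<in> \<A> \<and> x \<in> U"
  using atlas unfolding smooth_atlas_def by fast

lemma chart_transition: "(U, \<kappa>) \<in> \<A> \<Longrightarrow> (U', \<kappa>') \<in> \<A> \<Longrightarrow> smooth_on (\<kappa> ` (U \<inter> U')) (\<kappa>' \<circ> inv_into U \<kappa>)"
  using atlas unfolding smooth_atlas_def by fast

lemma inv_into_chart:
  assumes "(U, \<kappa>) \<in> \<A>" "y \<in> \<kappa> ` (U \<inter> W)"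
  shows "inv_into U \<kappa> y \<in> U" "inv_into U \<kappa> y \<in> W"
  using assms chart_inj[OF assms(1)] by (auto simp: inv_into_f_f)

lemma smooth_map_on_cong:
  assumes "openin M W" "smooth_map_on \<A> W f" "\<And>x. x \<in> W \<Longrightarrow> f x = g x"
  shows "smooth_map_on \<A> W g"
  unfolding smooth_map_on_iff
proof safe
  fix U \<kappa> assume U: "(U, \<kappa>) \<in> \<A>"
  show "smooth_on (\<kappa> ` (U \<inter> W)) (g \<circ> inv_into U \<kappa>)"
    by (rule smooth_on_cong[OF open_chart_image[OF U assms(1)], of "f \<circ> inv_into U \<kappa>"])
      (use assms U inv_into_chart[OF U] in \<open>auto simp: smooth_map_on_iff\<close>)
qed

lemma smooth_map_on_local:
  assumes "\<And>x. x \<in> W \<Longrightarrow> \<exists>N. openin M N \<and> x \<in> N \<and> smooth_map_on \<A> N f"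
  shows "smooth_map_on \<A> W f"
  unfolding smooth_map_on_iff
proof safe
  fix U \<kappa> assume U: "(U, \<kappa>) \<in> \<A>"
  show "smooth_on (\<kappa> ` (U \<inter> W)) (f \<circ> inv_into U \<kappa>)"
  proof (rule smooth_on_local)
    fix y assume "y \<in> \<kappa> ` (U \<inter> W)"
    then obtain x where x: "y = \<kappa> x" "x \<in> U" "x \<in> W" by blast
    obtain N where N: "openin M N" "x \<in> N" "smooth_map_on \<A> N f" using assms[OF x(3)] by blast
    then show "\<exists>T. open T \<and> y \<in> T \<and> smooth_on T (f \<circ> inv_into U \<kappa>)"
      using U x by (intro exI[of _ "\<kappa> ` (U \<inter> N)"]) (auto simp: open_chart_image smooth_map_on_iff)
  qed
qed

lemma smooth_map_on_sum:
  "openin M W \<Longrightarrow> (\<And>i. i \<in> I \<Longrightarrow> smooth_map_on \<A> W (f i)) \<Longrightarrow> smooth_map_on \<A> W (\<lambda>x. \<Sum>i\<in>I. f i x)"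
  by (auto simp: smooth_map_on_iff o_def open_chart_image intro!: smooth_on_sum)

lemma smooth_map_on_bilinear:
  assumes B: "subspace_bilinear B P Q K" and "openin M W" "smooth_map_on \<A> W f" "smooth_map_on \<A> W g"
    "\<And>y. y \<in> W \<Longrightarrow> f y \<in> P" "\<And>y. y \<in> W \<Longrightarrow> g y \<in> Q"
  shows "smooth_map_on \<A> W (\<lambda>x. B (f x) (g x))"
  unfolding smooth_map_on_iff
proof safe
  fix U \<kappa> assume U: "(U, \<kappa>) \<in> \<A>"
  show "smooth_on (\<kappa> ` (U \<inter> W)) ((\<lambda>x. B (f x) (g x)) \<circ> inv_into U \<kappa>)"
    using subspace_bilinear.smooth_on[OF B open_chart_image[OF U assms(2)], of "f \<circ> inv_into U \<kappa>" "g \<circ> inv_into U \<kappa>"]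
      assms U inv_into_chart[OF U]
    by (simp add: smooth_map_on_iff o_def)
qed

lemma smooth_map_on_scaleR:
  fixes g :: "'m \<Rightarrow> 'b::real_normed_vector"
  assumes "openin M W" "smooth_map_on \<A> W f" "smooth_map_on \<A> W g"
  shows "smooth_map_on \<A> W (\<lambda>x. f x *\<^sub>R g x)"
proof -
  have "subspace_bilinear (scaleR :: real \<Rightarrow> 'b \<Rightarrow> 'b) UNIV UNIV 1"
    by unfold_locales (auto simp: scaleR_add_left scaleR_add_right)
  from smooth_map_on_bilinear[OF this assms] show ?thesis by auto
qed

text \<open>Smoothness is a statement about coordinate expressions. Continuity on the manifold is
  pasted together from the chart domains, where \<open>f\<close> is its coordinate expression
  composed with the chart.\<close>

lemma smooth_map_on_imp_continuous_map:
  assumes W: "openin M W" and f: "smooth_map_on \<A> W f"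
  shows "continuous_map (subtopology M W) euclidean f"
proof -
  let ?X = "subtopology M W"
  show ?thesis
  proof (rule pasting_lemma[of \<A> ?X "\<lambda>(U, \<kappa>). U \<inter> W" _ "\<lambda>_. f"])
    fix i assume "i \<in> \<A>"
    then obtain U \<kappa> where U: "(U, \<kappa>) \<in> \<A>" "i = (U, \<kappa>)" by (cases i) auto
    show "openin ?X (case i of (U, \<kappa>) \<Rightarrow> U \<inter> W)"
      using chart_openin[OF U(1)] U(2) by (auto simp: openin_subtopology)
    have "continuous_on (\<kappa> ` (U \<inter> W)) (f \<circ> inv_into U \<kappa>)"
      using f U smooth_on_imp_continuous_on unfolding smooth_map_on_iff by blast
    then have "continuous_map (top_of_set (\<kappa> ` (U \<inter> W))) euclidean (f \<circ> inv_into U \<kappa>)"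
      by simp
    moreover have "continuous_map (subtopology M (U \<inter> W)) (top_of_set (\<kappa> ` (U \<inter> W))) \<kappa>"
    proof -
      have "continuous_map (subtopology M U) euclidean \<kappa>"
        using homeomorphic_imp_continuous_map[OF chart_homeomorphic[OF U(1)]]
        by (simp add: continuous_map_in_subtopology)
      then have "continuous_map (subtopology M (U \<inter> W)) euclidean \<kappa>"
        by (rule continuous_map_from_subtopology_mono) simp
      then show ?thesis by (auto simp: continuous_map_in_subtopology)
    qed
    ultimately have "continuous_map (subtopology M (U \<inter> W)) euclidean ((f \<circ> inv_into U \<kappa>) \<circ> \<kappa>)"
      by (rule continuous_map_compose[rotated])
    then have "continuous_map (subtopology M (U \<inter> W)) euclidean f"
      by (rule continuous_map_eq) (use chart_inj[OF U(1)] in \<open>auto simp: inv_into_f_f\<close>)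
    then show "continuous_map (subtopology ?X (case i of (U, \<kappa>) \<Rightarrow> U \<inter> W)) euclidean f"
      using U(2) by (simp add: subtopology_subtopology inf.absorb2 Int_commute Int_left_commute)
  next
    fix x assume "x \<in> topspace ?X"
    then show "\<exists>j. j \<in> \<A> \<and> x \<in> (case j of (U, \<kappa>) \<Rightarrow> U \<inter> W) \<and> f x = f x"
      using chart_cover[of x] by auto
  qed auto
qed

end

section \<open>Locally finite families of bump functions\<close>

text \<open>Finitely many of the neighbourhoods that witness local finiteness cover
  \<open>K\<close>.\<close>

lemma compactin_meets_finite:
  assumes "compactin M K" "locally_finite_in M \<V>" "K \<subseteq> topspace M"
  shows "finite {V \<in> \<V>. V \<inter> K \<noteq> {}}"
proof -
  obtain N where N: "\<And>x. x \<in> K \<Longrightarrow> openin M (N x) \<and> x \<in> N x \<and> finite {V \<in> \<V>. V \<inter> N x \<noteq> {}}"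
    using assms(2,3) unfolding locally_finite_in_def by (metis subsetD)
  obtain F where F: "finite F" "F \<subseteq> K" "K \<subseteq> \<Union>(N ` F)"
    using assms(1) N unfolding compactin_def
    by (smt (verit, ccfv_threshold) finite_subset_image imageE subset_eq UN_I Union_iff image_eqI)
  have "{V \<in> \<V>. V \<inter> K \<noteq> {}} \<subseteq> (\<Union>x\<in>F. {V \<in> \<V>. V \<inter> N x \<noteq> {}})"
    using F(3) by blast
  then show ?thesis
    using F(1,2) N by (meson finite_UN_I finite_subset subsetD)
qed

text \<open>The function is written down in one chart and extended by zero; \<open>D\<close> and
  \<open>C\<close> are the parts of the chart over an open ball and its closed ball. Compactness of
  \<open>C\<close> is used to count members of a locally finite cover, and closedness to glue with
  zero.\<close>

lemma smooth_bump_exists: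
  fixes M :: "'m topology" and \<A> :: "('m, 'n::real_inner) chart set"
  assumes M: "smooth_manifold M \<A>" and G: "openin M G" "x \<in> G"
  shows "\<exists>\<beta> C D. openin M D \<and> x \<in> D \<and> D \<subseteq> C \<and> C \<subseteq> G \<and> compactin M C \<and> closedin M C \<and>
     smooth_map_on \<A> (topspace M) \<beta> \<and>
     (\<forall>y. 0 \<le> \<beta> y) \<and> (\<forall>y\<in>D. 0 < \<beta> y) \<and> (\<forall>y. y \<notin> C \<longrightarrow> \<beta> y = (0::real))"
proof -
  have at: "smooth_atlas M \<A>" and H: "Hausdorff_space M" using M by (auto simp: smooth_manifold_def)
  have "x \<in> topspace M" using G openin_subset by blast
  then obtain U \<kappa> where U: "(U, \<kappa>) \<in> \<A>" "x \<in> U" using chart_cover[OF at] by blast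
  note inj = chart_inj[OF at U(1)]
  have UM: "U \<subseteq> topspace M" using chart_openin[OF at U(1)] openin_subset by blast
  define a where "a = \<kappa> x"
  have "open (\<kappa> ` (U \<inter> G))" "a \<in> \<kappa> ` (U \<inter> G)"
    using open_chart_image[OF at U(1) G(1)] U G by (auto simp: a_def)
  then obtain r where r: "0 < r" "cball a r \<subseteq> \<kappa> ` (U \<inter> G)"
    using open_contains_cball by blast
  define \<beta> where "\<beta> y = (if y \<in> U then flat 0 (r\<^sup>2 - (\<kappa> y - a) \<bullet> (\<kappa> y - a)) else 0)" for y
  define C where "C = inv_into U \<kappa> ` cball a r"
  define O' where "O' = {y \<in> topspace (subtopology M U). \<kappa> y \<in> ball a r}"
  have inv: "inv_into U \<kappa> z \<in> U \<inter> G" "\<kappa> (inv_into U \<kappa> z) = z" if z: "z \<in> cball a r" for z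
  proof -
    obtain y where "y \<in> U" "y \<in> G" "z = \<kappa> y" using r z by blast
    then show "inv_into U \<kappa> z \<in> U \<inter> G" "\<kappa> (inv_into U \<kappa> z) = z" using inj by (auto simp: inv_into_f_f)
  qed
  have C_iff: "y \<in> C \<longleftrightarrow> y \<in> U \<and> \<kappa> y \<in> cball a r" for y
    unfolding C_def using inv inj by (auto simp: image_iff inv_into_f_f intro!: bexI[of _ "\<kappa> y"])
  obtain g where g: "homeomorphic_maps (subtopology M U) (top_of_set (\<kappa> ` U)) \<kappa> g"
    using chart_homeomorphic[OF at U(1)] homeomorphic_map_maps by blast
  have cb: "cball a r \<subseteq> \<kappa> ` U" using r by blast
  have "compact (cball a r)"
    by (rule compact_cball_finite_dimensional) (use at in \<open>simp add: smooth_atlas_def\<close>)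
  then have "compactin (top_of_set (\<kappa> ` U)) (cball a r)"
    using cb by (simp add: compactin_subtopology)
  then have "compactin (subtopology M U) (g ` cball a r)"
    using g image_compactin unfolding homeomorphic_maps_def by blast
  moreover have "g z = inv_into U \<kappa> z" if z: "z \<in> cball a r" for z
  proof -
    obtain y where "y \<in> U" "z = \<kappa> y" using cb z by blast
    then show ?thesis using g UM inj by (auto simp: homeomorphic_maps_def inv_into_f_f)
  qed
  ultimately have "compactin (subtopology M U) C" by (simp add: C_def)
  then have "compactin M C" by (simp add: compactin_subtopology)
  \<comment> \<open>The Hausdorff property enters here. \<open>C\<close> has to be closed in
    \<open>M\<close> and not merely in \<open>U\<close>, so that a point outside \<open>U\<close>
    has a neighbourhood on which \<open>\<beta>\<close> vanishes.\<close>
  then have closed: "closedin M C" using H compactin_imp_closedin by blast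
  have "continuous_map (subtopology M U) euclidean \<kappa>"
    using g by (simp add: homeomorphic_maps_def continuous_map_in_subtopology)
  then have "openin (subtopology M U) O'"
    unfolding O'_def by (rule openin_continuous_map_preimage) simp
  then have opO: "openin M O'"
    using chart_openin[OF at U(1)] openin_trans_full by blast
  have pos: "0 < \<beta> y" if "y \<in> O'" for y
  proof -
    have "y \<in> U" "norm (\<kappa> y - a) < r" using that by (auto simp: O'_def dist_norm norm_minus_commute)
    then show ?thesis
      by (auto simp: \<beta>_def dot_square_norm intro!: flat_pos power_strict_mono)
  qed
  have zero: "\<beta> y = 0" if "y \<notin> C" for y
  proof (cases "y \<in> U")
    case True
    then have "r \<le> norm (\<kappa> y - a)" using that by (auto simp: C_iff dist_norm norm_minus_commute)
    then show ?thesis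
      using r(1) by (auto simp: \<beta>_def dot_square_norm intro!: flat_eq_0 power_mono)
  qed (simp add: \<beta>_def)
  have "smooth_map_on \<A> (topspace M) \<beta>"
  proof (rule smooth_map_on_local[OF at])
    fix p assume p: "p \<in> topspace M"
    show "\<exists>N. openin M N \<and> p \<in> N \<and> smooth_map_on \<A> N \<beta>"
    proof (cases "p \<in> U")
      case True
      have "smooth_map_on \<A> U \<beta>"
        unfolding smooth_map_on_iff
      proof safe
        fix U' \<kappa>' assume U': "(U', \<kappa>') \<in> \<A>"
        have op: "open (\<kappa>' ` (U' \<inter> U))"
          using open_chart_image[OF at U' chart_openin[OF at U(1)]] .
        have "smooth_on (\<kappa>' ` (U' \<inter> U)) (\<kappa> \<circ> inv_into U' \<kappa>')"
          using chart_transition[OF at U' U(1)] .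
        from smooth_on_bump[OF op this]
        show "smooth_on (\<kappa>' ` (U' \<inter> U)) (\<beta> \<circ> inv_into U' \<kappa>')"
          by (rule smooth_on_cong[OF op]) (use chart_inj[OF at U'] in \<open>auto simp: \<beta>_def inv_into_f_f\<close>)
      qed
      then show ?thesis using True chart_openin[OF at U(1)] by blast
    next
      case False
      have op: "openin M (topspace M - C)" using closed by blast
      have "smooth_map_on \<A> (topspace M - C) \<beta>"
        by (rule smooth_map_on_cong[OF at op smooth_map_on_const[of _ _ 0]]) (simp add: zero)
      then show ?thesis using op p False C_iff by blast
    qed
  qed
  moreover have "x \<in> O'" "O' \<subseteq> C"
    using U UM r by (auto simp: O'_def C_iff a_def)
  moreover have "C \<subseteq> G"
    unfolding C_def using inv(1) by blast
  ultimately show ?thesis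
    using opO pos zero closed \<open>compactin M C\<close>
    by (intro exI[of _ \<beta>] exI[of _ C] exI[of _ O']) (auto simp: \<beta>_def flat_nonneg)
qed

text \<open>The refinement is indexed by its own members, each with a chosen centre. The empty set
  is discarded because members are later counted through the compact sets that they meet.\<close>

lemma paracompact_refinement:
  assumes "paracompact_space M" "\<And>x. x \<in> topspace M \<Longrightarrow> openin M (G x) \<and> x \<in> G x"
  obtains \<V> c where "locally_finite_in M \<V>" "\<Union>\<V> = topspace M"
    "\<forall>V\<in>\<V>. openin M V \<and> V \<noteq> {} \<and> c V \<in> topspace M \<and> V \<subseteq> G (c V)"
proof -
  have "\<forall>U\<in>G ` topspace M. openin M U" using assms(2) by blast
  moreover have "\<Union>(G ` topspace M) = topspace M"
  proof
    show "\<Union>(G ` topspace M) \<subseteq> topspace M" using assms(2) openin_subset by blast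
    show "topspace M \<subseteq> \<Union>(G ` topspace M)" using assms(2) by blast
  qed
  ultimately have "\<exists>\<V>. (\<forall>V\<in>\<V>. openin M V \<and> (\<exists>U\<in>G ` topspace M. V \<subseteq> U)) \<and> \<Union>\<V> = topspace M \<and>
      locally_finite_in M \<V>"
    using assms(1)[unfolded paracompact_space_def, THEN spec[of _ "G ` topspace M"]] by blast
  then obtain \<V> where V: "\<forall>V\<in>\<V>. openin M V \<and> (\<exists>U\<in>G ` topspace M. V \<subseteq> U)" "\<Union>\<V> = topspace M"
    "locally_finite_in M \<V>"
    by (elim exE conjE)
  have "\<forall>V\<in>\<V>. \<exists>x. x \<in> topspace M \<and> V \<subseteq> G x"
    using V(1) by blast
  then obtain c where c: "\<forall>V\<in>\<V>. c V \<in> topspace M \<and> V \<subseteq> G (c V)"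
    by (rule bchoice[THEN exE])
  have "locally_finite_in M (\<V> - {{}})"
    by (rule locally_finite_in_subset[OF V(3)]) blast
  moreover have "\<Union>(\<V> - {{}}) = topspace M" using V(2) by auto
  ultimately show thesis
    by (rule that[of _ c]) (use V(1) c in auto)
qed

text \<open>Refining the sets \<open>W x\<close> on which the bumps are positive gives a locally
  finite family of small sets, but says nothing about the larger supports \<open>C x\<close>. Hence
  a locally finite family \<V> of relatively compact sets is fixed beforehand, and each support is
  placed inside one of its members. Supports can accumulate only if infinitely many of them share a
  member of \<V>, which compactness excludes.\<close>

lemma smooth_partition:
  fixes M :: "'m topology" and \<A> :: "('m, 'n::real_inner) chart set"
  assumes M: "smooth_manifold M \<A>" and para: "paracompact_space M"
    and G: "\<And>x. x \<in> topspace M \<Longrightarrow> openin M (G x) \<and> x \<in> G x"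
  obtains I :: "'m set set" and c :: "'m set \<Rightarrow> 'm" and C :: "'m set \<Rightarrow> 'm set"
    and \<beta> :: "'m set \<Rightarrow> 'm \<Rightarrow> real"
  where "\<And>i. i \<in> I \<Longrightarrow> c i \<in> topspace M" "\<And>i. i \<in> I \<Longrightarrow> closedin M (C i)"
    "\<And>i. i \<in> I \<Longrightarrow> C i \<subseteq> G (c i)"
    "\<And>i. i \<in> I \<Longrightarrow> smooth_map_on \<A> (topspace M) (\<beta> i)"
    "\<And>i x. i \<in> I \<Longrightarrow> 0 \<le> \<beta> i x" "\<And>i x. i \<in> I \<Longrightarrow> x \<notin> C i \<Longrightarrow> \<beta> i x = 0"
    "\<And>x. x \<in> topspace M \<Longrightarrow> \<exists>i\<in>I. 0 < \<beta> i x"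
    "\<And>x. x \<in> topspace M \<Longrightarrow> \<exists>N. openin M N \<and> x \<in> N \<and> finite {i \<in> I. C i \<inter> N \<noteq> {}}"
proof -
  have "\<exists>N K. openin M N \<and> x \<in> N \<and> N \<subseteq> K \<and> K \<subseteq> G x \<and> compactin M K" if "x \<in> topspace M" for x
    using smooth_bump_exists[OF M, of "G x" x] G[OF that] by blast
  then obtain N K where NK: "\<And>x. x \<in> topspace M \<Longrightarrow>
      openin M (N x) \<and> x \<in> N x \<and> N x \<subseteq> K x \<and> K x \<subseteq> G x \<and> compactin M (K x)"
    by metis
  have NN: "openin M (N x) \<and> x \<in> N x" if "x \<in> topspace M" for x
    using NK[OF that] by blast
  obtain \<V> d where V: "locally_finite_in M \<V>" "\<Union>\<V> = topspace M"
    and "\<forall>V\<in>\<V>. openin M V \<and> V \<noteq> {} \<and> d V \<in> topspace M \<and> V \<subseteq> N (d V)"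
    using paracompact_refinement[OF para, of N, OF NN] by metis
  then have d: "\<And>V. V \<in> \<V> \<Longrightarrow> openin M V \<and> V \<noteq> {} \<and> d V \<in> topspace M \<and> V \<subseteq> N (d V)" by blast
  have "\<forall>x\<in>topspace M. \<exists>V. V \<in> \<V> \<and> x \<in> V"
    using V(2) by blast
  then obtain v where v: "\<And>x. x \<in> topspace M \<Longrightarrow> v x \<in> \<V> \<and> x \<in> v x"
    by metis
  have "\<exists>\<beta> C D. openin M D \<and> x \<in> D \<and> D \<subseteq> C \<and> C \<subseteq> v x \<and> compactin M C \<and> closedin M C \<and>
     smooth_map_on \<A> (topspace M) \<beta> \<and>
     (\<forall>y. 0 \<le> \<beta> y) \<and> (\<forall>y\<in>D. 0 < \<beta> y) \<and> (\<forall>y. y \<notin> C \<longrightarrow> \<beta> y = (0::real))" if "x \<in> topspace M" for x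
    using smooth_bump_exists[OF M, of "v x" x] v[OF that] d by blast
  then obtain \<beta> C W where b: "\<And>x. x \<in> topspace M \<Longrightarrow> openin M (W x) \<and> x \<in> W x \<and> W x \<subseteq> C x \<and>
      C x \<subseteq> v x \<and> closedin M (C x) \<and> smooth_map_on \<A> (topspace M) (\<beta> x) \<and>
     (\<forall>y. 0 \<le> \<beta> x y) \<and> (\<forall>y\<in>W x. 0 < \<beta> x y) \<and> (\<forall>y. y \<notin> C x \<longrightarrow> \<beta> x y = (0::real))"
    by metis
  have bW: "openin M (W x) \<and> x \<in> W x" if "x \<in> topspace M" for x
    using b[OF that] by blast
  obtain I e where I: "locally_finite_in M I" "\<Union>I = topspace M"
    and "\<forall>i\<in>I. openin M i \<and> i \<noteq> {} \<and> e i \<in> topspace M \<and> i \<subseteq> W (e i)"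
    using paracompact_refinement[OF para, of W, OF bW] by metis
  then have e: "\<And>i. i \<in> I \<Longrightarrow> openin M i \<and> i \<noteq> {} \<and> e i \<in> topspace M \<and> i \<subseteq> W (e i)" by blast
  \<comment> \<open>If the support with index \<open>i\<close> is assigned to \<open>V\<close>, then
    \<open>i\<close> is a nonempty subset of the compact set \<open>K (d V)\<close>. Only finitely
    many members of the locally finite family \<open>I\<close> meet that set.\<close>
  have fin_v: "finite {i \<in> I. v (e i) = V}" if "V \<in> \<V>" for V
  proof (rule finite_subset)
    show "{i \<in> I. v (e i) = V} \<subseteq> {i \<in> I. i \<inter> K (d V) \<noteq> {}}"
    proof safe
      fix i assume i: "i \<in> I" "V = v (e i)" "i \<inter> K (d (v (e i))) = {}"
      have "i \<subseteq> K (d (v (e i)))" using e[OF i(1)] b[of "e i"] d[of V] NK[of "d V"] that i(2) by blast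
      then show False using e[OF i(1)] i(3) by blast
    qed
    have K: "compactin M (K (d V))" using NK[of "d V"] d[OF that] by blast
    show "finite {i \<in> I. i \<inter> K (d V) \<noteq> {}}"
      by (rule compactin_meets_finite[OF K I(1) compactin_subset_topspace[OF K]])
  qed
  show thesis
  \<comment> \<open>The set \<open>G\<close> that contains a support belongs to the member of \<V>
    around that support. The centre is therefore \<open>d (v (e i))\<close>, whereas the bump is the
    one built at \<open>e i\<close>.\<close>
  proof (rule that[of I "\<lambda>i. d (v (e i))" "\<lambda>i. C (e i)" "\<lambda>i. \<beta> (e i)"])
    fix i assume i: "i \<in> I"
    note ei = e[OF i]
    show "d (v (e i)) \<in> topspace M" using d v ei by blast
    show "closedin M (C (e i))" using b ei by blast
    show "C (e i) \<subseteq> G (d (v (e i)))" using b[of "e i"] d[of "v (e i)"] v[of "e i"] NK[of "d (v (e i))"] ei by blast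
    show "smooth_map_on \<A> (topspace M) (\<beta> (e i))" using b ei by blast
    show "0 \<le> \<beta> (e i) x" for x using b ei by blast
    show "\<beta> (e i) x = 0" if "x \<notin> C (e i)" for x using b ei that by blast
  next
    fix x assume x: "x \<in> topspace M"
    then obtain i where i: "i \<in> I" "x \<in> i" using I(2) by blast
    then show "\<exists>i\<in>I. 0 < \<beta> (e i) x" using b e by blast
    obtain O' where O': "openin M O'" "x \<in> O'" "finite {V \<in> \<V>. V \<inter> O' \<noteq> {}}"
      using V(1) x unfolding locally_finite_in_def by metis
    have "{i \<in> I. C (e i) \<inter> O' \<noteq> {}} \<subseteq> (\<Union>V\<in>{V \<in> \<V>. V \<inter> O' \<noteq> {}}. {i \<in> I. v (e i) = V})"
    proof
      fix i assume "i \<in> {i \<in> I. C (e i) \<inter> O' \<noteq> {}}"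
      then obtain z where i: "i \<in> I" "z \<in> C (e i)" "z \<in> O'" by blast
      have "e i \<in> topspace M" using e[OF i(1)] by blast
      then have "v (e i) \<in> \<V>" "z \<in> v (e i)" using v b[of "e i"] i(2) by blast+
      then show "i \<in> (\<Union>V\<in>{V \<in> \<V>. V \<inter> O' \<noteq> {}}. {i \<in> I. v (e i) = V})" using i by blast
    qed
    moreover have "finite (\<Union>V\<in>{V \<in> \<V>. V \<inter> O' \<noteq> {}}. {i \<in> I. v (e i) = V})"
      using O'(3) fin_v by blast
    ultimately have "finite {i \<in> I. C (e i) \<inter> O' \<noteq> {}}" by (rule finite_subset)
    with O' show "\<exists>N. openin M N \<and> x \<in> N \<and> finite {i \<in> I. C (e i) \<inter> N \<noteq> {}}" by blast
  qed
qed

section \<open>Hilbert modules\<close>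

lemma star_scaleR: "star (r *\<^sub>R x) = r *\<^sub>R star (x :: 'a::unital_cstar_algebra)"
  by (metis star_scaleC scaleC_of_real complex_cnj_complex_of_real)

context hilbert_module
begin

lemma carrier_closed:
  "0 \<in> carrier V" "v \<in> carrier V \<Longrightarrow> w \<in> carrier V \<Longrightarrow> v + w \<in> carrier V"
  "v \<in> carrier V \<Longrightarrow> w \<in> carrier V \<Longrightarrow> v - w \<in> carrier V" "v \<in> carrier V \<Longrightarrow> r *\<^sub>R v \<in> carrier V"
  using subspace_carrier by (auto simp: subspace_0 subspace_add subspace_diff subspace_scale)

lemma ip_scaleR_right: "u \<in> carrier V \<Longrightarrow> v \<in> carrier V \<Longrightarrow> ip V u (r *\<^sub>R v) = r *\<^sub>R ip V u v"
  using ip_act_right[of u v "r *\<^sub>R 1"] act_scaleR[of v r] by simp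

lemma ip_diff_right:
  "u \<in> carrier V \<Longrightarrow> v \<in> carrier V \<Longrightarrow> w \<in> carrier V \<Longrightarrow> ip V u (v - w) = ip V u v - ip V u w"
  using ip_add_right[of u v "- 1 *\<^sub>R w"] ip_scaleR_right[of u w "- 1"] carrier_closed(4)[of w "- 1"] by simp

lemma ip_add_left:
  "u \<in> carrier V \<Longrightarrow> v \<in> carrier V \<Longrightarrow> w \<in> carrier V \<Longrightarrow> ip V (u + v) w = ip V u w + ip V v w"
  by (simp add: ip_star[of w] ip_add_right star_add carrier_closed)

lemma ip_scaleR_left: "u \<in> carrier V \<Longrightarrow> v \<in> carrier V \<Longrightarrow> ip V (r *\<^sub>R u) v = r *\<^sub>R ip V u v"
  by (simp add: ip_star[of v] ip_scaleR_right star_scaleR carrier_closed)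

lemma ip_diff_left:
  "u \<in> carrier V \<Longrightarrow> v \<in> carrier V \<Longrightarrow> w \<in> carrier V \<Longrightarrow> ip V (u - v) w = ip V u w - ip V v w"
  using ip_add_left[of u "- 1 *\<^sub>R v" w] ip_scaleR_left[of v w "- 1"] carrier_closed(4)[of v "- 1"] by simp

lemma norm_ip_self: "v \<in> carrier V \<Longrightarrow> norm (ip V v v) = (norm v)\<^sup>2"
  using norm_ip[of v] by simp

lemma ip_eqI:
  assumes "v \<in> carrier V" "w \<in> carrier V" "\<And>u. u \<in> carrier V \<Longrightarrow> ip V u v = ip V u w"
  shows "v = w"
proof -
  have "ip V (v - w) (v - w) = 0"
    using assms by (simp add: ip_diff_right carrier_closed)
  then have "norm (v - w) = 0"
    using norm_ip_self[of "v - w"] assms by (simp add: carrier_closed)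
  then show ?thesis by simp
qed

text \<open>Polarization replaces the Cauchy-Schwarz inequality, whose proof needs the order on the
  \<open>C\<^sup>*\<close>-algebra.\<close>

lemma norm_ip_symmetric_le:
  assumes "u \<in> carrier V" "v \<in> carrier V" "ip V u v = ip V v u"
  shows "2 * norm (ip V u v) \<le> (norm u + norm v)\<^sup>2"
proof -
  \<comment> \<open>Since \<open>ip V u v = ip V v u\<close>, the two terms of the complex
    polarization identity with imaginary coefficients cancel and the real identity suffices.\<close>
  have "4 *\<^sub>R ip V u v = ip V (u + v) (u + v) - ip V (u - v) (u - v)"
    using assms(1,2) assms(3)[symmetric]
    by (simp add: ip_add_left ip_add_right ip_diff_left ip_diff_right carrier_closed algebra_simps)
      (metis (no_types, opaque_lifting) add.assoc numeral_Bit0 one_add_one scaleR_add_left scaleR_one)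
  then have "4 * norm (ip V u v) \<le> norm (ip V (u + v) (u + v)) + norm (ip V (u - v) (u - v))"
    by (metis norm_scaleR norm_triangle_ineq4 abs_numeral)
  also have "\<dots> = (norm (u + v))\<^sup>2 + (norm (u - v))\<^sup>2"
    using assms by (simp add: norm_ip_self carrier_closed)
  also have "\<dots> \<le> (norm u + norm v)\<^sup>2 + (norm u + norm v)\<^sup>2"
    by (intro add_mono power_mono norm_triangle_ineq norm_triangle_ineq4) auto
  finally show ?thesis by simp
qed

text \<open>Solutions of \<open>T v = w\<close> are the fixed points of
  \<open>\<lambda>v. w - (T v - v)\<close>, and additivity turns closeness to the identity into a
  contraction estimate. Additivity is all that is asked of \<open>T\<close>, so that the result also
  applies to an adjoint, which is given as a bare function.\<close>

lemma additive_near_identity_surj: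
  assumes T: "\<And>v. v \<in> carrier V \<Longrightarrow> T v \<in> carrier V"
    and add: "\<And>u v. u \<in> carrier V \<Longrightarrow> v \<in> carrier V \<Longrightarrow> T (u + v) = T u + T v"
    and c: "0 \<le> c" "c < 1" "\<And>v. v \<in> carrier V \<Longrightarrow> norm (T v - v) \<le> c * norm v"
    and w: "w \<in> carrier V"
  shows "\<exists>v\<in>carrier V. T v = w"
proof -
  have diff: "T (u - v) = T u - T v" if "u \<in> carrier V" "v \<in> carrier V" for u v
    using add[of "u - v" v] that by (simp add: carrier_closed algebra_simps)
  have "\<exists>!v\<in>carrier V. w - (T v - v) = v"
  proof (rule Banach_fix[OF complete_carrier _ c(1,2)])
    show "carrier V \<noteq> {}" using w by blast
    show "(\<lambda>v. w - (T v - v)) ` carrier V \<subseteq> carrier V" using w T by (auto simp: carrier_closed)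
    fix u v assume uv: "u \<in> carrier V" "v \<in> carrier V"
    have "dist (w - (T u - u)) (w - (T v - v)) = norm (T (u - v) - (u - v))"
      unfolding dist_norm diff[OF uv] by (subst norm_minus_commute) (simp add: algebra_simps)
    also have "\<dots> \<le> c * dist u v"
      using c(3)[of "u - v"] uv by (simp add: carrier_closed dist_norm)
    finally show "dist (w - (T u - u)) (w - (T v - v)) \<le> c * dist u v" .
  qed
  then show ?thesis by auto
qed

end

text \<open>An adjoint is given only through its pairing identity; definiteness of the inner product
  determines its values and makes it additive.\<close>

lemma adjoint_additive:
  assumes "hilbert_module V"
    and S: "\<And>w. w \<in> carrier W \<Longrightarrow> S w \<in> carrier V"
    and T: "\<And>v. v \<in> carrier V \<Longrightarrow> T v \<in> carrier W"
    and adj: "\<And>v w. v \<in> carrier V \<Longrightarrow> w \<in> carrier W \<Longrightarrow> ip W (T v) w = ip V v (S w)"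
    and "hilbert_module W" "u \<in> carrier W" "w \<in> carrier W"
  shows "S (u + w) = S u + S w"
proof -
  interpret V: hilbert_module V by fact
  interpret W: hilbert_module W by fact
  show ?thesis
    using assms(6,7) S T
    by (intro V.ip_eqI) (simp_all add: V.carrier_closed W.carrier_closed V.ip_add_right W.ip_add_right adj[symmetric])
qed

context hilbert_module
begin

text \<open>Cauchy-Schwarz would transfer the bound 1/8 to the adjoint unchanged. Polarization
  yields a weaker bound, but one still below 1, which is all that a contraction needs.\<close>

lemma adjoint_near_identity:
  assumes T: "\<And>v. v \<in> carrier V \<Longrightarrow> T v \<in> carrier V"
    and S: "\<And>v. v \<in> carrier V \<Longrightarrow> S v \<in> carrier V"
    and adj: "\<And>v w. v \<in> carrier V \<Longrightarrow> w \<in> carrier V \<Longrightarrow> ip V (T v) w = ip V v (S w)"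
    and T_le: "\<And>v. v \<in> carrier V \<Longrightarrow> norm (T v - v) \<le> norm v / 8"
    and w: "w \<in> carrier V"
  shows "norm (S w - w) \<le> 9 / 10 * norm w"
proof -
  define y where "y = S w - w"
  define x where "x = T y - y"
  have mem: "y \<in> carrier V" "x \<in> carrier V" "T y \<in> carrier V" "S w \<in> carrier V"
    using w S T by (auto simp: x_def y_def carrier_closed)
  \<comment> \<open>Moving \<open>T\<close> across the inner product turns
    \<open>ip V (T y - y) w\<close> into \<open>ip V y (S w - w)\<close>. The result is
    self-adjoint, so \<open>ip V w x\<close> has the same value and the symmetric estimate applies
    to \<open>x\<close> and \<open>w\<close>.\<close>
  have 1: "ip V x w = ip V y y"
    using mem w by (simp add: x_def ip_diff_left adj) (simp add: y_def ip_diff_right carrier_closed S)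
  then have "ip V w x = ip V y y"
    using ip_star[of x w] ip_star[of y y] mem w by simp
  then have "2 * (norm y)\<^sup>2 \<le> (norm x + norm w)\<^sup>2"
    using norm_ip_symmetric_le[of x w] mem w 1 by (simp add: norm_ip_self)
  also have "\<dots> \<le> (norm y / 8 + norm w)\<^sup>2"
    using T_le[OF mem(1)] by (intro power_mono add_mono) (auto simp: x_def)
  finally have le: "2 * (norm y)\<^sup>2 \<le> (norm y / 8 + norm w)\<^sup>2" .
  have "norm y \<le> 9 / 10 * norm w"
  proof (rule ccontr)
    assume "\<not> ?thesis"
    then have *: "norm w < 10 / 9 * norm y" by simp
    then have pos: "0 < norm y" using norm_ge_zero[of w] by linarith
    \<comment> \<open>Here 1/8 + 10/9 = 89/72 is below 5/4, whose square 25/16 is below 2. The value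
      9/10 is just a convenient number below 1 that makes this work.\<close>
    have "norm y / 8 + norm w \<le> 5 / 4 * norm y" using * pos by linarith
    then have "(norm y / 8 + norm w)\<^sup>2 \<le> (5 / 4 * norm y)\<^sup>2"
      by (intro power_mono) simp_all
    also have "\<dots> = 25 / 16 * (norm y)\<^sup>2" by (simp add: power_mult_distrib power_divide)
    also have "\<dots> < 2 * (norm y)\<^sup>2" using pos by simp
    finally show False using le by simp
  qed
  then show ?thesis by (simp add: y_def)
qed

end

section \<open>Adjointable maps\<close>

lemma norm_apply_map: "norm (apply_map T v) \<le> norm T * norm v"
  by transfer (rule bounded_map_le_onorm)

lemma norm_bounded_map_le: "(\<And>v. norm (apply_map T v) \<le> K * norm v) \<Longrightarrow> 0 \<le> K \<Longrightarrow> norm T \<le> K"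
  by transfer (rule bounded_map_onorm_le)

lemma apply_map_0 [simp]: "apply_map T 0 = 0"
  using norm_apply_map[of T 0] by simp

lemma apply_map_zero_map [simp]: "apply_map 0 v = 0"
  by transfer simp

lemma apply_map_add: "apply_map (S + T) v = apply_map S v + apply_map T v"
  by transfer simp

lemma apply_map_scaleR: "apply_map (r *\<^sub>R T) v = r *\<^sub>R apply_map T v"
  by transfer simp

lemma apply_map_sum: "apply_map (\<Sum>i\<in>I. T i) v = (\<Sum>i\<in>I. apply_map (T i) v)"
  by (induction I rule: infinite_finite_induct) (auto simp: apply_map_add)

lemma bounded_linear_apply_map: "bounded_linear (\<lambda>T. apply_map T v)"
  by (rule bounded_linear_intro[of _ "norm v"]) (auto simp: apply_map_add apply_map_scaleR norm_apply_map)

lemma continuous_apply_map: "continuous_on UNIV (\<lambda>T. apply_map T v)"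
  by (rule linear_continuous_on[OF bounded_linear_apply_map])

lemma apply_map_Bounded_map:
  assumes "\<And>v. norm (f v) \<le> K * norm v"
  shows "apply_map (Bounded_map f) = f"
  using assms by (intro Bounded_map_inverse) auto

lemma le_abs_mult: "x \<le> K * y \<Longrightarrow> 0 \<le> y \<Longrightarrow> x \<le> \<bar>K\<bar> * (y::real)"
  by (meson abs_ge_self mult_right_mono order_trans)

text \<open>\<open>Bounded_map\<close> is meaningful only on functions with a global bound. A bound
  on the carrier suffices because the extension vanishes elsewhere.\<close>

lemma apply_as_hom:
  assumes "\<And>v. v \<in> carrier V \<Longrightarrow> norm (f v) \<le> K * norm v"
  shows "apply_map (as_hom V f) v = (if v \<in> carrier V then f v else 0)"
proof -
  have "norm (if v \<in> carrier V then f v else 0) \<le> \<bar>K\<bar> * norm v" for v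
    using assms[of v] by (auto intro: le_abs_mult)
  then have "apply_map (as_hom V f) = (\<lambda>v. if v \<in> carrier V then f v else 0)"
    unfolding as_hom_def by (rule apply_map_Bounded_map)
  then show ?thesis by simp
qed

section \<open>Composition of bounded maps\<close>

lift_definition comp_map ::
    "('w::real_normed_vector, 'x::real_normed_vector) bounded_map \<Rightarrow> ('v::real_normed_vector, 'w) bounded_map
      \<Rightarrow> ('v, 'x) bounded_map" is "\<lambda>g f v. g (f v)"
proof -
  fix g :: "'w \<Rightarrow> 'x" and f :: "'v \<Rightarrow> 'w"
  assume "\<exists>K. \<forall>v. norm (g v) \<le> K * norm v" "\<exists>K. \<forall>v. norm (f v) \<le> K * norm v"
  then obtain K L where K: "\<And>v. norm (g v) \<le> K * norm v" and L: "\<And>v. norm (f v) \<le> L * norm v" by blast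
  have "norm (g (f v)) \<le> (\<bar>K\<bar> * L) * norm v" for v
  proof -
    have "norm (g (f v)) \<le> \<bar>K\<bar> * norm (f v)"
      using K[of "f v"] by (rule le_abs_mult) simp
    also have "\<dots> \<le> \<bar>K\<bar> * (L * norm v)" by (intro mult_left_mono L) auto
    finally show ?thesis by (simp add: mult.assoc)
  qed
  then show "\<exists>K. \<forall>v. norm (g (f v)) \<le> K * norm v" by blast
qed

lemma apply_comp_map: "apply_map (comp_map g f) v = apply_map g (apply_map f v)"
  by transfer simp

lemma norm_comp_map: "norm (comp_map g f) \<le> norm g * norm f"
proof (rule norm_bounded_map_le)
  fix v
  have "norm (apply_map g (apply_map f v)) \<le> norm g * (norm f * norm v)"
    by (rule order_trans[OF norm_apply_map]) (intro mult_left_mono norm_apply_map norm_ge_zero)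
  then show "norm (apply_map (comp_map g f) v) \<le> norm g * norm f * norm v"
    by (simp add: apply_comp_map mult.assoc)
qed simp

section \<open>The spaces of adjointable maps\<close>

lemma HomI:
  assumes "\<And>v. v \<notin> carrier V \<Longrightarrow> apply_map T v = 0" "\<And>v. v \<in> carrier V \<Longrightarrow> apply_map T v \<in> carrier W"
    "\<And>u v. u \<in> carrier V \<Longrightarrow> v \<in> carrier V \<Longrightarrow> apply_map T (u + v) = apply_map T u + apply_map T v"
    "\<And>v a. v \<in> carrier V \<Longrightarrow> apply_map T (act V v a) = act W (apply_map T v) a"
    "\<And>w. w \<in> carrier W \<Longrightarrow> S w \<in> carrier V"
    "\<And>v w. v \<in> carrier V \<Longrightarrow> w \<in> carrier W \<Longrightarrow> ip W (apply_map T v) w = ip V v (S w)"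
  shows "T \<in> Hom V W"
  unfolding Hom_def mem_Collect_eq by (intro conjI allI impI ballI exI[of _ S]) (simp_all add: assms)

lemma HomD:
  assumes "T \<in> Hom V W"
  shows "v \<notin> carrier V \<Longrightarrow> apply_map T v = 0" "v \<in> carrier V \<Longrightarrow> apply_map T v \<in> carrier W"
    "u \<in> carrier V \<Longrightarrow> v \<in> carrier V \<Longrightarrow> apply_map T (u + v) = apply_map T u + apply_map T v"
    "v \<in> carrier V \<Longrightarrow> apply_map T (act V v a) = act W (apply_map T v) a"
  using assms unfolding Hom_def by auto

lemma Hom_adjoint:
  assumes "T \<in> Hom V W"
  obtains S where "\<And>w. w \<in> carrier W \<Longrightarrow> S w \<in> carrier V"
    "\<And>v w. v \<in> carrier V \<Longrightarrow> w \<in> carrier W \<Longrightarrow> ip W (apply_map T v) w = ip V v (S w)"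
  using assms unfolding Hom_def by blast

text \<open>Real scalars act as \<open>r *\<^sub>R 1\<close>, so real homogeneity is contained in
  linearity over the algebra.\<close>

lemma Hom_scaleR_arg:
  assumes "hilbert_module V" "hilbert_module W" "T \<in> Hom V W" "v \<in> carrier V"
  shows "apply_map T (r *\<^sub>R v) = r *\<^sub>R apply_map T v"
  using HomD(2,4)[OF assms(3,4)] hilbert_module.act_scaleR[OF assms(1,4)] hilbert_module.act_scaleR[OF assms(2)]
  by metis

lemma subspace_Hom:
  assumes "hilbert_module V" "hilbert_module W"
  shows "subspace (Hom V W)"
proof -
  interpret V: hilbert_module V by fact
  interpret W: hilbert_module W by fact
  have act_0: "act W 0 a = 0" for a
    using W.act_add_left[OF W.carrier_closed(1) W.carrier_closed(1), of a] by simp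
  \<comment> \<open>The element \<open>r *\<^sub>R 1\<close> is central, so the order of the two
    actions can be exchanged.\<close>
  have act_scaleR: "act W (r *\<^sub>R w) a = r *\<^sub>R act W w a" if "w \<in> carrier W" for r w a
    using W.act_mult[OF that, of "r *\<^sub>R 1" a] W.act_mult[OF that, of a "r *\<^sub>R 1"] W.act_scaleR that W.act_closed by simp
  have ip_0: "ip W 0 w = 0" if "w \<in> carrier W" for w
    using W.ip_scaleR_left[OF that that, of 0] by simp
  have ip_0': "ip V w 0 = 0" if "w \<in> carrier V" for w
    using V.ip_scaleR_right[OF that that, of 0] by simp
  show ?thesis
  proof (rule subspaceI)
    show "0 \<in> Hom V W"
      by (rule HomI[where S = "\<lambda>_. 0"]) (auto simp: act_0 ip_0 ip_0' V.carrier_closed W.carrier_closed)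
    fix T T' assume T: "T \<in> Hom V W" and T': "T' \<in> Hom V W"
    obtain S where S: "\<And>w. w \<in> carrier W \<Longrightarrow> S w \<in> carrier V"
      "\<And>v w. v \<in> carrier V \<Longrightarrow> w \<in> carrier W \<Longrightarrow> ip W (apply_map T v) w = ip V v (S w)"
      by (rule Hom_adjoint[OF T]) blast
    obtain S' where S': "\<And>w. w \<in> carrier W \<Longrightarrow> S' w \<in> carrier V"
      "\<And>v w. v \<in> carrier V \<Longrightarrow> w \<in> carrier W \<Longrightarrow> ip W (apply_map T' v) w = ip V v (S' w)"
      by (rule Hom_adjoint[OF T']) blast
    show "T + T' \<in> Hom V W"
      using HomD[OF T] HomD[OF T'] S S'
      by (intro HomI[where S = "\<lambda>w. S w + S' w"])
        (auto simp: apply_map_add V.carrier_closed W.carrier_closed W.act_add_left W.ip_add_left V.ip_add_right)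
  next
    fix r T assume T: "T \<in> Hom V W"
    obtain S where S: "\<And>w. w \<in> carrier W \<Longrightarrow> S w \<in> carrier V"
      "\<And>v w. v \<in> carrier V \<Longrightarrow> w \<in> carrier W \<Longrightarrow> ip W (apply_map T v) w = ip V v (S w)"
      by (rule Hom_adjoint[OF T]) blast
    show "r *\<^sub>R T \<in> Hom V W"
      using HomD[OF T] S
      by (intro HomI[where S = "\<lambda>w. r *\<^sub>R S w"])
        (auto simp: apply_map_scaleR V.carrier_closed W.carrier_closed act_scaleR W.ip_scaleR_left
          V.ip_scaleR_right scaleR_add_right)
  qed
qed

text \<open>The lower bound makes \<open>t\<close> injective and its inverse \<open>g\<close>
  bounded. A right inverse \<open>g'\<close> of the adjoint is an adjoint of \<open>g\<close>: with
  \<open>w = t' (g' w)\<close>, the pairing of \<open>g v\<close> with \<open>w\<close> equals that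
  of \<open>t (g v) = v\<close> with \<open>g' w\<close>.\<close>

lemma invertible_homI:
  assumes V: "hilbert_module V" and W: "hilbert_module W" and t: "t \<in> Hom V W"
    and bound: "\<And>v. v \<in> carrier V \<Longrightarrow> norm v \<le> K * norm (apply_map t v)"
    and surj: "\<And>w. w \<in> carrier W \<Longrightarrow> \<exists>v\<in>carrier V. apply_map t v = w"
    and adj: "\<And>v w. v \<in> carrier V \<Longrightarrow> w \<in> carrier W \<Longrightarrow> ip W (apply_map t v) w = ip V v (t' w)"
    and adj_surj: "\<And>v. v \<in> carrier V \<Longrightarrow> \<exists>w\<in>carrier W. t' w = v"
  shows "invertible_hom V W t"
proof -
  interpret V: hilbert_module V by fact
  interpret W: hilbert_module W by fact
  obtain g where g: "\<And>w. w \<in> carrier W \<Longrightarrow> g w \<in> carrier V \<and> apply_map t (g w) = w"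
    using surj by metis
  obtain g' where g': "\<And>v. v \<in> carrier V \<Longrightarrow> g' v \<in> carrier W \<and> t' (g' v) = v"
    using adj_surj by metis
  have inj: "u = v" if "u \<in> carrier V" "v \<in> carrier V" "apply_map t u = apply_map t v" for u v
  proof -
    have "apply_map t (u - v) + apply_map t v = apply_map t u"
      using HomD(3)[OF t, of "u - v" v] that by (simp add: V.carrier_closed)
    then show ?thesis using bound[of "u - v"] that by (simp add: V.carrier_closed)
  qed
  have gb: "apply_map (as_hom W g) w = (if w \<in> carrier W then g w else 0)" for w
    by (rule apply_as_hom[of _ _ K]) (use g bound in metis)
  have "as_hom W g \<in> Hom W V"
  proof (rule HomI[where S = g'])
    show "apply_map (as_hom W g) (u + v) = apply_map (as_hom W g) u + apply_map (as_hom W g) v"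
      if "u \<in> carrier W" "v \<in> carrier W" for u v
      using g that HomD(3)[OF t, of "g u" "g v"] by (auto simp: gb V.carrier_closed W.carrier_closed intro!: inj)
    show "apply_map (as_hom W g) (act W v a) = act V (apply_map (as_hom W g) v) a" if "v \<in> carrier W" for v a
      using g that HomD(4)[OF t, of "g v" a] by (auto simp: gb V.act_closed W.act_closed intro!: inj)
    show "ip V (apply_map (as_hom W g) v) w = ip W v (g' w)" if "v \<in> carrier W" "w \<in> carrier V" for v w
      using adj[of "g v" "g' w"] g g' that by (simp add: gb)
  qed (use g g' in \<open>auto simp: gb\<close>)
  moreover have "g (apply_map t v) = v" if "v \<in> carrier V" for v
    using that g HomD(2)[OF t] by (intro inj) auto
  ultimately show ?thesis
    unfolding invertible_hom_def using t g HomD(2)[OF t] by (auto simp: gb intro!: bexI[of _ "as_hom W g"])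
qed

text \<open>With \<open>s'\<close> the inverse of \<open>s\<close>, the hypothesis says that \<open>t \<circ> s' / \<sigma>\<close> is close to the identity.\<close>

lemma invertible_hom_perturb:
  assumes V: "hilbert_module V" and W: "hilbert_module W"
    and s: "invertible_hom V W s" and t: "t \<in> Hom V W" and \<sigma>: "0 < \<sigma>"
    and close: "\<And>v. v \<in> carrier V \<Longrightarrow>
      norm (apply_map t v - \<sigma> *\<^sub>R apply_map s v) \<le> \<sigma> * norm (apply_map s v) / 8"
  shows "invertible_hom V W t"
proof -
  interpret V: hilbert_module V by fact
  interpret W: hilbert_module W by fact
  obtain s' where sH: "s \<in> Hom V W" and s': "s' \<in> Hom W V"
    and s's: "\<And>v. v \<in> carrier V \<Longrightarrow> apply_map s' (apply_map s v) = v"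
    and ss': "\<And>w. w \<in> carrier W \<Longrightarrow> apply_map s (apply_map s' w) = w"
    using s unfolding invertible_hom_def by blast
  obtain s\<^sub>a where s\<^sub>a: "\<And>w. w \<in> carrier W \<Longrightarrow> s\<^sub>a w \<in> carrier V"
    "\<And>v w. v \<in> carrier V \<Longrightarrow> w \<in> carrier W \<Longrightarrow> ip W (apply_map s v) w = ip V v (s\<^sub>a w)"
    by (rule Hom_adjoint[OF sH]) blast
  obtain s'\<^sub>a where s'\<^sub>a: "\<And>v. v \<in> carrier V \<Longrightarrow> s'\<^sub>a v \<in> carrier W"
    "\<And>v w. v \<in> carrier V \<Longrightarrow> w \<in> carrier W \<Longrightarrow> ip V (apply_map s' w) v = ip W w (s'\<^sub>a v)"
    by (rule Hom_adjoint[OF s']) blast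
  obtain t\<^sub>a where t\<^sub>a: "\<And>w. w \<in> carrier W \<Longrightarrow> t\<^sub>a w \<in> carrier V"
    "\<And>v w. v \<in> carrier V \<Longrightarrow> w \<in> carrier W \<Longrightarrow> ip W (apply_map t v) w = ip V v (t\<^sub>a w)"
    by (rule Hom_adjoint[OF t]) blast
  define T where "T w = apply_map t (apply_map s' w) /\<^sub>R \<sigma>" for w
  \<comment> \<open>The adjoint of \<open>T\<close>, with the two factors in reverse order.\<close>
  define S where "S w = s'\<^sub>a (t\<^sub>a w) /\<^sub>R \<sigma>" for w
  have Tc: "T w \<in> carrier W" and Sc: "S w \<in> carrier W" if "w \<in> carrier W" for w
    using that HomD(2)[OF t] HomD(2)[OF s'] s'\<^sub>a t\<^sub>a by (auto simp: T_def S_def W.carrier_closed)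
  have Tadd: "T (u + w) = T u + T w" if "u \<in> carrier W" "w \<in> carrier W" for u w
    using that HomD(2,3)[OF s'] HomD(3)[OF t] by (simp add: T_def scaleR_add_right)
  have adj: "ip W (T u) w = ip W u (S w)" if "u \<in> carrier W" "w \<in> carrier W" for u w
    using that HomD(2)[OF t] HomD(2)[OF s'] s'\<^sub>a t\<^sub>a
    by (simp add: T_def S_def W.ip_scaleR_left W.ip_scaleR_right)
  have Tle: "norm (T w - w) \<le> norm w / 8" if w: "w \<in> carrier W" for w
  proof -
    have "T w - w = (apply_map t (apply_map s' w) - \<sigma> *\<^sub>R w) /\<^sub>R \<sigma>"
      using \<sigma> by (simp add: T_def scaleR_diff_right)
    then have "norm (T w - w) = norm (apply_map t (apply_map s' w) - \<sigma> *\<^sub>R w) / \<sigma>"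
      using \<sigma> by (simp add: divide_inverse mult.commute)
    then show ?thesis
      using close[of "apply_map s' w"] ss'[OF w] HomD(2)[OF s' w] \<sigma> by (simp add: divide_le_eq mult.commute)
  qed
  have T_surj: "\<exists>u\<in>carrier W. T u = w" if "w \<in> carrier W" for w
    using W.additive_near_identity_surj[OF Tc Tadd _ _ _ that, of "1/8"] Tle by auto
  \<comment> \<open>The contraction constant is 9/10 here instead of 1/8.\<close>
  have S_surj: "\<exists>u\<in>carrier W. S u = w" if "w \<in> carrier W" for w
    using W.additive_near_identity_surj[OF Sc adjoint_additive[OF W Sc Tc adj W] _ _
        W.adjoint_near_identity[OF Tc Sc adj Tle] that] by auto
  obtain K where K: "\<And>w. norm (apply_map s' w) \<le> K * norm w"
    using norm_apply_map by metis
  show ?thesis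
  \<comment> \<open>The closeness hypothesis gives \<open>7 / 8 * \<sigma> * norm (apply_map s v)
    \<le> norm (apply_map t v)\<close>; the factor \<open>\<bar>K\<bar>\<close> bounds the inverse
    of \<open>s\<close>.\<close>
  proof (rule invertible_homI[OF V W t, where t' = t\<^sub>a and K = "\<bar>K\<bar> * (8 / (7 * \<sigma>))"])
    fix v assume v: "v \<in> carrier V"
    have "\<sigma> * norm (apply_map s v) \<le> norm (apply_map t v) + \<sigma> * norm (apply_map s v) / 8"
      using close[OF v] norm_triangle_sub[of "\<sigma> *\<^sub>R apply_map s v" "apply_map t v"] \<sigma>
      by (simp add: norm_minus_commute)
    then have *: "norm (apply_map s v) \<le> 8 / (7 * \<sigma>) * norm (apply_map t v)"
      using \<sigma> by (simp add: field_simps)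
    have "norm v \<le> \<bar>K\<bar> * norm (apply_map s v)"
      using K[of "apply_map s v"] s's[OF v] by (auto intro: le_abs_mult)
    also have "\<dots> \<le> \<bar>K\<bar> * (8 / (7 * \<sigma>) * norm (apply_map t v))"
      by (intro mult_left_mono *) auto
    finally show "norm v \<le> \<bar>K\<bar> * (8 / (7 * \<sigma>)) * norm (apply_map t v)" by (simp add: mult.assoc)
  next
    fix w assume "w \<in> carrier W"
    then obtain u where u: "u \<in> carrier W" "T u = w" using T_surj by blast
    have "apply_map t (apply_map s' u /\<^sub>R \<sigma>) = w"
      using u HomD(2)[OF s' u(1)] by (simp add: Hom_scaleR_arg[OF V W t] T_def)
    then show "\<exists>v\<in>carrier V. apply_map t v = w"
      using HomD(2)[OF s' u(1)] V.carrier_closed(4) by blast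
  next
    fix v assume v: "v \<in> carrier V"
    \<comment> \<open>Surjectivity of \<open>S\<close> on \<open>carrier W\<close> has to become
      surjectivity of \<open>t\<^sub>a\<close> onto \<open>carrier V\<close>. From
      \<open>S z = s'\<^sub>a v\<close> the map \<open>s'\<^sub>a\<close> is cancelled: it is
      injective because \<open>s'\<close> is onto, which is seen by testing against
      \<open>u = s' (s u)\<close>.\<close>
    obtain z where z: "z \<in> carrier W" "S z = s'\<^sub>a v" using S_surj s'\<^sub>a(1)[OF v] by blast
    have "t\<^sub>a z /\<^sub>R \<sigma> = v"
    proof (rule V.ip_eqI)
      fix u assume u: "u \<in> carrier V"
      have su: "apply_map s u \<in> carrier W" using HomD(2)[OF sH u] .
      have "ip V u (t\<^sub>a z /\<^sub>R \<sigma>) = ip V (apply_map s' (apply_map s u)) (t\<^sub>a z /\<^sub>R \<sigma>)"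
        using s's[OF u] by simp
      also have "\<dots> = ip W (apply_map s u) (S z)"
        using z(1) su u t\<^sub>a s'\<^sub>a HomD(2)[OF s' su] by (simp add: S_def V.ip_scaleR_right W.ip_scaleR_right)
      also have "\<dots> = ip V u v"
        using z(2) s'\<^sub>a(2)[OF v su] s's[OF u] by simp
      finally show "ip V u (t\<^sub>a z /\<^sub>R \<sigma>) = ip V u v" .
    qed (use z t\<^sub>a v V.carrier_closed in auto)
    \<comment> \<open>As a bare function \<open>t\<^sub>a\<close> is not known to be homogeneous;
      this too comes from the pairing identity.\<close>
    moreover have "t\<^sub>a (z /\<^sub>R \<sigma>) = t\<^sub>a z /\<^sub>R \<sigma>"
      using z t\<^sub>a HomD(2)[OF t]
      by (intro V.ip_eqI) (simp_all add: V.carrier_closed W.carrier_closed V.ip_scaleR_right W.ip_scaleR_right t\<^sub>a(2)[symmetric])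
    ultimately show "\<exists>w\<in>carrier W. t\<^sub>a w = v" using z W.carrier_closed(4) by metis
  qed (use t\<^sub>a in auto)
qed

section \<open>Transport along isomorphisms\<close>

lemma hmodule_isoD:
  assumes "hmodule_iso V W f"
  shows "bij_betw f (carrier V) (carrier W)" "v \<in> carrier V \<Longrightarrow> f v \<in> carrier W"
    "u \<in> carrier V \<Longrightarrow> v \<in> carrier V \<Longrightarrow> f (u + v) = f u + f v"
    "v \<in> carrier V \<Longrightarrow> f (act V v a) = act W (f v) a"
    "u \<in> carrier V \<Longrightarrow> v \<in> carrier V \<Longrightarrow> ip W (f u) (f v) = ip V u v"
  using assms bij_betwE unfolding hmodule_iso_def by blast+

lemma hmodule_iso_norm:
  assumes "hilbert_module V" "hilbert_module W" "hmodule_iso V W f" "v \<in> carrier V"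
  shows "norm (f v) = norm v"
  using assms hmodule_isoD[OF assms(3)] hilbert_module.norm_ip by metis

lemma hmodule_iso_inv_into:
  assumes V: "hilbert_module V" and f: "hmodule_iso V W f"
  shows "hmodule_iso W V (inv_into (carrier V) f)"
proof -
  interpret V: hilbert_module V by fact
  note b = hmodule_isoD(1)[OF f]
  have r: "inv_into (carrier V) f w \<in> carrier V" "f (inv_into (carrier V) f w) = w" if "w \<in> carrier W" for w
    using b that by (auto simp: bij_betw_def inv_into_into f_inv_into_f)
  have l: "inv_into (carrier V) f (f v) = v" if "v \<in> carrier V" for v
    using b that by (auto simp: bij_betw_def)
  show ?thesis
    unfolding hmodule_iso_def
  proof (intro conjI ballI allI)
    show "bij_betw (inv_into (carrier V) f) (carrier W) (carrier V)"
      by (rule bij_betw_inv_into[OF b])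
    fix u v a assume uv: "u \<in> carrier W"
    show "inv_into (carrier V) f (act W u a) = act V (inv_into (carrier V) f u) a"
      using r[OF uv] l V.act_closed hmodule_isoD(4)[OF f] by metis
    assume v: "v \<in> carrier W"
    show "inv_into (carrier V) f (u + v) = inv_into (carrier V) f u + inv_into (carrier V) f v"
      using r[OF uv] r[OF v] l V.carrier_closed(2) hmodule_isoD(3)[OF f] by metis
    show "ip V (inv_into (carrier V) f u) (inv_into (carrier V) f v) = ip W u v"
      using r[OF uv] r[OF v] hmodule_isoD(5)[OF f] by metis
  qed
qed

text \<open>Isomorphisms preserve inner products, so their inverses act as their adjoints and the
  transported map has adjoint \<open>f' \<circ> S \<circ> h'\<close>. This is applied in both
  directions, from fibres to model modules and back.\<close>

lemma transport_Hom:
  assumes V: "hilbert_module V" and V': "hilbert_module V'" and W: "hilbert_module W" and W': "hilbert_module W'"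
    and f: "hmodule_iso V V' f" and h: "hmodule_iso W' W h" and T: "T \<in> Hom V' W'"
  shows "as_hom V (\<lambda>v. h (apply_map T (f v))) \<in> Hom V W"
    "apply_map (as_hom V (\<lambda>v. h (apply_map T (f v)))) v = (if v \<in> carrier V then h (apply_map T (f v)) else 0)"
proof -
  have app: "apply_map (as_hom V (\<lambda>v. h (apply_map T (f v)))) v
      = (if v \<in> carrier V then h (apply_map T (f v)) else 0)" for v
  proof (rule apply_as_hom)
    fix v assume v: "v \<in> carrier V"
    have "norm (h (apply_map T (f v))) = norm (apply_map T (f v))"
      using v hmodule_isoD(2)[OF f] HomD(2)[OF T] by (intro hmodule_iso_norm[OF W' W h]) auto
    also have "\<dots> \<le> norm T * norm (f v)" by (rule norm_apply_map)
    finally show "norm (h (apply_map T (f v))) \<le> norm T * norm v"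
      using hmodule_iso_norm[OF V V' f v] by simp
  qed
  then show "apply_map (as_hom V (\<lambda>v. h (apply_map T (f v)))) v
      = (if v \<in> carrier V then h (apply_map T (f v)) else 0)" .
  obtain S where S: "\<And>w. w \<in> carrier W' \<Longrightarrow> S w \<in> carrier V'"
    "\<And>v w. v \<in> carrier V' \<Longrightarrow> w \<in> carrier W' \<Longrightarrow> ip W' (apply_map T v) w = ip V' v (S w)"
    by (rule Hom_adjoint[OF T]) blast
  define f' where "f' = inv_into (carrier V) f"
  define h' where "h' = inv_into (carrier W') h"
  have f': "f' w \<in> carrier V" "f (f' w) = w" if "w \<in> carrier V'" for w
    using hmodule_isoD(1)[OF f] that by (auto simp: f'_def bij_betw_def inv_into_into f_inv_into_f)
  have h': "h' w \<in> carrier W'" "h (h' w) = w" if "w \<in> carrier W" for w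
    using hmodule_isoD(1)[OF h] that by (auto simp: h'_def bij_betw_def inv_into_into f_inv_into_f)
  show "as_hom V (\<lambda>v. h (apply_map T (f v))) \<in> Hom V W"
  proof (rule HomI[where S = "\<lambda>w. f' (S (h' w))"])
    fix v w assume v: "v \<in> carrier V" and w: "w \<in> carrier W"
    have fv: "f v \<in> carrier V'" and Tfv: "apply_map T (f v) \<in> carrier W'"
      using v hmodule_isoD(2)[OF f] HomD(2)[OF T] by auto
    have "ip W (h (apply_map T (f v))) w = ip W' (apply_map T (f v)) (h' w)"
      using hmodule_isoD(5)[OF h Tfv h'(1)[OF w]] h'(2)[OF w] by simp
    also have "\<dots> = ip V' (f v) (f (f' (S (h' w))))"
      using S fv h'[OF w] f' by simp
    also have "\<dots> = ip V v (f' (S (h' w)))"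
      using v w S h' f' by (intro hmodule_isoD(5)[OF f]) auto
    finally show "ip W (apply_map (as_hom V (\<lambda>v. h (apply_map T (f v)))) v) w = ip V v (f' (S (h' w)))"
      using v by (simp add: app)
  qed (use hmodule_isoD[OF f] HomD[OF T] hmodule_isoD[OF h] f' h' S hilbert_module.act_closed[OF V]
      hilbert_module.carrier_closed[OF V] in \<open>auto simp: app\<close>)
qed

text \<open>Both subspaces are deliberately larger than spaces \<open>Hom\<close>. They are cut out
  by equations between continuous functions of the map, and by values in a complete carrier, so they
  are visibly closed; closedness of \<open>Hom\<close> would require convergence of
  adjoints.\<close>

lemma subspace_bilinear_comp_map:
  assumes "hilbert_module W"
  shows "subspace_bilinear comp_map
    {G. (\<forall>u\<in>carrier W. \<forall>v\<in>carrier W. apply_map G (u + v) = apply_map G u + apply_map G v) \<and>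
        (\<forall>v\<in>carrier W. \<forall>r. apply_map G (r *\<^sub>R v) = r *\<^sub>R apply_map G v)}
    {F. \<forall>v. apply_map F v \<in> carrier W} 1"
    (is "subspace_bilinear _ ?P ?Q _")
proof
  interpret W: hilbert_module W by fact
  show "subspace ?P"
    by (rule subspaceI) (auto simp: apply_map_add apply_map_scaleR algebra_simps)
  show "subspace ?Q"
    by (rule subspaceI) (auto simp: apply_map_add apply_map_scaleR W.carrier_closed)
  show "closed ?P"
  proof -
    have "?P = (\<Inter>u\<in>carrier W. \<Inter>v\<in>carrier W. {G. apply_map G (u + v) = apply_map G u + apply_map G v}) \<inter>
        (\<Inter>v\<in>carrier W. \<Inter>r. {G. apply_map G (r *\<^sub>R v) = r *\<^sub>R apply_map G v})"
      by auto
    moreover have "closed \<dots>"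
      by (intro closed_Int closed_INT ballI closed_Collect_eq continuous_apply_map continuous_on_add
          continuous_on_scaleR continuous_on_const)
    ultimately show ?thesis by simp
  qed
  have "closed (carrier W)"
    using W.complete_carrier by (rule complete_imp_closed)
  then have "closed {F. apply_map F v \<in> carrier W}" for v
    using closed_vimage[OF _ continuous_apply_map] by (simp add: vimage_def)
  then show "closed ?Q"
    by (rule closed_Collect_all)
  show "norm (comp_map g f) \<le> norm g * norm f * 1" for g f
    using norm_comp_map[of g f] by simp
qed (auto intro!: bounded_map_eqI simp: apply_comp_map apply_map_add apply_map_scaleR)

lemma smooth_map_on_comp_map:
  assumes "smooth_atlas M \<A>" "hilbert_module V" "hilbert_module W" "hilbert_module X"
    and "openin M D" "smooth_map_on \<A> D G" "smooth_map_on \<A> D F"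
    and G: "\<And>x. x \<in> D \<Longrightarrow> G x \<in> Hom W X" and F: "\<And>x. x \<in> D \<Longrightarrow> F x \<in> Hom V W"
  shows "smooth_map_on \<A> D (\<lambda>x. comp_map (G x) (F x))"
proof (rule smooth_map_on_bilinear[OF assms(1) subspace_bilinear_comp_map[OF assms(3)] assms(5-7)])
  fix y assume y: "y \<in> D"
  show "G y \<in> {G. (\<forall>u\<in>carrier W. \<forall>v\<in>carrier W. apply_map G (u + v) = apply_map G u + apply_map G v) \<and>
        (\<forall>v\<in>carrier W. \<forall>r. apply_map G (r *\<^sub>R v) = r *\<^sub>R apply_map G v)}"
    using HomD(3)[OF G[OF y]] Hom_scaleR_arg[OF assms(3,4) G[OF y]] by blast
  have "apply_map (F y) v \<in> carrier W" for v
    using HomD(1,2)[OF F[OF y], of v] hilbert_module.carrier_closed(1)[OF assms(3)] by (cases "v \<in> carrier V") auto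
  then show "F y \<in> {F. \<forall>v. apply_map F v \<in> carrier W}" by blast
qed

lemma comp_map_Hom:
  assumes G: "G \<in> Hom W X" and F: "F \<in> Hom V W"
  shows "comp_map G F \<in> Hom V X"
proof -
  obtain S where S: "\<And>w. w \<in> carrier W \<Longrightarrow> S w \<in> carrier V"
    "\<And>v w. v \<in> carrier V \<Longrightarrow> w \<in> carrier W \<Longrightarrow> ip W (apply_map F v) w = ip V v (S w)"
    by (rule Hom_adjoint[OF F]) blast
  obtain R where R: "\<And>w. w \<in> carrier X \<Longrightarrow> R w \<in> carrier W"
    "\<And>v w. v \<in> carrier W \<Longrightarrow> w \<in> carrier X \<Longrightarrow> ip X (apply_map G v) w = ip W v (R w)"
    by (rule Hom_adjoint[OF G]) blast
  show ?thesis
    by (rule HomI[where S = "\<lambda>x. S (R x)"]) (simp_all add: apply_comp_map HomD[OF F] HomD[OF G] S R)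
qed

lemma as_hom_cong: "(\<And>v. v \<in> carrier V \<Longrightarrow> f v = g v) \<Longrightarrow> as_hom V f = as_hom V g"
  unfolding as_hom_def by (rule arg_cong[of _ _ Bounded_map]) auto

lemma apply_id_hom: "apply_map (as_hom V (\<lambda>v. v)) v = (if v \<in> carrier V then v else 0)"
  by (rule apply_as_hom[of _ _ 1]) simp

lemma id_Hom:
  assumes "hilbert_module V"
  shows "as_hom V (\<lambda>v. v) \<in> Hom V V"
  by (rule HomI[where S = "\<lambda>v. v"])
    (simp_all add: apply_id_hom hilbert_module.carrier_closed[OF assms] hilbert_module.act_closed[OF assms])

lemma hmodule_iso_norm_diff:
  assumes V: "hilbert_module V" and W: "hilbert_module W" and f: "hmodule_iso V W f"
    and uv: "u \<in> carrier V" "v \<in> carrier V"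
  shows "norm (f u - f v) = norm (u - v)"
proof -
  have uv': "u - v \<in> carrier V" using hilbert_module.carrier_closed(3)[OF V uv] .
  then have "f u - f v = f (u - v)"
    using hmodule_isoD(3)[OF f uv' uv(2)] by simp
  then show ?thesis using hmodule_iso_norm[OF V W f uv'] by simp
qed

lemma hmodule_iso_inverse:
  assumes "hmodule_iso V W f"
  shows "v \<in> carrier V \<Longrightarrow> inv_into (carrier V) f (f v) = v"
    "w \<in> carrier W \<Longrightarrow> f (inv_into (carrier V) f w) = w"
    "w \<in> carrier W \<Longrightarrow> inv_into (carrier V) f w \<in> carrier V"
  using hmodule_isoD(1)[OF assms] by (auto simp: bij_betw_def inv_into_into f_inv_into_f)

section \<open>Sections in local trivializations\<close>

lemma local_trivializationD:
  assumes "local_trivialization M E \<phi>"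
  shows "openin M (triv_dom \<phi>)" "hilbert_module (model_fibre \<phi>)"
    "x \<in> triv_dom \<phi> \<Longrightarrow> hmodule_iso (fibre E x) (model_fibre \<phi>) (triv_map \<phi> x)"
  using assms unfolding local_trivialization_def by blast+

lemma local_trivialization_fibre:
  assumes "hilbert_module_bundle M E" "local_trivialization M E \<phi>" "x \<in> triv_dom \<phi>"
  shows "hilbert_module (fibre E x)"
proof -
  have "x \<in> topspace M"
    using openin_subset[OF local_trivializationD(1)[OF assms(2)]] assms(3) by (rule subsetD)
  then show ?thesis
    by (rule hilbert_module_bundle.fibre_hilbert_module[OF assms(1)])
qed

lemma local_hom_Hom:
  assumes E1: "hilbert_module_bundle M E\<^sub>1" "local_trivialization M E\<^sub>1 \<phi>\<^sub>1" "x \<in> triv_dom \<phi>\<^sub>1"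
    and E2: "hilbert_module_bundle M E\<^sub>2" "local_trivialization M E\<^sub>2 \<phi>\<^sub>2" "x \<in> triv_dom \<phi>\<^sub>2"
    and s: "s x \<in> Hom (fibre E\<^sub>1 x) (fibre E\<^sub>2 x)"
  shows "local_hom E\<^sub>1 \<phi>\<^sub>1 \<phi>\<^sub>2 (\<lambda>x. apply_map (s x)) x \<in> Hom (model_fibre \<phi>\<^sub>1) (model_fibre \<phi>\<^sub>2)"
    "apply_map (local_hom E\<^sub>1 \<phi>\<^sub>1 \<phi>\<^sub>2 (\<lambda>x. apply_map (s x)) x) v = (if v \<in> carrier (model_fibre \<phi>\<^sub>1)
      then triv_map \<phi>\<^sub>2 x (apply_map (s x) (inv_into (carrier (fibre E\<^sub>1 x)) (triv_map \<phi>\<^sub>1 x) v)) else 0)"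
proof -
  note f = hmodule_iso_inv_into[OF local_trivialization_fibre[OF E1] local_trivializationD(3)[OF E1(2,3)]]
  note tr = transport_Hom[OF local_trivializationD(2)[OF E1(2)] local_trivialization_fibre[OF E1]
      local_trivializationD(2)[OF E2(2)] local_trivialization_fibre[OF E2] f local_trivializationD(3)[OF E2(2,3)] s]
  show "local_hom E\<^sub>1 \<phi>\<^sub>1 \<phi>\<^sub>2 (\<lambda>x. apply_map (s x)) x \<in> Hom (model_fibre \<phi>\<^sub>1) (model_fibre \<phi>\<^sub>2)"
    unfolding local_hom_def by (rule tr(1))
  show "apply_map (local_hom E\<^sub>1 \<phi>\<^sub>1 \<phi>\<^sub>2 (\<lambda>x. apply_map (s x)) x) v = (if v \<in> carrier (model_fibre \<phi>\<^sub>1)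
      then triv_map \<phi>\<^sub>2 x (apply_map (s x) (inv_into (carrier (fibre E\<^sub>1 x)) (triv_map \<phi>\<^sub>1 x) v)) else 0)"
    unfolding local_hom_def by (rule tr(2))
qed

lemma transition_Hom:
  assumes E: "hilbert_module_bundle M E" and \<phi>: "local_trivialization M E \<phi>" "x \<in> triv_dom \<phi>"
    and \<psi>: "local_trivialization M E \<psi>" "x \<in> triv_dom \<psi>"
  shows "local_hom E \<phi> \<psi> (\<lambda>x v. v) x \<in> Hom (model_fibre \<phi>) (model_fibre \<psi>)"
    "apply_map (local_hom E \<phi> \<psi> (\<lambda>x v. v) x) v = (if v \<in> carrier (model_fibre \<phi>)
      then triv_map \<psi> x (inv_into (carrier (fibre E x)) (triv_map \<phi> x) v) else 0)"
proof -
  note lh = local_hom_Hom[OF E \<phi> E \<psi>, of "\<lambda>x. as_hom (fibre E x) (\<lambda>v. v)",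
      OF id_Hom[OF local_trivialization_fibre[OF E \<phi>]]]
  note inv = hmodule_iso_inverse(3)[OF local_trivializationD(3)[OF \<phi>]]
  \<comment> \<open>The plain identity becomes a section of bounded maps once it is extended by
    zero; inside the fibre nothing changes.\<close>
  have eq: "local_hom E \<phi> \<psi> (\<lambda>x v. v) x
      = local_hom E \<phi> \<psi> (\<lambda>x. apply_map (as_hom (fibre E x) (\<lambda>v. v))) x"
    unfolding local_hom_def by (rule as_hom_cong) (simp add: apply_id_hom inv)
  show "local_hom E \<phi> \<psi> (\<lambda>x v. v) x \<in> Hom (model_fibre \<phi>) (model_fibre \<psi>)"
    unfolding eq by (rule lh(1))
  show "apply_map (local_hom E \<phi> \<psi> (\<lambda>x v. v) x) v = (if v \<in> carrier (model_fibre \<phi>)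
      then triv_map \<psi> x (inv_into (carrier (fibre E x)) (triv_map \<phi> x) v) else 0)"
    unfolding eq lh(2) by (simp add: apply_id_hom inv)
qed

section \<open>Sections that are constant in a pair of trivializations\<close>

definition constant_hom ::
    "('m, 'a::unital_cstar_algebra, 'v::real_normed_vector) hbundle \<Rightarrow>
     ('m, 'a, 'v, 'f::real_normed_vector) triv \<Rightarrow> ('m, 'a, 'w::real_normed_vector) hbundle \<Rightarrow>
     ('m, 'a, 'w, 'g::real_normed_vector) triv \<Rightarrow> ('f, 'g) bounded_map \<Rightarrow> 'm \<Rightarrow> ('v, 'w) bounded_map" where
  "constant_hom E\<^sub>1 \<phi>\<^sub>1 E\<^sub>2 \<phi>\<^sub>2 T x = as_hom (fibre E\<^sub>1 x)
     (\<lambda>v. inv_into (carrier (fibre E\<^sub>2 x)) (triv_map \<phi>\<^sub>2 x) (apply_map T (triv_map \<phi>\<^sub>1 x v)))"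

lemma constant_hom_Hom:
  assumes E1: "hilbert_module_bundle M E\<^sub>1" "local_trivialization M E\<^sub>1 \<phi>\<^sub>1" "x \<in> triv_dom \<phi>\<^sub>1"
    and E2: "hilbert_module_bundle M E\<^sub>2" "local_trivialization M E\<^sub>2 \<phi>\<^sub>2" "x \<in> triv_dom \<phi>\<^sub>2"
    and T: "T \<in> Hom (model_fibre \<phi>\<^sub>1) (model_fibre \<phi>\<^sub>2)"
  shows "constant_hom E\<^sub>1 \<phi>\<^sub>1 E\<^sub>2 \<phi>\<^sub>2 T x \<in> Hom (fibre E\<^sub>1 x) (fibre E\<^sub>2 x)"
    "apply_map (constant_hom E\<^sub>1 \<phi>\<^sub>1 E\<^sub>2 \<phi>\<^sub>2 T x) v = (if v \<in> carrier (fibre E\<^sub>1 x)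
      then inv_into (carrier (fibre E\<^sub>2 x)) (triv_map \<phi>\<^sub>2 x) (apply_map T (triv_map \<phi>\<^sub>1 x v)) else 0)"
proof -
  note h = hmodule_iso_inv_into[OF local_trivialization_fibre[OF E2] local_trivializationD(3)[OF E2(2,3)]]
  note tr = transport_Hom[OF local_trivialization_fibre[OF E1] local_trivializationD(2)[OF E1(2)]
      local_trivialization_fibre[OF E2] local_trivializationD(2)[OF E2(2)] local_trivializationD(3)[OF E1(2,3)] h T]
  show "constant_hom E\<^sub>1 \<phi>\<^sub>1 E\<^sub>2 \<phi>\<^sub>2 T x \<in> Hom (fibre E\<^sub>1 x) (fibre E\<^sub>2 x)"
    unfolding constant_hom_def by (rule tr(1))
  show "apply_map (constant_hom E\<^sub>1 \<phi>\<^sub>1 E\<^sub>2 \<phi>\<^sub>2 T x) v = (if v \<in> carrier (fibre E\<^sub>1 x)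
      then inv_into (carrier (fibre E\<^sub>2 x)) (triv_map \<phi>\<^sub>2 x) (apply_map T (triv_map \<phi>\<^sub>1 x v)) else 0)"
    unfolding constant_hom_def by (rule tr(2))
qed

text \<open>In any other pair of trivializations a constant section appears as a fixed map between
  two transition functions. This is how the smooth structures of the two bundles make it
  smooth.\<close>

lemma local_hom_constant_hom:
  assumes E1: "hilbert_module_bundle M E\<^sub>1" and \<phi>1: "local_trivialization M E\<^sub>1 \<phi>\<^sub>1" "x \<in> triv_dom \<phi>\<^sub>1"
    and \<psi>1: "local_trivialization M E\<^sub>1 \<psi>\<^sub>1" "x \<in> triv_dom \<psi>\<^sub>1"
    and E2: "hilbert_module_bundle M E\<^sub>2" and \<phi>2: "local_trivialization M E\<^sub>2 \<phi>\<^sub>2" "x \<in> triv_dom \<phi>\<^sub>2"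
    and \<psi>2: "local_trivialization M E\<^sub>2 \<psi>\<^sub>2" "x \<in> triv_dom \<psi>\<^sub>2"
    and T: "T \<in> Hom (model_fibre \<phi>\<^sub>1) (model_fibre \<phi>\<^sub>2)"
  shows "local_hom E\<^sub>1 \<psi>\<^sub>1 \<psi>\<^sub>2 (\<lambda>x. apply_map (constant_hom E\<^sub>1 \<phi>\<^sub>1 E\<^sub>2 \<phi>\<^sub>2 T x)) x =
    comp_map (local_hom E\<^sub>2 \<phi>\<^sub>2 \<psi>\<^sub>2 (\<lambda>x v. v) x) (comp_map T (local_hom E\<^sub>1 \<psi>\<^sub>1 \<phi>\<^sub>1 (\<lambda>x v. v) x))"
proof (rule bounded_map_eqI)
  fix v
  note c = constant_hom_Hom[OF E1 \<phi>1 E2 \<phi>2 T]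
  note l = local_hom_Hom(2)[OF E1 \<psi>1 E2 \<psi>2, of "constant_hom E\<^sub>1 \<phi>\<^sub>1 E\<^sub>2 \<phi>\<^sub>2 T", OF c(1)]
  note inv1 = hmodule_iso_inverse(3)[OF local_trivializationD(3)[OF \<psi>1]]
  show "apply_map (local_hom E\<^sub>1 \<psi>\<^sub>1 \<psi>\<^sub>2 (\<lambda>x. apply_map (constant_hom E\<^sub>1 \<phi>\<^sub>1 E\<^sub>2 \<phi>\<^sub>2 T x)) x) v =
    apply_map (comp_map (local_hom E\<^sub>2 \<phi>\<^sub>2 \<psi>\<^sub>2 (\<lambda>x v. v) x) (comp_map T (local_hom E\<^sub>1 \<psi>\<^sub>1 \<phi>\<^sub>1 (\<lambda>x v. v) x))) v"
  proof (cases "v \<in> carrier (model_fibre \<psi>\<^sub>1)")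
    case True
    then show ?thesis
      unfolding apply_comp_map l transition_Hom(2)[OF E1 \<psi>1 \<phi>1] transition_Hom(2)[OF E2 \<phi>2 \<psi>2]
      using HomD(2)[OF T] hmodule_isoD(2)[OF local_trivializationD(3)[OF \<phi>1]] inv1
      by (simp add: c(2))
  next
    case False
    then show ?thesis
      unfolding apply_comp_map l transition_Hom(2)[OF E1 \<psi>1 \<phi>1] by simp
  qed
qed

text \<open>Reduces smoothness of a glued section to that of its summands. The index set is fixed
  and only the value at the single point \<open>x\<close> is involved.\<close>

lemma local_hom_linear:
  assumes E1: "hilbert_module_bundle M E\<^sub>1" "local_trivialization M E\<^sub>1 \<phi>\<^sub>1" "x \<in> triv_dom \<phi>\<^sub>1"
    and E2: "hilbert_module_bundle M E\<^sub>2" "local_trivialization M E\<^sub>2 \<phi>\<^sub>2" "x \<in> triv_dom \<phi>\<^sub>2"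
    and t: "\<And>i. i \<in> J \<Longrightarrow> t i x \<in> Hom (fibre E\<^sub>1 x) (fibre E\<^sub>2 x)"
  shows "local_hom E\<^sub>1 \<phi>\<^sub>1 \<phi>\<^sub>2 (\<lambda>x. apply_map (\<Sum>i\<in>J. b i x *\<^sub>R t i x)) x =
    (\<Sum>i\<in>J. b i x *\<^sub>R local_hom E\<^sub>1 \<phi>\<^sub>1 \<phi>\<^sub>2 (\<lambda>x. apply_map (t i x)) x)"
proof (rule bounded_map_eqI)
  fix v
  note V = local_trivialization_fibre[OF E1] and W = local_trivialization_fibre[OF E2]
  note W' = local_trivializationD(2)[OF E2(2)]
  note f = local_trivializationD(3)[OF E1(2,3)] and h = local_trivializationD(3)[OF E2(2,3)]
  let ?f' = "inv_into (carrier (fibre E\<^sub>1 x)) (triv_map \<phi>\<^sub>1 x)"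
  note sub = subspace_Hom[OF V W]
  \<comment> \<open>Trivializations are assumed additive and linear over the algebra; real
    homogeneity follows by acting with \<open>r *\<^sub>R 1\<close>.\<close>
  have h_scaleR: "triv_map \<phi>\<^sub>2 x (r *\<^sub>R w) = r *\<^sub>R triv_map \<phi>\<^sub>2 x w" if "w \<in> carrier (fibre E\<^sub>2 x)" for r w
    using hmodule_isoD(2,4)[OF h that] hilbert_module.act_scaleR[OF W that] hilbert_module.act_scaleR[OF W'] by metis
  have h_0: "triv_map \<phi>\<^sub>2 x 0 = 0"
    using h_scaleR[of 0 0] hilbert_module.carrier_closed(1)[OF W] by simp
  have h_sum: "triv_map \<phi>\<^sub>2 x (\<Sum>i\<in>K. b i x *\<^sub>R w i) = (\<Sum>i\<in>K. b i x *\<^sub>R triv_map \<phi>\<^sub>2 x (w i))"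
    if "\<And>i. i \<in> K \<Longrightarrow> w i \<in> carrier (fibre E\<^sub>2 x)" for w K
    using that
  proof (induction K rule: infinite_finite_induct)
    case (insert i K)
    have "(\<Sum>i\<in>K. b i x *\<^sub>R w i) \<in> carrier (fibre E\<^sub>2 x)"
      using insert.prems by (intro subspace_sum hilbert_module.subspace_carrier[OF W]
          hilbert_module.carrier_closed(4)[OF W]) auto
    then show ?case
      using insert hilbert_module.carrier_closed(4)[OF W] by (simp add: hmodule_isoD(3)[OF h] h_scaleR)
  qed (simp_all add: h_0)
  have sum: "(\<Sum>i\<in>J. b i x *\<^sub>R t i x) \<in> Hom (fibre E\<^sub>1 x) (fibre E\<^sub>2 x)"
    using t sub by (intro subspace_sum subspace_scale) auto
  note l = local_hom_Hom(2)[OF E1 E2]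
  have lt: "apply_map (local_hom E\<^sub>1 \<phi>\<^sub>1 \<phi>\<^sub>2 (\<lambda>x. apply_map (t i x)) x) v = (if v \<in> carrier (model_fibre \<phi>\<^sub>1)
      then triv_map \<phi>\<^sub>2 x (apply_map (t i x) (?f' v)) else 0)" if "i \<in> J" for i
    using that by (intro l[of "t i"] t)
  show "apply_map (local_hom E\<^sub>1 \<phi>\<^sub>1 \<phi>\<^sub>2 (\<lambda>x. apply_map (\<Sum>i\<in>J. b i x *\<^sub>R t i x)) x) v =
    apply_map (\<Sum>i\<in>J. b i x *\<^sub>R local_hom E\<^sub>1 \<phi>\<^sub>1 \<phi>\<^sub>2 (\<lambda>x. apply_map (t i x)) x) v"
  proof (cases "v \<in> carrier (model_fibre \<phi>\<^sub>1)")
    case True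
    have "apply_map (t i x) (?f' v) \<in> carrier (fibre E\<^sub>2 x)" if "i \<in> J" for i
      using HomD(2)[OF t[OF that]] hmodule_iso_inverse(3)[OF f True] by blast
    then have "triv_map \<phi>\<^sub>2 x (\<Sum>i\<in>J. b i x *\<^sub>R apply_map (t i x) (?f' v))
        = (\<Sum>i\<in>J. b i x *\<^sub>R triv_map \<phi>\<^sub>2 x (apply_map (t i x) (?f' v)))"
      by (rule h_sum)
    also have "\<dots> = (\<Sum>i\<in>J. b i x *\<^sub>R apply_map (local_hom E\<^sub>1 \<phi>\<^sub>1 \<phi>\<^sub>2 (\<lambda>x. apply_map (t i x)) x) v)"
      by (intro sum.cong refl) (simp add: lt True)
    finally show ?thesis
      using l[of "\<lambda>x. \<Sum>i\<in>J. b i x *\<^sub>R t i x", OF sum] True by (simp add: apply_map_sum apply_map_scaleR)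
  next
    case False
    then show ?thesis
      using l[of "\<lambda>x. \<Sum>i\<in>J. b i x *\<^sub>R t i x", OF sum]
      by (simp add: apply_map_sum apply_map_scaleR lt)
  qed
qed

text \<open>A lower bound is available at \<open>x\<^sub>0\<close> only, while the error must be
  compared with \<open>s x v\<close> at nearby points. Continuity in operator norm carries the lower
  bound over, at the price of absorbing a small multiple of \<open>norm u\<close>.\<close>

lemma constant_hom_approximates:
  assumes E1: "hilbert_module_bundle M E\<^sub>1" "local_trivialization M E\<^sub>1 \<phi>\<^sub>1" "x\<^sub>0 \<in> triv_dom \<phi>\<^sub>1"
    and E2: "hilbert_module_bundle M E\<^sub>2" "local_trivialization M E\<^sub>2 \<phi>\<^sub>2" "x\<^sub>0 \<in> triv_dom \<phi>\<^sub>2"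
    and s: "\<And>x. x \<in> topspace M \<Longrightarrow> s x \<in> Hom (fibre E\<^sub>1 x) (fibre E\<^sub>2 x)"
    and inv: "invertible_hom (fibre E\<^sub>1 x\<^sub>0) (fibre E\<^sub>2 x\<^sub>0) (s x\<^sub>0)"
    and cont: "continuous_map (subtopology M (triv_dom \<phi>\<^sub>1 \<inter> triv_dom \<phi>\<^sub>2)) euclidean
          (local_hom E\<^sub>1 \<phi>\<^sub>1 \<phi>\<^sub>2 (\<lambda>x. apply_map (s x)))"
  shows "\<exists>G T. openin M G \<and> x\<^sub>0 \<in> G \<and> G \<subseteq> triv_dom \<phi>\<^sub>1 \<inter> triv_dom \<phi>\<^sub>2 \<and>
    T \<in> Hom (model_fibre \<phi>\<^sub>1) (model_fibre \<phi>\<^sub>2) \<and>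
    (\<forall>x\<in>G. \<forall>v\<in>carrier (fibre E\<^sub>1 x).
      norm (apply_map (constant_hom E\<^sub>1 \<phi>\<^sub>1 E\<^sub>2 \<phi>\<^sub>2 T x) v - apply_map (s x) v) \<le> norm (apply_map (s x) v) / 8)"
proof -
  let ?D = "triv_dom \<phi>\<^sub>1 \<inter> triv_dom \<phi>\<^sub>2"
  define S where "S = local_hom E\<^sub>1 \<phi>\<^sub>1 \<phi>\<^sub>2 (\<lambda>x. apply_map (s x))"
  have D: "openin M ?D" using local_trivializationD(1)[OF E1(2)] local_trivializationD(1)[OF E2(2)] by (rule openin_Int)
  then have DM: "?D \<subseteq> topspace M" by (rule openin_subset)
  have S_Hom: "S x \<in> Hom (model_fibre \<phi>\<^sub>1) (model_fibre \<phi>\<^sub>2)"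
    and S_app: "\<And>v. v \<in> carrier (fibre E\<^sub>1 x) \<Longrightarrow>
      apply_map (S x) (triv_map \<phi>\<^sub>1 x v) = triv_map \<phi>\<^sub>2 x (apply_map (s x) v)"
    and norm1: "\<And>v. v \<in> carrier (fibre E\<^sub>1 x) \<Longrightarrow> norm (triv_map \<phi>\<^sub>1 x v) = norm v"
    and norm2: "\<And>v. v \<in> carrier (fibre E\<^sub>2 x) \<Longrightarrow> norm (triv_map \<phi>\<^sub>2 x v) = norm v"
    if x: "x \<in> ?D" for x
  proof -
    have "s x \<in> Hom (fibre E\<^sub>1 x) (fibre E\<^sub>2 x)" using s x DM by blast
    note x1 = IntD1[OF x] and x2 = IntD2[OF x]
    note l = local_hom_Hom[OF E1(1,2) x1 E2(1,2) x2, of s, OF \<open>s x \<in> _\<close>]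
    show "S x \<in> Hom (model_fibre \<phi>\<^sub>1) (model_fibre \<phi>\<^sub>2)" unfolding S_def by (rule l(1))
    show "apply_map (S x) (triv_map \<phi>\<^sub>1 x v) = triv_map \<phi>\<^sub>2 x (apply_map (s x) v)" if "v \<in> carrier (fibre E\<^sub>1 x)" for v
      unfolding S_def l(2) using that hmodule_isoD(2)[OF local_trivializationD(3)[OF E1(2) x1]]
      by (simp add: hmodule_iso_inverse(1)[OF local_trivializationD(3)[OF E1(2) x1]])
    show "norm (triv_map \<phi>\<^sub>1 x v) = norm v" if "v \<in> carrier (fibre E\<^sub>1 x)" for v
      using hmodule_iso_norm[OF local_trivialization_fibre[OF E1(1,2) x1] local_trivializationD(2)[OF E1(2)]
        local_trivializationD(3)[OF E1(2) x1] that] .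
    show "norm (triv_map \<phi>\<^sub>2 x v) = norm v" if "v \<in> carrier (fibre E\<^sub>2 x)" for v
      using hmodule_iso_norm[OF local_trivialization_fibre[OF E2(1,2) x2] local_trivializationD(2)[OF E2(2)]
        local_trivializationD(3)[OF E2(2) x2] that] .
  qed
  have x0: "x\<^sub>0 \<in> ?D" using E1(3) E2(3) by blast
  obtain s' where s': "\<And>v. v \<in> carrier (fibre E\<^sub>1 x\<^sub>0) \<Longrightarrow> apply_map s' (apply_map (s x\<^sub>0) v) = v"
    using inv unfolding invertible_hom_def by blast
  \<comment> \<open>The summand 1 keeps \<open>K\<close> positive even if \<open>s'\<close> is zero;
    \<open>K\<close> will occur in a denominator.\<close>
  define K where "K = norm s' + 1"
  have K: "0 < K" by (simp add: K_def add_nonneg_pos)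
  have lower: "norm u \<le> K * norm (apply_map (S x\<^sub>0) u)" if u: "u \<in> carrier (model_fibre \<phi>\<^sub>1)" for u
  proof -
    note iso = local_trivializationD(3)[OF E1(2,3)]
    define w where "w = inv_into (carrier (fibre E\<^sub>1 x\<^sub>0)) (triv_map \<phi>\<^sub>1 x\<^sub>0) u"
    have w: "w \<in> carrier (fibre E\<^sub>1 x\<^sub>0)" "u = triv_map \<phi>\<^sub>1 x\<^sub>0 w"
      using hmodule_iso_inverse[OF iso] u by (auto simp: w_def)
    have sw: "apply_map (s x\<^sub>0) w \<in> carrier (fibre E\<^sub>2 x\<^sub>0)"
      using HomD(2)[OF s w(1)] x0 DM by blast
    have "norm w \<le> norm s' * norm (apply_map (s x\<^sub>0) w)"
      using norm_apply_map[of s' "apply_map (s x\<^sub>0) w"] s'[OF w(1)] by simp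
    also have "\<dots> \<le> K * norm (apply_map (s x\<^sub>0) w)"
      by (rule mult_right_mono) (auto simp: K_def)
    finally show ?thesis
      using w(2) S_app[OF x0 w(1)] norm1[OF x0 w(1)] norm2[OF x0 sw] by simp
  qed
  \<comment> \<open>With radius \<open>1 / (9 * K)\<close> the error is at most
    \<open>norm u / (9 * K)\<close>, and the lower bound loses only
    \<open>norm u / 9\<close>.\<close>
  define G where "G = {x \<in> topspace (subtopology M ?D). S x \<in> ball (S x\<^sub>0) (1 / (9 * K))}"
  have "openin (subtopology M ?D) G"
    unfolding G_def by (rule openin_continuous_map_preimage[OF cont[folded S_def]]) simp
  then have "openin M G"
    using D openin_trans_full by blast
  moreover have "x\<^sub>0 \<in> G" using x0 DM K by (auto simp: G_def)
  moreover have GD: "G \<subseteq> ?D" by (auto simp: G_def)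
  moreover have "norm (apply_map (constant_hom E\<^sub>1 \<phi>\<^sub>1 E\<^sub>2 \<phi>\<^sub>2 (S x\<^sub>0) x) v - apply_map (s x) v)
      \<le> norm (apply_map (s x) v) / 8" if x: "x \<in> G" and v: "v \<in> carrier (fibre E\<^sub>1 x)" for x v
  proof -
    have xD: "x \<in> ?D" using x GD by blast
    note x1 = IntD1[OF xD] and x2 = IntD2[OF xD]
    note f = local_trivializationD(3)[OF E1(2) x1] and h = local_trivializationD(3)[OF E2(2) x2]
    note W = local_trivialization_fibre[OF E2(1,2) x2] and W' = local_trivializationD(2)[OF E2(2)]
    define u where "u = triv_map \<phi>\<^sub>1 x v"
    have u: "u \<in> carrier (model_fibre \<phi>\<^sub>1)" unfolding u_def by (rule hmodule_isoD(2)[OF f v])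
    let ?h' = "inv_into (carrier (fibre E\<^sub>2 x)) (triv_map \<phi>\<^sub>2 x)"
    have sv: "apply_map (s x) v \<in> carrier (fibre E\<^sub>2 x)"
      using HomD(2)[OF s v] xD DM by blast
    have Su: "apply_map (S x) u = triv_map \<phi>\<^sub>2 x (apply_map (s x) v)"
      unfolding u_def by (rule S_app[OF xD v])
    have norm_Su: "norm (apply_map (S x) u) = norm (apply_map (s x) v)"
      unfolding Su by (rule norm2[OF xD sv])
    have diff: "apply_map (S x) u - apply_map (S x\<^sub>0) u = apply_map (S x - S x\<^sub>0) u"
      using apply_map_add[of "S x - S x\<^sub>0" "S x\<^sub>0" u] by simp
    have "norm (apply_map (S x) u - apply_map (S x\<^sub>0) u) \<le> norm (S x - S x\<^sub>0) * norm u"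
      unfolding diff by (rule norm_apply_map)
    also have "\<dots> \<le> 1 / (9 * K) * norm u"
      using x by (intro mult_right_mono) (auto simp: G_def dist_norm norm_minus_commute)
    finally have d: "norm (apply_map (S x) u - apply_map (S x\<^sub>0) u) \<le> norm u / (9 * K)" by simp
    have "norm (apply_map (S x\<^sub>0) u) \<le> norm (apply_map (S x) u) + norm u / (9 * K)"
      using d norm_triangle_sub[of "apply_map (S x\<^sub>0) u" "apply_map (S x) u"] by (simp add: norm_minus_commute)
    then have "K * norm (apply_map (S x\<^sub>0) u) \<le> K * (norm (apply_map (S x) u) + norm u / (9 * K))"
      using K by (intro mult_left_mono) auto
    \<comment> \<open>Absorbing \<open>norm u / 9\<close> on the left leaves 8/9 of
      \<open>norm u\<close>, which is where the factor 1/8 relative to \<open>S x\<close> comes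
      from.\<close>
    then have "norm u \<le> K * norm (apply_map (S x) u) + norm u / 9"
      using lower[OF u] K by (simp add: distrib_left)
    then have "norm u / (9 * K) \<le> norm (apply_map (S x) u) / 8"
      using K by (simp add: field_simps)
    then have le: "norm (apply_map (S x\<^sub>0) u - apply_map (S x) u) \<le> norm (apply_map (s x) v) / 8"
      using d norm_Su by (simp add: norm_minus_commute)
    have "apply_map (constant_hom E\<^sub>1 \<phi>\<^sub>1 E\<^sub>2 \<phi>\<^sub>2 (S x\<^sub>0) x) v = ?h' (apply_map (S x\<^sub>0) u)"
      using constant_hom_Hom(2)[OF E1(1,2) x1 E2(1,2) x2 S_Hom[OF x0]] v by (simp add: u_def)
    moreover have "apply_map (s x) v = ?h' (apply_map (S x) u)"
      using Su hmodule_iso_inverse(1)[OF h sv] by simp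
    ultimately have "norm (apply_map (constant_hom E\<^sub>1 \<phi>\<^sub>1 E\<^sub>2 \<phi>\<^sub>2 (S x\<^sub>0) x) v - apply_map (s x) v)
        = norm (?h' (apply_map (S x\<^sub>0) u) - ?h' (apply_map (S x) u))" by simp
    also have "\<dots> = norm (apply_map (S x\<^sub>0) u - apply_map (S x) u)"
      by (rule hmodule_iso_norm_diff[OF W' W hmodule_iso_inv_into[OF W h]])
        (use HomD(2)[OF S_Hom u] x0 xD in auto)
    finally show ?thesis using le by simp
  qed
  ultimately show ?thesis
    using S_Hom[OF x0] by blast
qed

section \<open>Gluing the local approximations\<close>

theorem theorem3p13:
  fixes M :: "'m topology"
    and \<A> :: "('m, 'n::real_inner) chart set"
    and V\<^sub>1 :: "('m, 'a::unital_cstar_algebra, 'v::real_normed_vector) hbundle"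
    and \<T>\<^sub>1 :: "('m, 'a, 'v, 'f::real_normed_vector) triv set"
    and V\<^sub>2 :: "('m, 'a, 'w::real_normed_vector) hbundle"
    and \<T>\<^sub>2 :: "('m, 'a, 'w, 'g::real_normed_vector) triv set"
  assumes "smooth_manifold M \<A>"
    and "paracompact_space M"
    and "smooth_hilbert_module_bundle M \<A> V\<^sub>1 \<T>\<^sub>1"
    and "smooth_hilbert_module_bundle M \<A> V\<^sub>2 \<T>\<^sub>2"
    and "\<exists>s. bundle_isomorphism M V\<^sub>1 \<T>\<^sub>1 V\<^sub>2 \<T>\<^sub>2 s"
  shows "\<exists>s. smooth_bundle_isomorphism M \<A> V\<^sub>1 \<T>\<^sub>1 V\<^sub>2 \<T>\<^sub>2 s"
proof -
  obtain s where "bundle_isomorphism M V\<^sub>1 \<T>\<^sub>1 V\<^sub>2 \<T>\<^sub>2 s" using assms(5) by blast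
  then have s_Hom: "\<And>x. x \<in> topspace M \<Longrightarrow> s x \<in> Hom (fibre V\<^sub>1 x) (fibre V\<^sub>2 x)"
    and s_cont: "\<And>\<phi>\<^sub>1 \<phi>\<^sub>2. \<phi>\<^sub>1 \<in> \<T>\<^sub>1 \<Longrightarrow> \<phi>\<^sub>2 \<in> \<T>\<^sub>2 \<Longrightarrow>
      continuous_map (subtopology M (triv_dom \<phi>\<^sub>1 \<inter> triv_dom \<phi>\<^sub>2)) euclidean
        (local_hom V\<^sub>1 \<phi>\<^sub>1 \<phi>\<^sub>2 (\<lambda>x. apply_map (s x)))"
    and s_inv: "\<And>x. x \<in> topspace M \<Longrightarrow> invertible_hom (fibre V\<^sub>1 x) (fibre V\<^sub>2 x) (s x)"
    by (auto simp: bundle_isomorphism_def continuous_hom_section_def)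
  have at: "smooth_atlas M \<A>" using assms(1) by (simp add: smooth_manifold_def)
  have E1: "hilbert_module_bundle M V\<^sub>1" and E2: "hilbert_module_bundle M V\<^sub>2"
    and S1: "smooth_structure M \<A> V\<^sub>1 \<T>\<^sub>1" and S2: "smooth_structure M \<A> V\<^sub>2 \<T>\<^sub>2"
    using assms(3,4) by (auto simp: smooth_hilbert_module_bundle_def)
  have triv1: "\<And>\<phi>. \<phi> \<in> \<T>\<^sub>1 \<Longrightarrow> local_trivialization M V\<^sub>1 \<phi>"
    and triv2: "\<And>\<phi>. \<phi> \<in> \<T>\<^sub>2 \<Longrightarrow> local_trivialization M V\<^sub>2 \<phi>"
    and trans1: "\<And>\<phi> \<psi>. \<phi> \<in> \<T>\<^sub>1 \<Longrightarrow> \<psi> \<in> \<T>\<^sub>1 \<Longrightarrow>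
      smooth_map_on \<A> (triv_dom \<phi> \<inter> triv_dom \<psi>) (local_hom V\<^sub>1 \<phi> \<psi> (\<lambda>x v. v))"
    and trans2: "\<And>\<phi> \<psi>. \<phi> \<in> \<T>\<^sub>2 \<Longrightarrow> \<psi> \<in> \<T>\<^sub>2 \<Longrightarrow>
      smooth_map_on \<A> (triv_dom \<phi> \<inter> triv_dom \<psi>) (local_hom V\<^sub>2 \<phi> \<psi> (\<lambda>x v. v))"
    using S1 S2 by (auto simp: smooth_structure_def)
  have fib1: "hilbert_module (fibre V\<^sub>1 x)" and fib2: "hilbert_module (fibre V\<^sub>2 x)" if "x \<in> topspace M" for x
    using that hilbert_module_bundle.fibre_hilbert_module[OF E1] hilbert_module_bundle.fibre_hilbert_module[OF E2] by auto
  have "\<exists>\<phi>\<^sub>1 \<phi>\<^sub>2 G T. \<phi>\<^sub>1 \<in> \<T>\<^sub>1 \<and> \<phi>\<^sub>2 \<in> \<T>\<^sub>2 \<and> openin M G \<and> x\<^sub>0 \<in> G \<and> G \<subseteq> triv_dom \<phi>\<^sub>1 \<inter> triv_dom \<phi>\<^sub>2 \<and>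
      T \<in> Hom (model_fibre \<phi>\<^sub>1) (model_fibre \<phi>\<^sub>2) \<and>
      (\<forall>x\<in>G. \<forall>v\<in>carrier (fibre V\<^sub>1 x).
        norm (apply_map (constant_hom V\<^sub>1 \<phi>\<^sub>1 V\<^sub>2 \<phi>\<^sub>2 T x) v - apply_map (s x) v) \<le> norm (apply_map (s x) v) / 8)"
    if x0: "x\<^sub>0 \<in> topspace M" for x\<^sub>0
  proof -
    have "x\<^sub>0 \<in> (\<Union>\<phi>\<in>\<T>\<^sub>1. triv_dom \<phi>)" "x\<^sub>0 \<in> (\<Union>\<phi>\<in>\<T>\<^sub>2. triv_dom \<phi>)"
      using x0 S1 S2 by (auto simp: smooth_structure_def)
    then obtain \<phi>\<^sub>1 \<phi>\<^sub>2 where \<phi>: "\<phi>\<^sub>1 \<in> \<T>\<^sub>1" "x\<^sub>0 \<in> triv_dom \<phi>\<^sub>1" "\<phi>\<^sub>2 \<in> \<T>\<^sub>2" "x\<^sub>0 \<in> triv_dom \<phi>\<^sub>2"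
      by blast
    show ?thesis
      using constant_hom_approximates[OF E1 triv1[OF \<phi>(1)] \<phi>(2) E2 triv2[OF \<phi>(3)] \<phi>(4) s_Hom s_inv[OF x0]
          s_cont[OF \<phi>(1,3)]] \<phi>(1,3) by blast
  qed
  then obtain \<phi>\<^sub>1 \<phi>\<^sub>2 G T where loc: "\<And>x\<^sub>0. x\<^sub>0 \<in> topspace M \<Longrightarrow> \<phi>\<^sub>1 x\<^sub>0 \<in> \<T>\<^sub>1 \<and> \<phi>\<^sub>2 x\<^sub>0 \<in> \<T>\<^sub>2 \<and>
      openin M (G x\<^sub>0) \<and> x\<^sub>0 \<in> G x\<^sub>0 \<and> G x\<^sub>0 \<subseteq> triv_dom (\<phi>\<^sub>1 x\<^sub>0) \<inter> triv_dom (\<phi>\<^sub>2 x\<^sub>0) \<and>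
      T x\<^sub>0 \<in> Hom (model_fibre (\<phi>\<^sub>1 x\<^sub>0)) (model_fibre (\<phi>\<^sub>2 x\<^sub>0)) \<and>
      (\<forall>x\<in>G x\<^sub>0. \<forall>v\<in>carrier (fibre V\<^sub>1 x).
        norm (apply_map (constant_hom V\<^sub>1 (\<phi>\<^sub>1 x\<^sub>0) V\<^sub>2 (\<phi>\<^sub>2 x\<^sub>0) (T x\<^sub>0) x) v - apply_map (s x) v)
          \<le> norm (apply_map (s x) v) / 8)"
    by metis
  have Gnb: "openin M (G x) \<and> x \<in> G x" if "x \<in> topspace M" for x
    using loc[OF that] by simp
  obtain I :: "'m set set" and c C and \<beta> :: "'m set \<Rightarrow> 'm \<Rightarrow> real"
    where c: "\<And>i. i \<in> I \<Longrightarrow> c i \<in> topspace M" and C_closed: "\<And>i. i \<in> I \<Longrightarrow> closedin M (C i)"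
      and C_sub: "\<And>i. i \<in> I \<Longrightarrow> C i \<subseteq> G (c i)"
      and \<beta>_smooth: "\<And>i. i \<in> I \<Longrightarrow> smooth_map_on \<A> (topspace M) (\<beta> i)"
      and \<beta>_nonneg: "\<And>i x. i \<in> I \<Longrightarrow> 0 \<le> \<beta> i x" and \<beta>_0: "\<And>i x. i \<in> I \<Longrightarrow> x \<notin> C i \<Longrightarrow> \<beta> i x = 0"
      and \<beta>_pos: "\<And>x. x \<in> topspace M \<Longrightarrow> \<exists>i\<in>I. 0 < \<beta> i x"
      and fin: "\<And>x. x \<in> topspace M \<Longrightarrow> \<exists>N. openin M N \<and> x \<in> N \<and> finite {i \<in> I. C i \<inter> N \<noteq> {}}"
    by (rule smooth_partition[OF assms(1,2) Gnb]) (assumption, rule that)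
  define \<tau> where "\<tau> i = constant_hom V\<^sub>1 (\<phi>\<^sub>1 (c i)) V\<^sub>2 (\<phi>\<^sub>2 (c i)) (T (c i))" for i
  \<comment> \<open>Membership in \<open>C i\<close> puts \<open>x\<close> into the domains of the
    trivializations that define \<open>\<tau> i\<close>. The indices left out have coefficient 0 at
    \<open>x\<close>.\<close>
  define J where "J x = {i \<in> I. x \<in> C i}" for x
  define t where "t x = (\<Sum>i\<in>J x. \<beta> i x *\<^sub>R \<tau> i x)" for x
  have J_dom: "x \<in> triv_dom (\<phi>\<^sub>1 (c i))" "x \<in> triv_dom (\<phi>\<^sub>2 (c i))" "x \<in> G (c i)" "i \<in> I" if "i \<in> J x" for i x
    using that C_sub[of i] loc[OF c[of i]] unfolding J_def by blast+
  have \<tau>_Hom: "\<tau> i x \<in> Hom (fibre V\<^sub>1 x) (fibre V\<^sub>2 x)" if i: "i \<in> J x" for i x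
    unfolding \<tau>_def using loc[OF c[OF J_dom(4)[OF i]]]
    by (intro constant_hom_Hom(1)[OF E1 triv1 J_dom(1)[OF i] E2 triv2 J_dom(2)[OF i]]) blast+
  have t_Hom: "t x \<in> Hom (fibre V\<^sub>1 x) (fibre V\<^sub>2 x)" if x: "x \<in> topspace M" for x
    unfolding t_def using subspace_Hom[OF fib1[OF x] fib2[OF x]] \<tau>_Hom
    by (intro subspace_sum subspace_scale) auto
  have t_inv: "invertible_hom (fibre V\<^sub>1 x) (fibre V\<^sub>2 x) (t x)" if x: "x \<in> topspace M" for x
  proof (rule invertible_hom_perturb[OF fib1[OF x] fib2[OF x] s_inv[OF x] t_Hom[OF x], of "\<Sum>i\<in>J x. \<beta> i x"])
    obtain N where N: "openin M N" "x \<in> N" "finite {i \<in> I. C i \<inter> N \<noteq> {}}" using fin[OF x] by blast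
    have "J x \<subseteq> {i \<in> I. C i \<inter> N \<noteq> {}}" using N(2) by (auto simp: J_def)
    then have finJ: "finite (J x)" using N(3) by (rule finite_subset)
    obtain i where i: "i \<in> I" "0 < \<beta> i x" using \<beta>_pos[OF x] by blast
    then have "i \<in> J x" using \<beta>_0[of i x] by (auto simp: J_def)
    then show "0 < (\<Sum>i\<in>J x. \<beta> i x)"
      using i(2) finJ \<beta>_nonneg J_dom(4) by (intro sum_pos2[of _ i]) auto
    fix v assume v: "v \<in> carrier (fibre V\<^sub>1 x)"
    have "apply_map (t x) v - (\<Sum>i\<in>J x. \<beta> i x) *\<^sub>R apply_map (s x) v
        = (\<Sum>i\<in>J x. \<beta> i x *\<^sub>R (apply_map (\<tau> i x) v - apply_map (s x) v))"
      by (simp add: t_def apply_map_sum apply_map_scaleR scaleR_sum_left scaleR_diff_right sum_subtractf)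
    also have "norm \<dots> \<le> (\<Sum>i\<in>J x. \<beta> i x * (norm (apply_map (s x) v) / 8))"
    proof (rule sum_norm_le)
      fix i assume i: "i \<in> J x"
      have "norm (apply_map (\<tau> i x) v - apply_map (s x) v) \<le> norm (apply_map (s x) v) / 8"
        unfolding \<tau>_def using loc[OF c[OF J_dom(4)[OF i]]] J_dom(3)[OF i] v by blast
      then show "norm (\<beta> i x *\<^sub>R (apply_map (\<tau> i x) v - apply_map (s x) v)) \<le> \<beta> i x * (norm (apply_map (s x) v) / 8)"
        using \<beta>_nonneg[OF J_dom(4)[OF i], of x] by (simp add: mult_left_mono del: times_divide_eq_right)
    qed
    finally show "norm (apply_map (t x) v - (\<Sum>i\<in>J x. \<beta> i x) *\<^sub>R apply_map (s x) v)
        \<le> (\<Sum>i\<in>J x. \<beta> i x) * norm (apply_map (s x) v) / 8"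
      by (simp add: sum_distrib_right sum_divide_distrib)
  qed
  have t_smooth: "smooth_map_on \<A> (triv_dom \<psi>\<^sub>1 \<inter> triv_dom \<psi>\<^sub>2) (local_hom V\<^sub>1 \<psi>\<^sub>1 \<psi>\<^sub>2 (\<lambda>x. apply_map (t x)))"
    if \<psi>: "\<psi>\<^sub>1 \<in> \<T>\<^sub>1" "\<psi>\<^sub>2 \<in> \<T>\<^sub>2" for \<psi>\<^sub>1 \<psi>\<^sub>2
  proof -
    let ?D = "triv_dom \<psi>\<^sub>1 \<inter> triv_dom \<psi>\<^sub>2"
    let ?L = "\<lambda>i. local_hom V\<^sub>1 \<psi>\<^sub>1 \<psi>\<^sub>2 (\<lambda>x. apply_map (\<tau> i x))"
    note \<psi>1 = triv1[OF \<psi>(1)] and \<psi>2 = triv2[OF \<psi>(2)]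
    have D: "openin M ?D" using local_trivializationD(1)[OF \<psi>1] local_trivializationD(1)[OF \<psi>2] by (rule openin_Int)
    have DM: "?D \<subseteq> topspace M" using D by (rule openin_subset)
    define g where "g i x = (if x \<in> C i then \<beta> i x *\<^sub>R ?L i x else 0)" for i x
    have g_smooth: "smooth_map_on \<A> ?D (g i)" if i: "i \<in> I" for i
    proof (rule smooth_map_on_local[OF at])
      fix p assume p: "p \<in> ?D"
      show "\<exists>N. openin M N \<and> p \<in> N \<and> smooth_map_on \<A> N (g i)"
      proof (cases "p \<in> C i")
        case True
        note ci = loc[OF c[OF i]]
        have \<phi>1: "\<phi>\<^sub>1 (c i) \<in> \<T>\<^sub>1" and \<phi>2: "\<phi>\<^sub>2 (c i) \<in> \<T>\<^sub>2"
          and T: "T (c i) \<in> Hom (model_fibre (\<phi>\<^sub>1 (c i))) (model_fibre (\<phi>\<^sub>2 (c i)))"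
          using ci by simp_all
        \<comment> \<open>A full neighbourhood, possibly reaching beyond \<open>C i\<close>, is
          needed at boundary points of \<open>C i\<close>; the domains of the trivializations
          provide it.\<close>
        define N where "N = ?D \<inter> (triv_dom (\<phi>\<^sub>1 (c i)) \<inter> triv_dom (\<phi>\<^sub>2 (c i)))"
        have N: "openin M N"
          unfolding N_def using D local_trivializationD(1)[OF triv1[OF \<phi>1]] local_trivializationD(1)[OF triv2[OF \<phi>2]]
          by blast
        have mem: "x \<in> triv_dom \<psi>\<^sub>1" "x \<in> triv_dom \<psi>\<^sub>2" "x \<in> triv_dom (\<phi>\<^sub>1 (c i))" "x \<in> triv_dom (\<phi>\<^sub>2 (c i))"
          if "x \<in> N" for x using that by (auto simp: N_def)
        have tr1: "smooth_map_on \<A> N (local_hom V\<^sub>1 \<psi>\<^sub>1 (\<phi>\<^sub>1 (c i)) (\<lambda>x v. v))"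
          by (rule smooth_map_on_subset[OF trans1[OF \<psi>(1) \<phi>1]]) (auto simp: N_def)
        have tr2: "smooth_map_on \<A> N (local_hom V\<^sub>2 (\<phi>\<^sub>2 (c i)) \<psi>\<^sub>2 (\<lambda>x v. v))"
          by (rule smooth_map_on_subset[OF trans2[OF \<phi>2 \<psi>(2)]]) (auto simp: N_def)
        note H1 = transition_Hom(1)[OF E1 \<psi>1 mem(1) triv1[OF \<phi>1] mem(3)]
          and H2 = transition_Hom(1)[OF E2 triv2[OF \<phi>2] mem(4) \<psi>2 mem(2)]
        note mods = local_trivializationD(2)[OF \<psi>1] local_trivializationD(2)[OF triv1[OF \<phi>1]]
          local_trivializationD(2)[OF triv2[OF \<phi>2]] local_trivializationD(2)[OF \<psi>2]
        have "smooth_map_on \<A> N (\<lambda>x. comp_map (T (c i)) (local_hom V\<^sub>1 \<psi>\<^sub>1 (\<phi>\<^sub>1 (c i)) (\<lambda>x v. v) x))"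
          by (rule smooth_map_on_comp_map[OF at mods(1-3) N smooth_map_on_const tr1 T H1])
        then have "smooth_map_on \<A> N (\<lambda>x. comp_map (local_hom V\<^sub>2 (\<phi>\<^sub>2 (c i)) \<psi>\<^sub>2 (\<lambda>x v. v) x)
            (comp_map (T (c i)) (local_hom V\<^sub>1 \<psi>\<^sub>1 (\<phi>\<^sub>1 (c i)) (\<lambda>x v. v) x)))"
          by (rule smooth_map_on_comp_map[OF at mods(1,3,4) N tr2 _ H2 comp_map_Hom[OF T H1]])
        then have "smooth_map_on \<A> N (?L i)"
          by (rule smooth_map_on_cong[OF at N])
            (use local_hom_constant_hom[OF E1 triv1[OF \<phi>1] mem(3) \<psi>1 mem(1) E2 triv2[OF \<phi>2] mem(4) \<psi>2 mem(2) T]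
              in \<open>simp add: \<tau>_def\<close>)
        moreover have "smooth_map_on \<A> N (\<beta> i)"
          by (rule smooth_map_on_subset[OF \<beta>_smooth[OF i] openin_subset[OF N]])
        ultimately have "smooth_map_on \<A> N (\<lambda>x. \<beta> i x *\<^sub>R ?L i x)"
          by (intro smooth_map_on_scaleR[OF at N])
        \<comment> \<open>On the part of \<open>N\<close> outside \<open>C i\<close> the coefficient
          \<open>\<beta> i\<close> already vanishes, so the cut-off changes nothing.\<close>
        then have "smooth_map_on \<A> N (g i)"
          by (rule smooth_map_on_cong[OF at N]) (simp add: g_def \<beta>_0[OF i])
        moreover have "p \<in> N"
          using p True J_dom(1,2)[of i p] i by (auto simp: N_def J_def)
        ultimately show ?thesis using N by blast
      next
        case False
        have op: "openin M (?D - C i)" using D C_closed[OF i] by (rule openin_diff)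
        have "smooth_map_on \<A> (?D - C i) (g i)"
          by (rule smooth_map_on_cong[OF at op smooth_map_on_const[of _ _ 0]]) (simp add: g_def)
        then show ?thesis using op p False by blast
      qed
    qed
    show ?thesis
    proof (rule smooth_map_on_local[OF at])
      fix p assume p: "p \<in> ?D"
      then obtain N where N: "openin M N" "p \<in> N" "finite {i \<in> I. C i \<inter> N \<noteq> {}}" using fin DM by blast
      let ?F = "{i \<in> I. C i \<inter> N \<noteq> {}}"
      have op: "openin M (?D \<inter> N)" using D N(1) by (rule openin_Int)
      have "smooth_map_on \<A> (?D \<inter> N) (g i)" if "i \<in> ?F" for i
        by (rule smooth_map_on_subset[OF g_smooth]) (use that in auto)
      then have "smooth_map_on \<A> (?D \<inter> N) (\<lambda>x. \<Sum>i\<in>?F. g i x)"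
        by (rule smooth_map_on_sum[OF at op])
      moreover have "(\<Sum>i\<in>?F. g i x) = local_hom V\<^sub>1 \<psi>\<^sub>1 \<psi>\<^sub>2 (\<lambda>x. apply_map (t x)) x" if x: "x \<in> ?D \<inter> N" for x
      proof -
        \<comment> \<open>\<open>J x\<close> varies with \<open>x\<close>, whereas \<open>?F\<close>
          serves all points of \<open>N\<close>; the additional summands are zero by the
          cut-off.\<close>
        have "(\<Sum>i\<in>?F. g i x) = (\<Sum>i\<in>J x. g i x)"
          using x N(3) by (intro sum.mono_neutral_right) (auto simp: J_def g_def)
        also have "\<dots> = (\<Sum>i\<in>J x. \<beta> i x *\<^sub>R ?L i x)"
          by (intro sum.cong) (auto simp: J_def g_def)
        \<comment> \<open>The index set is frozen at \<open>J x\<close> while the argument of the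
          section is \<open>y\<close>. Since \<open>local_hom\<close> at \<open>x\<close> uses only
          the value of the section at \<open>x\<close>, this agrees with \<open>t\<close>.\<close>
        also have "\<dots> = local_hom V\<^sub>1 \<psi>\<^sub>1 \<psi>\<^sub>2 (\<lambda>y. apply_map (\<Sum>i\<in>J x. \<beta> i y *\<^sub>R \<tau> i y)) x"
          using x \<tau>_Hom by (intro local_hom_linear[OF E1 \<psi>1 _ E2 \<psi>2, symmetric]) auto
        also have "\<dots> = local_hom V\<^sub>1 \<psi>\<^sub>1 \<psi>\<^sub>2 (\<lambda>x. apply_map (t x)) x"
          by (simp add: local_hom_def t_def)
        finally show ?thesis .
      qed
      ultimately have "smooth_map_on \<A> (?D \<inter> N) (local_hom V\<^sub>1 \<psi>\<^sub>1 \<psi>\<^sub>2 (\<lambda>x. apply_map (t x)))"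
        by (rule smooth_map_on_cong[OF at op])
      then show "\<exists>N. openin M N \<and> p \<in> N \<and> smooth_map_on \<A> N (local_hom V\<^sub>1 \<psi>\<^sub>1 \<psi>\<^sub>2 (\<lambda>x. apply_map (t x)))"
        using op p N(2) by blast
    qed
  qed
  have "continuous_map (subtopology M (triv_dom \<psi>\<^sub>1 \<inter> triv_dom \<psi>\<^sub>2)) euclidean
      (local_hom V\<^sub>1 \<psi>\<^sub>1 \<psi>\<^sub>2 (\<lambda>x. apply_map (t x)))" if \<psi>: "\<psi>\<^sub>1 \<in> \<T>\<^sub>1" "\<psi>\<^sub>2 \<in> \<T>\<^sub>2" for \<psi>\<^sub>1 \<psi>\<^sub>2
    by (rule smooth_map_on_imp_continuous_map[OF at openin_Int t_smooth[OF \<psi>]])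
      (rule local_trivializationD(1)[OF triv1[OF \<psi>(1)]] local_trivializationD(1)[OF triv2[OF \<psi>(2)]])+
  then have "smooth_bundle_isomorphism M \<A> V\<^sub>1 \<T>\<^sub>1 V\<^sub>2 \<T>\<^sub>2 t"
    using t_Hom t_inv t_smooth
    by (simp add: smooth_bundle_isomorphism_def bundle_isomorphism_def continuous_hom_section_def smooth_hom_section_def)
  then show ?thesis by blast
qed

end
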